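(* Let $G$ be a graph. (i) If $\mathrm{Mad}(G) < \frac{26}{11}$, then $\chi_s(G)\leq 4$. (ii) If $\mathrm{Mad}(G) < \frac{18}{7}$ and $g(G)\geq 6$, then $\chi_s(G)\leq 5$. (iii) If $\mathrm{Mad}(G) < \frac{8}{3}$ and $g(G)\geq 6$, then $\chi_s(G)\leq 6$.
   Context: Graphs are finite and simple. A proper vertex coloring of a graph is a star coloring if the union of every two color classes induces a star forest, i.e. a graph each of whose connected components is a star $K_{1,m}$ with $m\ge 0$ (equivalently, no path on four vertices, as a not necessarily induced subgraph, is colored with only two colors). The star chromatic number $\chi_s(G)$ is the smallest $k$ such that $G$ has a star coloring using $k$ colors. The maximum average degree is $\mathrm{Mad}(G)=\max\{2|E(H)|/|V(H)| : H\subseteq G\}$, the maximum being over subgraphs $H$ with at least one vertex. The girth $g(G)$ is the length of a shortest cycle in $G$ (with $g(G)=\infty$ if $G$ has no cycle). *)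

theory Defs
  imports
    Complex_Main
    "HOL-Library.Extended_Nat"
    "Graph_Theory.Graph_Theory"
begin

text \<open>
  Finite simple graphs are the loop-free symmetric digraphs without parallel arcs of the locale
  \<^locale>\<open>graph\<close>: an undirected edge joining \<open>u\<close> and \<open>v\<close> is represented by the two arcs
  \<open>(u, v)\<close> and \<open>(v, u)\<close>.
\<close>

definition edges :: "('a, 'b) pre_digraph \<Rightarrow> 'a set set" where
  "edges G = {{u, v} |u v. (u, v) \<in> arcs_ends G}"

text \<open>
  The requirement \<open>graph H\<close> makes \<open>H\<close> contain both or neither of the two arcs of an edge.
  For the graph without vertices the maximum is over the empty set and is unspecified.
\<close>

definition Mad :: "('a, 'b) pre_digraph \<Rightarrow> real" where
  "Mad G = Max {2 * real (card (edges H)) / real (card (verts H)) |H.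
                  subgraph H G \<and> graph H \<and> verts H \<noteq> {}}"

text \<open>
  The closed walk \<open>u, v, u\<close> along an edge and back counts as a \<^const>\<open>pre_digraph.cycle\<close>
  of a symmetric digraph; requiring length at least 3 leaves exactly the undirected cycles.
  The infimum of the empty set is \<open>\<infinity>\<close>.
\<close>

definition girth :: "('a, 'b) pre_digraph \<Rightarrow> enat" where
  "girth G = Inf {enat (length p) |p. pre_digraph.cycle G p \<and> 3 \<le> length p}"

text \<open>
  In a symmetric digraph the strongly connected components are the connected components
  of the underlying undirected graph.
\<close>

definition star_forest :: "('a, 'b) pre_digraph \<Rightarrow> bool" where
  "star_forest G \<longleftrightarrow> (\<forall>H \<in> pre_digraph.sccs G. \<exists>m. complete_bipartite_digraph 1 m H)"

definition proper_coloring :: "('a, 'b) pre_digraph \<Rightarrow> ('a \<Rightarrow> 'c) \<Rightarrow> bool" where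
  "proper_coloring G c \<longleftrightarrow> (\<forall>(u, v) \<in> arcs_ends G. c u \<noteq> c v)"

definition color_class :: "('a, 'b) pre_digraph \<Rightarrow> ('a \<Rightarrow> 'c) \<Rightarrow> 'c \<Rightarrow> 'a set" where
  "color_class G c i = {v \<in> verts G. c v = i}"

definition star_coloring :: "('a, 'b) pre_digraph \<Rightarrow> ('a \<Rightarrow> 'c) \<Rightarrow> bool" where
  "star_coloring G c \<longleftrightarrow> proper_coloring G c \<and>
     (\<forall>i j. i \<noteq> j \<longrightarrow> star_forest (G \<restriction> (color_class G c i \<union> color_class G c j)))"

definition star_chromatic_number :: "('a, 'b) pre_digraph \<Rightarrow> nat" where
  "star_chromatic_number G =
     (LEAST k. \<exists>c :: 'a \<Rightarrow> nat. c ` verts G \<subseteq> {..<k} \<and> star_coloring G c)"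

end

theory Submission
  imports Defs
begin

text \<open>
  Call a colouring with colours \<open>0, \<dots>, r\<close> good if colour 0 induces a forest, the other classes are
  independent, and no vertex has two neighbours of the same colour larger than its own. Splitting the
  forest into three classes by the depth modulo 3 turns a good colouring into a star colouring with
  \<open>r + 3\<close> colours. Hence it suffices to exclude a minimal set \<open>S\<close> of vertices without a good colouring,
  where \<open>r\<close> is 1, 2, 3 in the three parts, by discharging.

  For girth at least 6 the configurations are local: a vertex \<open>x\<close> with its neighbours of degree 2 and of
  small degree is deleted, and a good colouring of the rest is extended.

  For \<open>r = 1\<close> local configurations do not suffice. A vertex of degree 3 with two neighbours on threads of
  two vertices of degree 2 (\<open>bad\<close>) lacks charge 1. The vertices \<open>bad\<close>, \<open>weak\<close>, \<open>triple\<close>, \<open>link\<close> that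
  cannot receive this charge locally induce a graph \<open>W\<close> in which only \<open>bad\<close> vertices have degree 3. A cycle of
  \<open>W\<close> through such a vertex is reducible: it is coloured once around. Hence \<open>W\<close> has average degree at
  most 2, which says that charge enters \<open>W\<close> from outside as often as it is lacking.
\<close>

section \<open>Good colourings\<close>

locale sgraph =
  fixes E :: "'a \<Rightarrow> 'a \<Rightarrow> bool"
  assumes sym: "E u v \<Longrightarrow> E v u" and irrefl: "\<not> E u u"
begin

definition nb :: "'a set \<Rightarrow> 'a \<Rightarrow> 'a set" where
  "nb T v = {u \<in> T. E v u}"

definition forest_on :: "'a set \<Rightarrow> bool" where
  "forest_on T \<longleftrightarrow> (\<forall>X \<subseteq> T. X \<noteq> {} \<longrightarrow> (\<exists>v \<in> X. card (nb X v) \<le> 1))"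

definition good :: "nat \<Rightarrow> 'a set \<Rightarrow> ('a \<Rightarrow> nat) \<Rightarrow> bool" where
  "good r T \<phi> \<longleftrightarrow> (\<forall>v \<in> T. \<phi> v \<le> r) \<and>
     (\<forall>u \<in> T. \<forall>v \<in> T. E u v \<and> \<phi> u = \<phi> v \<longrightarrow> \<phi> u = 0) \<and>
     (\<forall>c \<in> T. \<forall>u \<in> T. \<forall>v \<in> T. E c u \<and> E c v \<and> \<phi> u = \<phi> v \<and> \<phi> c < \<phi> u \<longrightarrow> u = v) \<and>
     forest_on {v \<in> T. \<phi> v = 0}"

definition isolated :: "'a set \<Rightarrow> ('a \<Rightarrow> nat) \<Rightarrow> 'a \<Rightarrow> bool" where
  "isolated T \<phi> z \<longleftrightarrow> \<phi> z = 0 \<and> (\<forall>u \<in> nb T z. \<phi> u \<noteq> 0)"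

definition free :: "'a set \<Rightarrow> ('a \<Rightarrow> nat) \<Rightarrow> 'a \<Rightarrow> nat \<Rightarrow> bool" where
  "free T \<phi> z j \<longleftrightarrow> \<phi> z \<noteq> j \<and> (\<phi> z < j \<longrightarrow> (\<forall>y \<in> nb T z. \<phi> y \<noteq> j))"

definition normal :: "nat \<Rightarrow> 'a set \<Rightarrow> ('a \<Rightarrow> nat) \<Rightarrow> bool" where
  "normal r T \<phi> \<longleftrightarrow> good r T \<phi> \<and> (\<forall>w \<in> T. \<phi> w \<noteq> 0 \<longrightarrow>
     (\<exists>a \<in> nb T w. \<exists>b \<in> nb T w. a \<noteq> b \<and> \<phi> a = \<phi> b \<and> \<phi> a < \<phi> w))"

lemma in_nb [simp]: "u \<in> nb T v \<longleftrightarrow> u \<in> T \<and> E v u"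
  by (simp add: nb_def)

lemma finite_nb [simp]: "finite T \<Longrightarrow> finite (nb T v)"
  by (simp add: nb_def)

lemma nb_mono: "T \<subseteq> T' \<Longrightarrow> nb T v \<subseteq> nb T' v"
  by auto

lemma E_commute: "E u v \<longleftrightarrow> E v u"
  using sym by blast

lemma forest_on_mono: "forest_on T \<Longrightarrow> T' \<subseteq> T \<Longrightarrow> forest_on T'"
  unfolding forest_on_def by (meson subset_trans)

lemma good_edge: "\<lbrakk>good r T \<phi>; u \<in> T; v \<in> T; E u v; \<phi> u = \<phi> v\<rbrakk> \<Longrightarrow> \<phi> u = 0"
  unfolding good_def by blast

lemma good_centre:
  "\<lbrakk>good r T \<phi>; c \<in> T; u \<in> T; v \<in> T; E c u; E c v; \<phi> u = \<phi> v; \<phi> c < \<phi> u\<rbrakk> \<Longrightarrow> u = v"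
  unfolding good_def by blast

lemma good_le: "good r T \<phi> \<Longrightarrow> v \<in> T \<Longrightarrow> \<phi> v \<le> r"
  unfolding good_def by blast

lemma goodI:
  assumes "\<And>v. v \<in> T \<Longrightarrow> \<phi> v \<le> r"
    and "\<And>u v. \<lbrakk>u \<in> T; v \<in> T; E u v; \<phi> u = \<phi> v\<rbrakk> \<Longrightarrow> \<phi> u = 0"
    and "\<And>c u v. \<lbrakk>c \<in> T; u \<in> T; v \<in> T; E c u; E c v; \<phi> u = \<phi> v; \<phi> c < \<phi> u\<rbrakk> \<Longrightarrow> u = v"
    and "forest_on {v \<in> T. \<phi> v = 0}"
  shows "good r T \<phi>"
  using assms unfolding good_def by blast

lemma good_mono:
  assumes "good r T \<phi>" "T' \<subseteq> T"
  shows "good r T' \<phi>"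
proof (rule goodI)
  show "forest_on {v \<in> T'. \<phi> v = 0}"
    by (rule forest_on_mono[of "{v \<in> T. \<phi> v = 0}"]) (use assms in \<open>auto simp: good_def\<close>)
  show "\<phi> v \<le> r" if "v \<in> T'" for v
    using good_le[OF assms(1)] assms(2) that by blast
  show "\<phi> u = 0" if "u \<in> T'" "v \<in> T'" "E u v" "\<phi> u = \<phi> v" for u v
    using good_edge[OF assms(1)] assms(2) that by blast
  show "u = v" if "c \<in> T'" "u \<in> T'" "v \<in> T'" "E c u" "E c v" "\<phi> u = \<phi> v" "\<phi> c < \<phi> u" for c u v
    using good_centre[OF assms(1), of c u v] assms(2) that by blast
qed

lemma forest_on_insert:
  assumes "forest_on F" "finite F"
    and "\<And>u. u \<in> nb F v \<Longrightarrow> u = w \<or> nb F u = {}"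
  shows "forest_on (insert v F)"
  unfolding forest_on_def
proof (intro allI impI)
  fix X assume X: "X \<subseteq> insert v F" "X \<noteq> {}"
  have finX: "finite X" using X assms(2) finite_subset by blast
  show "\<exists>v\<in>X. card (nb X v) \<le> 1"
  proof (cases "v \<in> X")
    case False
    then show ?thesis using X assms(1) unfolding forest_on_def by blast
  next
    case True
    show ?thesis
    proof (cases "\<exists>u \<in> nb X v. u \<noteq> w")
      case True
      then obtain u where u: "u \<in> X" "E v u" "u \<noteq> w" by auto
      then have "u \<in> nb F v" using X irrefl by auto
      then have "nb F u = {}" using assms(3) u by blast
      then have "nb X u \<subseteq> {v}" using X by (fastforce simp: nb_def)
      then have "card (nb X u) \<le> card {v}" by (intro card_mono) auto
      then show ?thesis using u by auto
    next
      case False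
      then have "nb X v \<subseteq> {w}" by blast
      then have "card (nb X v) \<le> card {w}" by (intro card_mono) auto
      then show ?thesis using True by auto
    qed
  qed
qed

lemma add_forest_vertex:
  assumes g: "good r T \<phi>" and fin: "finite T" and v: "v \<notin> T"
    and distinct: "\<forall>u \<in> nb T v. \<forall>u' \<in> nb T v. \<phi> u = \<phi> u' \<longrightarrow> \<phi> u \<noteq> 0 \<longrightarrow> u = u'"
    and leaf: "\<forall>u \<in> nb T v. \<phi> u = 0 \<longrightarrow> u = w \<or> isolated T \<phi> u"
  shows "\<exists>\<psi>. good r (insert v T) \<psi> \<and> \<psi> v = 0 \<and> (\<forall>u \<in> T. \<psi> u = \<phi> u)"
proof -
  let ?\<psi> = "\<phi>(v := 0)"
  let ?F = "{v \<in> T. \<phi> v = 0}"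
  have "good r (insert v T) ?\<psi>"
  proof (rule goodI)
    show "?\<psi> u \<le> r" if "u \<in> insert v T" for u
      using good_le[OF g] that by auto
    show "?\<psi> u = 0" if "u \<in> insert v T" "u' \<in> insert v T" "E u u'" "?\<psi> u = ?\<psi> u'" for u u'
      using good_edge[OF g, of u u'] that by (auto split: if_splits)
    show "u = u'" if *: "c \<in> insert v T" "u \<in> insert v T" "u' \<in> insert v T"
      and h: "E c u" "E c u'" "?\<psi> u = ?\<psi> u'" "?\<psi> c < ?\<psi> u" for c u u'
    proof -
      have "u \<noteq> v" "u' \<noteq> v" using h by (auto split: if_splits)
      then show "u = u'"
        using * h good_centre[OF g, of c u u'] distinct[rule_format, of u u'] by (cases "c = v") auto
    qed
    have "forest_on (insert v ?F)"
    proof (rule forest_on_insert)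
      show "forest_on ?F" using g by (simp add: good_def)
      show "finite ?F" using fin by simp
      show "u = w \<or> nb ?F u = {}" if "u \<in> nb ?F v" for u
        using leaf[rule_format, of u] that by (auto simp: isolated_def nb_def)
    qed
    moreover have "{u \<in> insert v T. ?\<psi> u = 0} = insert v ?F" using v by auto
    ultimately show "forest_on {u \<in> insert v T. ?\<psi> u = 0}" by simp
  qed
  then show ?thesis using v by (intro exI[of _ ?\<psi>]) auto
qed

lemma add_coloured_vertex:
  assumes g: "good r T \<phi>" and v: "v \<notin> T" and j: "1 \<le> j" "j \<le> r"
    and free: "\<forall>z \<in> nb T v. free T \<phi> z j"
    and distinct: "\<forall>u \<in> nb T v. \<forall>u' \<in> nb T v. \<phi> u = \<phi> u' \<longrightarrow> j < \<phi> u \<longrightarrow> u = u'"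
  shows "\<exists>\<psi>. good r (insert v T) \<psi> \<and> \<psi> v = j \<and> (\<forall>u \<in> T. \<psi> u = \<phi> u)"
proof -
  let ?\<psi> = "\<phi>(v := j)"
  have free1: "\<phi> z \<noteq> j" if "z \<in> T" "E v z" for z using free[rule_format, of z] that by (simp add: free_def)
  have free2: "\<phi> y \<noteq> j" if "z \<in> T" "E v z" "\<phi> z < j" "y \<in> T" "E z y" for z y
    using free[rule_format, of z] that by (simp add: free_def)
  have "good r (insert v T) ?\<psi>"
  proof (rule goodI)
    show "?\<psi> u \<le> r" if "u \<in> insert v T" for u
      using good_le[OF g] j that by auto
    show "?\<psi> u = 0" if "u \<in> insert v T" "u' \<in> insert v T" "E u u'" "?\<psi> u = ?\<psi> u'" for u u'
    proof -
      have "u \<noteq> u'" using that irrefl by auto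
      then show "?\<psi> u = 0"
        using that good_edge[OF g, of u u'] free1[of u] free1[of u'] sym[of u u'] by (auto split: if_splits)
    qed
    show "u = u'" if *: "c \<in> insert v T" "u \<in> insert v T" "u' \<in> insert v T"
      and h: "E c u" "E c u'" "?\<psi> u = ?\<psi> u'" "?\<psi> c < ?\<psi> u" for c u u'
    proof (cases "c = v")
      case True
      then have "u \<noteq> v" "u' \<noteq> v" using h irrefl by auto
      then show ?thesis using * h True distinct[rule_format, of u u'] v by auto
    next
      case False
      then have c: "c \<in> T" "E v c \<or> v \<notin> {u, u'}" using * h sym[of c v] by auto
      show ?thesis
      proof (rule ccontr)
        assume ne: "u \<noteq> u'"
        show False
          using * h c ne False free2[of c u] free2[of c u'] good_centre[OF g c(1), of u u']
          by (auto split: if_splits)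
      qed
    qed
    have "{u \<in> insert v T. ?\<psi> u = 0} = {v \<in> T. \<phi> v = 0}" using v j by auto
    then show "forest_on {u \<in> insert v T. ?\<psi> u = 0}" using g unfolding good_def by simp
  qed
  then show ?thesis using v by (intro exI[of _ ?\<psi>]) auto
qed

text \<open>A coloured vertex violating the condition in \<^const>\<open>normal\<close> can be moved into the forest;
  this lowers the number of coloured vertices.\<close>

lemma normal_exists:
  assumes "good r T \<phi>" "finite T"
  obtains \<psi> where "normal r T \<psi>"
proof -
  let ?m = "\<lambda>\<phi>. card {v \<in> T. \<phi> v \<noteq> 0}"
  obtain \<psi> where g: "good r T \<psi>" and min: "\<And>\<chi>. good r T \<chi> \<Longrightarrow> ?m \<psi> \<le> ?m \<chi>"
    using ex_has_least_nat[of "good r T" \<phi> ?m] assms(1) by auto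
  have "\<exists>a \<in> nb T w. \<exists>b \<in> nb T w. a \<noteq> b \<and> \<psi> a = \<psi> b \<and> \<psi> a < \<psi> w"
    if w: "w \<in> T" "\<psi> w \<noteq> 0" for w
  proof (rule ccontr)
    assume non: "\<not> ?thesis"
    let ?T = "T - {w}"
    have g': "good r ?T \<psi>" using g good_mono by blast
    have eq: "u = u'" if "u \<in> nb ?T w" "u' \<in> nb ?T w" "\<psi> u = \<psi> u'" for u u'
    proof (cases "\<psi> u < \<psi> w")
      case True
      then show ?thesis using non that by (metis DiffE in_nb)
    next
      case False
      moreover have "\<psi> u \<noteq> \<psi> w" using good_edge[OF g, of w u] w that by auto
      ultimately have "\<psi> w < \<psi> u" by simp
      then show ?thesis using good_centre[OF g, of w u u'] w that by auto
    qed
    have "\<exists>\<chi>. good r (insert w ?T) \<chi> \<and> \<chi> w = 0 \<and> (\<forall>u \<in> ?T. \<chi> u = \<psi> u)"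
    proof (rule add_forest_vertex[OF g', of w "SOME u. u \<in> nb ?T w \<and> \<psi> u = 0"]; (intro ballI impI)?)
      fix u assume "u \<in> nb ?T w" "\<psi> u = 0"
      then have "(SOME u. u \<in> nb ?T w \<and> \<psi> u = 0) = u"
        using eq by (intro some_equality) auto
      then show "u = (SOME u. u \<in> nb ?T w \<and> \<psi> u = 0) \<or> isolated ?T \<psi> u" by simp
    qed (use eq assms(2) in \<open>blast+\<close>)
    then obtain \<chi> where \<chi>: "good r (insert w ?T) \<chi>" "\<chi> w = 0" "\<And>u. u \<in> ?T \<Longrightarrow> \<chi> u = \<psi> u"
      by blast
    have "insert w ?T = T" using w by auto
    then have "?m \<psi> \<le> ?m \<chi>" using min \<chi> by simp
    moreover have "{v \<in> T. \<chi> v \<noteq> 0} \<subset> {v \<in> T. \<psi> v \<noteq> 0}"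
    proof
      show "{v \<in> T. \<chi> v \<noteq> 0} \<subseteq> {v \<in> T. \<psi> v \<noteq> 0}"
      proof
        fix v assume v: "v \<in> {v \<in> T. \<chi> v \<noteq> 0}"
        then have "v \<noteq> w" using \<chi>(2) by auto
        then show "v \<in> {v \<in> T. \<psi> v \<noteq> 0}" using \<chi>(3)[of v] v by auto
      qed
      show "{v \<in> T. \<chi> v \<noteq> 0} \<noteq> {v \<in> T. \<psi> v \<noteq> 0}"
      proof
        assume "{v \<in> T. \<chi> v \<noteq> 0} = {v \<in> T. \<psi> v \<noteq> 0}"
        moreover have "w \<in> {v \<in> T. \<psi> v \<noteq> 0}" using w by simp
        ultimately have "w \<in> {v \<in> T. \<chi> v \<noteq> 0}" by blast
        then show False using \<chi>(2) by simp
      qed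
    qed
    then have "?m \<chi> < ?m \<psi>" using assms(2) by (intro psubset_card_mono) auto
    ultimately show False by simp
  qed
  then have "normal r T \<psi>" using g unfolding normal_def by simp
  then show thesis by (rule that)
qed

lemma normal_good: "normal r T \<phi> \<Longrightarrow> good r T \<phi>"
  by (simp add: normal_def)

lemma normal_pendant:
  assumes "normal r T \<phi>" "finite T" "w \<in> T" "card (nb T w) \<le> 1"
  shows "\<phi> w = 0"
proof (rule ccontr)
  assume "\<phi> w \<noteq> 0"
  then obtain a b where "a \<in> nb T w" "b \<in> nb T w" "a \<noteq> b" using assms unfolding normal_def by blast
  then have "card {a, b} \<le> card (nb T w)" using assms(2) by (intro card_mono) auto
  then show False using assms(4) \<open>a \<noteq> b\<close> by simp
qed

lemma free_or_isolated:
  assumes n: "normal r T \<phi>" and fin: "finite T" and w: "w \<in> T" and deg: "card (nb T w) \<le> r"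
    and noniso: "isolated T \<phi> w \<Longrightarrow> card (nb T w) < r"
  shows "\<exists>j \<in> {1..r}. free T \<phi> w j"
proof (rule ccontr)
  assume no: "\<not> ?thesis"
  then have nf: "\<not> free T \<phi> w j" if "j \<in> {1..r}" for j
    using that by blast
  have cardr: "card {1..r} = r" by simp
  show False
  proof (cases "\<phi> w = 0")
    case True
    have sub: "{1..r} \<subseteq> \<phi> ` (nb T w - {u. \<phi> u = 0})"
    proof
      fix j assume j: "j \<in> {1..r}"
      then obtain y where "y \<in> nb T w" "\<phi> y = j" using nf[OF j] True unfolding free_def by auto
      then show "j \<in> \<phi> ` (nb T w - {u. \<phi> u = 0})" using j by auto
    qed
    have "r \<le> card (nb T w - {u. \<phi> u = 0})"
      using surj_card_le[OF _ sub] cardr fin by simp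
    moreover have "card (nb T w - {u. \<phi> u = 0}) < card (nb T w)" if ni: "\<not> isolated T \<phi> w"
    proof -
      obtain u where "u \<in> nb T w" "\<phi> u = 0" using ni True unfolding isolated_def by auto
      then have "nb T w - {u. \<phi> u = 0} \<subset> nb T w" by blast
      then show ?thesis using fin by (intro psubset_card_mono) simp_all
    qed
    moreover have "card (nb T w - {u. \<phi> u = 0}) \<le> card (nb T w)" using fin by (intro card_mono) auto
    ultimately show False using deg noniso by linarith
  next
    case False
    then obtain a b where ab: "a \<in> nb T w" "b \<in> nb T w" "a \<noteq> b" "\<phi> a = \<phi> b" "\<phi> a < \<phi> w"
      using n w unfolding normal_def by blast
    have sub: "{1..r} \<subseteq> insert (\<phi> w) (\<phi> ` (nb T w - {a, b}))"
    proof
      fix j assume j: "j \<in> {1..r}"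
      show "j \<in> insert (\<phi> w) (\<phi> ` (nb T w - {a, b}))"
      proof (cases "j = \<phi> w")
        case False
        then obtain y where "y \<in> nb T w" "\<phi> y = j" "\<phi> w < j" using nf[OF j] unfolding free_def by auto
        moreover from this have "y \<noteq> a" "y \<noteq> b" using ab by auto
        ultimately show ?thesis by blast
      qed simp
    qed
    have "card (nb T w - {a, b}) = card (nb T w) - 2"
      using ab fin by (subst card_Diff_subset) auto
    moreover have "2 \<le> card (nb T w)"
      using card_mono[of "nb T w" "{a, b}"] ab fin by simp
    moreover have "r \<le> card (insert (\<phi> w) (\<phi> ` (nb T w - {a, b})))"
      using card_mono[OF _ sub] fin cardr by simp
    moreover have "card (insert (\<phi> w) (\<phi> ` (nb T w - {a, b}))) \<le> Suc (card (nb T w - {a, b}))"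
      using card_image_le[of "nb T w - {a, b}" \<phi>] fin by (simp add: card_insert_if)
    ultimately show False using deg by linarith
  qed
qed

lemma add_forest_leaf:
  assumes "good r T \<phi>" "finite T" "v \<notin> T"
    and inj: "\<forall>u \<in> nb T v. \<forall>u' \<in> nb T v. \<phi> u = \<phi> u' \<longrightarrow> u = u'"
  shows "\<exists>\<psi>. good r (insert v T) \<psi> \<and> \<psi> v = 0 \<and> (\<forall>u \<in> T. \<psi> u = \<phi> u)"
proof (rule add_forest_vertex[OF assms(1-3), of "SOME u. u \<in> nb T v \<and> \<phi> u = 0"]; intro ballI impI)
  fix u assume u: "u \<in> nb T v" "\<phi> u = 0"
  have "(SOME u. u \<in> nb T v \<and> \<phi> u = 0) = u"
    by (rule some_equality) (use u inj in auto)
  then show "u = (SOME u. u \<in> nb T v \<and> \<phi> u = 0) \<or> isolated T \<phi> u" by simp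
next
  show "u = u'" if "u \<in> nb T v" "u' \<in> nb T v" "\<phi> u = \<phi> u'" for u u'
    using inj that by blast
qed

lemma add_leaves:
  assumes g: "good r T \<phi>" and fin: "finite T" and finP: "finite P" and disj: "P \<inter> T = {}"
    and inj: "\<forall>b \<in> P. \<forall>u \<in> nb (T \<union> P) b. \<forall>u' \<in> nb (T \<union> P) b.
      (if u \<in> T then \<phi> u else 0) = (if u' \<in> T then \<phi> u' else 0) \<longrightarrow> u = u'"
  shows "\<exists>\<psi>. good r (T \<union> P) \<psi> \<and> (\<forall>b \<in> P. \<psi> b = 0) \<and> (\<forall>u \<in> T. \<psi> u = \<phi> u)"
proof -
  have "\<exists>\<psi>. good r (T \<union> Q) \<psi> \<and> (\<forall>b \<in> Q. \<psi> b = 0) \<and> (\<forall>u \<in> T. \<psi> u = \<phi> u)" if "finite Q" "Q \<subseteq> P" for Q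
    using that
  proof (induction Q rule: finite_induct)
    case empty
    show ?case using g by auto
  next
    case (insert b Q)
    then obtain \<psi> where \<psi>: "good r (T \<union> Q) \<psi>" "\<forall>b \<in> Q. \<psi> b = 0" "\<forall>u \<in> T. \<psi> u = \<phi> u"
      by auto
    have b: "b \<in> P" "b \<notin> T \<union> Q" using insert disj by auto
    have "\<forall>u \<in> nb (T \<union> Q) b. \<forall>u' \<in> nb (T \<union> Q) b. \<psi> u = \<psi> u' \<longrightarrow> u = u'"
    proof (intro ballI impI)
      fix u u' assume u: "u \<in> nb (T \<union> Q) b" "u' \<in> nb (T \<union> Q) b" "\<psi> u = \<psi> u'"
      have "\<psi> x = (if x \<in> T then \<phi> x else 0)" if "x \<in> nb (T \<union> Q) b" for x using that \<psi> by auto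
      then have "(if u \<in> T then \<phi> u else 0) = (if u' \<in> T then \<phi> u' else 0)" using u by metis
      moreover have "u \<in> nb (T \<union> P) b" "u' \<in> nb (T \<union> P) b" using u insert(4) by auto
      ultimately show "u = u'" using inj b(1) by blast
    qed
    then obtain \<chi> where \<chi>: "good r (insert b (T \<union> Q)) \<chi>" "\<chi> b = 0" "\<forall>u \<in> T \<union> Q. \<chi> u = \<psi> u"
      using add_forest_leaf[OF \<psi>(1) _ b(2)] fin insert(1) by auto
    have "good r (T \<union> insert b Q) \<chi>" using \<chi>(1) by simp
    moreover have "\<forall>b \<in> insert b Q. \<chi> b = 0" "\<forall>u \<in> T. \<chi> u = \<phi> u" using \<chi> \<psi> by auto
    ultimately show ?case by blast
  qed
  from this[OF finP] show ?thesis by blast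
qed

lemma add_forest_set:
  assumes g: "good r T \<phi>" and fin: "finite T" and finP: "finite P" and disj: "P \<inter> T = {}"
    and indep: "\<forall>b \<in> P. \<forall>b' \<in> P. \<not> E b b'"
    and inj: "\<forall>b \<in> P. \<forall>u \<in> nb T b. \<forall>u' \<in> nb T b. \<phi> u = \<phi> u' \<longrightarrow> u = u'"
  shows "\<exists>\<psi>. good r (T \<union> P) \<psi> \<and> (\<forall>b \<in> P. \<psi> b = 0) \<and> (\<forall>u \<in> T. \<psi> u = \<phi> u)"
proof (rule add_leaves[OF g fin finP disj], rule ballI)
  fix b assume b: "b \<in> P"
  have "nb (T \<union> P) b = nb T b" using indep b by auto
  then show "\<forall>u \<in> nb (T \<union> P) b. \<forall>u' \<in> nb (T \<union> P) b.
      (if u \<in> T then \<phi> u else 0) = (if u' \<in> T then \<phi> u' else 0) \<longrightarrow> u = u'"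
    using inj b by simp
qed

end

section \<open>Minimal counterexamples\<close>

locale mincex = sgraph E for E :: "'a \<Rightarrow> 'a \<Rightarrow> bool" +
  fixes S :: "'a set" and r :: nat
  assumes finS: "finite S" and r1: "1 \<le> r"
    and nocol: "\<not> good r S \<phi>"
    and mincol: "T \<subset> S \<Longrightarrow> \<exists>\<phi>. good r T \<phi>"
begin

abbreviation N :: "'a \<Rightarrow> 'a set" where "N v \<equiv> nb S v"

definition d :: "'a \<Rightarrow> nat" where "d v = card (nb S v)"

text \<open>The other neighbour of a vertex \<open>b\<close> of degree 2; unspecified for other degrees.\<close>

definition far :: "'a \<Rightarrow> 'a \<Rightarrow> 'a" where "far x b = (THE y. y \<in> N b \<and> y \<noteq> x)"

text \<open>Two adjacent \<open>alpha\<close> vertices form a thread between two vertices of larger degree.\<close>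

definition alpha :: "'a \<Rightarrow> bool" where "alpha b \<longleftrightarrow> d b = 2 \<and> (\<exists>b' \<in> N b. d b' = 2)"

lemma partial:
  assumes "x \<in> D" "D \<subseteq> S"
  obtains \<phi> where "normal r (S - D) \<phi>" "good r (S - D) \<phi>" "finite (S - D)"
proof -
  have "S - D \<subset> S" using assms by auto
  then obtain \<phi> where "good r (S - D) \<phi>" using mincol by blast
  then obtain \<psi> where "normal r (S - D) \<psi>" using normal_exists finS by blast
  then show thesis using that normal_good finS by blast
qed

lemma two_far:
  assumes "d b = 2" "x \<in> N b"
  shows "N b = {x, far x b}" "far x b \<noteq> x" "far x b \<in> S" "E b (far x b)"
proof -
  obtain u v where uv: "N b = {u, v}" "u \<noteq> v" using assms(1) unfolding d_def card_2_iff by blast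
  then obtain y where y: "N b = {x, y}" "x \<noteq> y" using assms(2) by (metis insert_commute empty_iff insert_iff)
  then have "far x b = y" unfolding far_def by (intro the_equality) auto
  then show "N b = {x, far x b}" "far x b \<noteq> x" using y by auto
  then have "far x b \<in> N b" by blast
  then show "far x b \<in> S" "E b (far x b)" by auto
qed

lemma far_eq: "d b = 2 \<Longrightarrow> N b = {x, y} \<Longrightarrow> x \<noteq> y \<Longrightarrow> far x b = y"
  unfolding far_def by (intro the_equality) auto

lemma N_sym: "u \<in> S \<Longrightarrow> v \<in> N u \<Longrightarrow> u \<in> N v"
  using sym by auto

lemma nb_Int: "N v = A \<Longrightarrow> T \<subseteq> S \<Longrightarrow> nb T v = A \<inter> T"
  by auto

lemma finN [simp]: "finite (N v)" using finS by simp

lemma card_nb_le: "T \<subseteq> S \<Longrightarrow> D \<subseteq> N v \<Longrightarrow> D \<inter> T = {} \<Longrightarrow> card (nb T v) + card D \<le> d v"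
proof -
  assume a: "T \<subseteq> S" "D \<subseteq> N v" "D \<inter> T = {}"
  have "finite D" using a(2) finN finite_subset by blast
  moreover have "finite (nb T v)" using a(1) finS finite_subset by (intro finite_nb) blast
  ultimately  have "card (nb T v) + card D = card (nb T v \<union> D)" using a by (subst card_Un_disjoint) auto
  also have "\<dots> \<le> d v" unfolding d_def using a finN by (intro card_mono) auto
  finally show ?thesis .
qed

lemma close_leaf:
  assumes "good r T \<phi>" "insert v T = S" "v \<notin> T"
    and inj: "\<forall>u \<in> nb T v. \<forall>u' \<in> nb T v. \<phi> u = \<phi> u' \<longrightarrow> u = u'"
  shows False
proof -
  have "finite T" using assms(2) finS by (metis finite_insert)
  then show False using add_forest_leaf[OF assms(1) _ assms(3) inj] assms(2) nocol by auto
qed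

lemma close_vertex:
  assumes "good r T \<phi>" "insert v T = S" "v \<notin> T"
    and "\<forall>u \<in> nb T v. \<forall>u' \<in> nb T v. \<phi> u = \<phi> u' \<longrightarrow> \<phi> u \<noteq> 0 \<longrightarrow> u = u'"
    and "\<forall>u \<in> nb T v. \<phi> u = 0 \<longrightarrow> u = w \<or> isolated T \<phi> u"
  shows False
proof -
  have "finite T" using assms(2) finS by (metis finite_insert)
  then show False using add_forest_vertex[OF assms(1) _ assms(3-5)] assms(2) nocol by auto
qed

lemma deg_ge_2: assumes "v \<in> S" shows "2 \<le> d v"
proof (rule ccontr)
  assume "\<not> 2 \<le> d v"
  then have le: "card (N v) \<le> 1" unfolding d_def by simp
  obtain \<phi> where \<phi>: "normal r (S - {v}) \<phi>" "good r (S - {v}) \<phi>" "finite (S - {v})"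
    by (rule partial[of v "{v}"]) (use assms in auto)
  have eq: "u = u'" if "u \<in> nb (S - {v}) v" "u' \<in> nb (S - {v}) v" for u u'
    using that le card_le_Suc0_iff_eq[OF finN, of v] by auto
  then have "\<exists>\<psi>. good r (insert v (S - {v})) \<psi>"
    using add_forest_leaf[OF \<phi>(2) \<phi>(3)] by blast
  moreover have "insert v (S - {v}) = S" using assms by auto
  ultimately show False using nocol by simp
qed

lemma alpha_end:
  assumes S: "u \<in> S" "v \<in> S" and two: "d u = 2" "d v = 2" and e: "E u v" and x: "x \<in> N u" "x \<noteq> v"
  shows "r + 2 \<le> d x"
proof (rule ccontr)
  assume "\<not> r + 2 \<le> d x"
  then have dx: "d x \<le> r + 1" by simp
  define w where "w = far u v"
  have far: "far v u = x" using two_far[of u v] two e x S by auto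
  have Nu: "N u = {v, x}" using two_far[of u v] two e x S far by auto
  have Nv: "N v = {u, w}" "w \<noteq> u" "w \<in> S" "E v w" using two_far[of v u] two e S sym unfolding w_def by auto
  have ne: "u \<noteq> v" "w \<noteq> v" "x \<noteq> u" "x \<in> S" using e Nv x irrefl by auto
  define T where "T = S - {u, v}"
  have TS: "T \<subseteq> S" "u \<notin> T" "v \<notin> T" "insert v T \<subseteq> S" "insert u T \<subseteq> S"
    "insert u (insert v T) = S" "insert v (insert u T) = S" using S unfolding T_def by auto
  obtain \<phi> where n: "normal r T \<phi>" and g: "good r T \<phi>" and fin: "finite T"
    by (rule partial[of u "{u, v}"]) (use S T_def in auto)
  have xT: "x \<in> T" "w \<in> T" using ne x Nv unfolding T_def by auto
  have nbu: "nb T u = {x}" and nbv: "nb T v = {w}"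
    using xT TS by (auto simp: nb_Int[OF Nu] nb_Int[OF Nv(1)])
  have nbu': "nb (insert v T) u = {v, x}" and nbv': "nb (insert u T) v = {u, w}"
    using xT TS ne by (auto simp: nb_Int[OF Nu] nb_Int[OF Nv(1)])
  show False
  proof (cases "\<phi> x = 0 \<and> \<phi> w = 0")
    case False
    show False
    proof (cases "\<phi> x = 0")
      case True
      obtain \<psi> where \<psi>: "good r (insert u T) \<psi>" "\<psi> u = 0" "\<forall>a \<in> T. \<psi> a = \<phi> a"
        using add_forest_leaf[OF g fin TS(2)] nbu by auto
      have "\<psi> w \<noteq> 0" using \<psi>(3) xT False True by simp
      then show False
        by (intro close_leaf[OF \<psi>(1) TS(7)]) (use nbv' TS(3) \<psi>(2) ne(1) in simp_all)
    next
      case xn: False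
      obtain \<psi> where \<psi>: "good r (insert v T) \<psi>" "\<psi> v = 0" "\<forall>a \<in> T. \<psi> a = \<phi> a"
        using add_forest_leaf[OF g fin TS(3)] nbv by auto
      have "\<psi> x \<noteq> 0" using \<psi>(3) xT xn by simp
      then show False
        by (intro close_leaf[OF \<psi>(1) TS(6)]) (use nbu' TS(2) \<psi>(2) ne(1) in simp_all)
    qed
  next
    case True
    have uv: "u \<in> N x" "w = x \<Longrightarrow> v \<in> N x"
      using N_sym[OF S(1) x(1)] Nv(1) N_sym[OF S(2), of w] by auto
    have cx: "card (nb T x) \<le> r" "w = x \<Longrightarrow> card (nb T x) < r"
      using card_nb_le[OF TS(1), of "{u}" x] card_nb_le[OF TS(1), of "{u, v}" x] dx uv TS(2,3) ne(1) by auto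
    show False
    proof (cases "\<exists>j \<in> {1..r}. free T \<phi> x j")
      case True
      then obtain j where j: "1 \<le> j" "j \<le> r" "free T \<phi> x j" by auto
      obtain \<psi> where \<psi>: "good r (insert u T) \<psi>" "\<psi> u = j" "\<forall>a \<in> T. \<psi> a = \<phi> a"
        using add_coloured_vertex[OF g TS(2) j(1,2)] nbu j(3) by auto
      have "\<psi> w = 0" using \<psi>(3) xT \<open>\<phi> x = 0 \<and> \<phi> w = 0\<close> by simp
      then show False
        by (intro close_leaf[OF \<psi>(1) TS(7)]) (use nbv' TS(3) \<psi>(2) j(1) ne(1) in simp_all)
    next
      case False
      then have iso: "isolated T \<phi> x" "w \<noteq> x"
        using free_or_isolated[OF n fin xT(1) cx(1)] cx(2) by blast+
      obtain \<psi> where \<psi>: "good r (insert v T) \<psi>" "\<psi> v = 0" "\<forall>a \<in> T. \<psi> a = \<phi> a"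
        using add_forest_leaf[OF g fin TS(3)] nbv by auto
      have "x \<notin> N v" using Nv iso(2) ne by auto
      then have "nb (insert v T) x = nb T x" using S ne sym[of x v] by auto
      then have "isolated (insert v T) \<psi> x"
        using iso(1) \<psi>(3) xT unfolding isolated_def by (metis in_nb)
      then show False
        by (intro close_vertex[OF \<psi>(1) TS(6), of v])
          (use nbu' TS(2) \<psi>(2) ne(1) in \<open>simp_all add: isolated_def\<close>)
    qed
  qed
qed

end

lemma card_le_1_eq: "\<lbrakk>finite A; card A \<le> 1; u \<in> A; u' \<in> A\<rbrakk> \<Longrightarrow> u = u'"
  by (metis card_le_Suc0_iff_eq One_nat_def)

context sgraph
begin

lemma isolated_free_cong:
  assumes "nb T' y = nb T y" "y \<in> T" "\<forall>u \<in> T. \<psi> u = \<phi> u"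
  shows "isolated T' \<psi> y \<longleftrightarrow> isolated T \<phi> y" "free T' \<psi> y j \<longleftrightarrow> free T \<phi> y j"
proof -
  have "\<psi> y = \<phi> y" "\<forall>u \<in> nb T y. \<psi> u = \<phi> u" using assms by auto
  then show "isolated T' \<psi> y \<longleftrightarrow> isolated T \<phi> y" "free T' \<psi> y j \<longleftrightarrow> free T \<phi> y j"
    unfolding isolated_def free_def assms(1) by auto
qed

end

context mincex
begin

lemma nb_two:
  assumes "d b = 2" "x \<in> S" "b \<in> N x" "T \<subseteq> S"
  shows "nb T b = {x, far x b} \<inter> T"
  using nb_Int[OF two_far(1) assms(4)] assms N_sym by blast

lemma alpha_two: "alpha b \<Longrightarrow> d b = 2"
  by (simp add: alpha_def)

lemma alpha_far:
  assumes "alpha b" "x \<in> S" "b \<in> N x" "d x \<noteq> 2"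
  shows "d (far x b) = 2"
proof -
  have "N b = {x, far x b}" using two_far(1) assms N_sym alpha_two by blast
  then show ?thesis using assms(1,4) unfolding alpha_def by auto
qed

lemma alpha_far_nb:
  assumes "alpha b" "x \<in> S" "b \<in> N x" "d x \<noteq> 2" "T \<subseteq> S" "b \<notin> T"
  shows "card (nb T (far x b)) \<le> 1"
proof -
  have b: "b \<in> S" "x \<in> N b" "d b = 2" using assms N_sym alpha_two by auto
  have "b \<in> N (far x b)" using two_far[OF b(3,2)] b(1) sym by auto
  then show ?thesis
    using card_nb_le[OF assms(5), of "{b}" "far x b"] alpha_far[OF assms(1-4)] assms(6) by auto
qed

lemma alpha_far_zero:
  assumes "alpha b" "x \<in> S" "b \<in> N x" "d x \<noteq> 2" "T \<subseteq> S" "b \<notin> T" "far x b \<in> T" "normal r T \<phi>"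
  shows "\<phi> (far x b) = 0"
  using normal_pendant[OF assms(8) _ assms(7) alpha_far_nb[OF assms(1-6)]] assms(5) finS finite_subset by blast

lemma cut:
  assumes g: "good r T \<psi>" and TS: "T \<subseteq> S" and x: "x \<in> T" "\<psi> x = 0"
    and b: "d b = 2" "b \<in> N x" "b \<notin> T" and y: "far x b \<in> T" "\<psi> (far x b) = 0"
    and j: "1 \<le> j" "j \<le> r" and xj: "\<forall>u \<in> nb T x. \<psi> u \<noteq> j"
    and iso: "isolated T \<psi> (far x b) \<or> free T \<psi> (far x b) j"
  shows "\<exists>\<chi>. good r (insert b T) \<chi> \<and> (\<chi> b = 0 \<or> \<chi> b = j) \<and> (\<forall>u \<in> T. \<chi> u = \<psi> u)"
proof -
  have nbb: "nb T b = {x, far x b}" using nb_two[OF b(1) _ b(2) TS] x(1) y(1) TS by auto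
  have fin: "finite T" using TS finS finite_subset by blast
  show ?thesis
  proof (cases "isolated T \<psi> (far x b)")
    case True
    have "\<exists>\<chi>. good r (insert b T) \<chi> \<and> \<chi> b = 0 \<and> (\<forall>u \<in> T. \<chi> u = \<psi> u)"
      by (rule add_forest_vertex[OF g fin b(3), of x]) (simp_all add: nbb x y True)
    then show ?thesis by blast
  next
    case False
    then have fr: "free T \<psi> (far x b) j" using iso by blast
    have "free T \<psi> x j" using x(2) j(1) xj by (simp add: free_def)
    then have "\<exists>\<chi>. good r (insert b T) \<chi> \<and> \<chi> b = j \<and> (\<forall>u \<in> T. \<chi> u = \<psi> u)"
      by (intro add_coloured_vertex[OF g b(3) j]) (simp_all add: nbb x y fr)
    then show ?thesis by blast
  qed
qed

lemma cut_many:
  assumes g: "good r T \<psi>" and TS: "T \<subseteq> S" and x: "x \<in> T" "\<psi> x = 0" "d x \<noteq> 2"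
    and A: "A \<subseteq> N x" "A \<inter> T = {}" "\<forall>a \<in> A. alpha a \<and> far x a \<in> T \<and> \<psi> (far x a) = 0"
    and card: "card A \<le> card ({1..r} - \<psi> ` nb T x)"
  shows "\<exists>\<chi>. good r (T \<union> A) \<chi> \<and> (\<forall>u \<in> T. \<chi> u = \<psi> u)"
proof -
  have finA: "finite A" using A(1) finN finite_subset by blast
  have finT: "finite T" using TS finS finite_subset by blast
  have xS: "x \<in> S" using x TS by auto
  have "\<exists>\<chi>. good r (T \<union> Q) \<chi> \<and> (\<forall>u \<in> T. \<chi> u = \<psi> u)" if "finite Q" "Q \<subseteq> A" for Q
    using that
  proof (induction Q rule: finite_induct)
    case empty
    show ?case using g by auto
  next
    case (insert a Q)
    then obtain \<chi> where \<chi>: "good r (T \<union> Q) \<chi>" "\<forall>u \<in> T. \<chi> u = \<psi> u" by auto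
    have a: "alpha a" "d a = 2" "a \<in> N x" "a \<notin> T \<union> Q" "far x a \<in> T" "\<psi> (far x a) = 0"
      using insert A alpha_two by auto
    have TQ: "T \<union> Q \<subseteq> S" using TS insert(4) A(1) by auto
    have sub: "\<chi> ` nb (T \<union> Q) x \<subseteq> \<psi> ` nb T x \<union> \<chi> ` Q" using \<chi>(2) by force
    have "card Q < card A" using insert(2,4) finA by (intro psubset_card_mono) auto
    also have "card A \<le> card ({1..r} - \<psi> ` nb T x)" by (rule card)
    finally have "card (\<chi> ` Q) < card ({1..r} - \<psi> ` nb T x)"
      using card_image_le[OF insert(1), of \<chi>] by linarith
    then have "\<not> {1..r} - \<psi> ` nb T x \<subseteq> \<chi> ` Q"
      using card_mono[of "\<chi> ` Q" "{1..r} - \<psi> ` nb T x"] insert(1) by auto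
    then obtain j where "j \<in> {1..r} - \<psi> ` nb T x" "j \<notin> \<chi> ` Q" by blast
    then have j: "1 \<le> j" "j \<le> r" "j \<notin> \<psi> ` nb T x" "j \<notin> \<chi> ` Q" by simp_all
    have xj: "\<forall>u \<in> nb (T \<union> Q) x. \<chi> u \<noteq> j" using sub j(3,4) by blast
    have le1: "card (nb (T \<union> Q) (far x a)) \<le> 1" by (rule alpha_far_nb[OF a(1) xS a(3) x(3) TQ a(4)])
    have y0: "\<chi> (far x a) = 0" using \<chi>(2) a by simp
    have eq: "u = u'" if "u \<in> nb (T \<union> Q) (far x a)" "u' \<in> nb (T \<union> Q) (far x a)" for u u'
    proof -
      have "finite (nb (T \<union> Q) (far x a))" using finT insert(1) by simp
      then show ?thesis by (rule card_le_1_eq[OF _ le1 that])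
    qed
    have iso: "isolated (T \<union> Q) \<chi> (far x a) \<or> free (T \<union> Q) \<chi> (far x a) j"
    proof (cases "\<exists>u \<in> nb (T \<union> Q) (far x a). \<chi> u = j")
      case True
      then obtain u where "u \<in> nb (T \<union> Q) (far x a)" "\<chi> u = j" by blast
      then have "\<forall>u' \<in> nb (T \<union> Q) (far x a). \<chi> u' = j" using eq by blast
      then show ?thesis using y0 j(1) by (simp add: isolated_def)
    next
      case False
      then show ?thesis using y0 j(1) by (simp add: free_def)
    qed
    have "\<exists>\<chi>'. good r (insert a (T \<union> Q)) \<chi>' \<and> (\<chi>' a = 0 \<or> \<chi>' a = j) \<and> (\<forall>u \<in> T \<union> Q. \<chi>' u = \<chi> u)"
      by (rule cut[OF \<chi>(1) TQ _ _ a(2,3,4) _ y0 j(1,2) xj iso]) (use x a \<chi>(2) in auto)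
    then obtain \<chi>' where "good r (insert a (T \<union> Q)) \<chi>'" "\<forall>u \<in> T \<union> Q. \<chi>' u = \<chi> u" by blast
    then have "good r (T \<union> insert a Q) \<chi>' \<and> (\<forall>u \<in> T. \<chi>' u = \<psi> u)" using \<chi>(2) by simp
    then show ?case by blast
  qed
  from this[OF finA] show ?thesis by blast
qed

text \<open>\<open>L\<close> holds at most one neighbour through which \<open>x\<close> is joined to the forest; the far ends of the
  vertices in \<open>Z\<close> are coloured, so these vertices do not join \<open>x\<close> to anything.\<close>

lemma add_forest_centre:
  assumes g: "good r T \<phi>" and TS: "T \<subseteq> S" and x: "x \<in> S" "x \<notin> T"
    and P: "L \<union> Z \<subseteq> N x" "(L \<union> Z) \<inter> T = {}" "L \<inter> Z = {}"
      "\<forall>b \<in> L \<union> Z. d b = 2 \<and> far x b \<in> T" "\<forall>b \<in> L \<union> Z. \<forall>b' \<in> L \<union> Z. \<not> E b b'"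
    and L: "card L \<le> 1" and Z: "\<forall>b \<in> Z. \<phi> (far x b) \<noteq> 0"
    and distinct: "\<forall>u \<in> nb T x. \<forall>u' \<in> nb T x. \<phi> u = \<phi> u' \<longrightarrow> \<phi> u \<noteq> 0 \<longrightarrow> u = u'"
    and leaf: "\<forall>u \<in> nb T x. \<phi> u = 0 \<longrightarrow> L = {} \<and> u = w \<or> isolated T \<phi> u"
    and sep: "\<forall>u \<in> nb T x. \<forall>l \<in> L. \<not> E u l"
  shows "\<exists>\<psi>. good r (insert x (T \<union> L \<union> Z)) \<psi> \<and> \<psi> x = 0 \<and> (\<forall>b \<in> L \<union> Z. \<psi> b = 0) \<and> (\<forall>u \<in> T. \<psi> u = \<phi> u)"
proof -
  have fin: "finite T" "finite L" "finite Z"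
    using TS finS P(1) finN[of x] finite_subset by blast+
  have nbb: "nb T b = {far x b}" if "b \<in> L \<union> Z" for b
  proof -
    have b: "d b = 2" "b \<in> N x" "far x b \<in> T" using that P(1,4) by blast+
    show ?thesis using nb_two[OF b(1) x(1) b(2) TS] b(3) x(2) by simp
  qed
  obtain \<phi>' where \<phi>': "good r (T \<union> L) \<phi>'" "\<forall>b \<in> L. \<phi>' b = 0" "\<forall>u \<in> T. \<phi>' u = \<phi> u"
  proof -
    have "\<exists>\<psi>. good r (T \<union> L) \<psi> \<and> (\<forall>b \<in> L. \<psi> b = 0) \<and> (\<forall>u \<in> T. \<psi> u = \<phi> u)"
      by (rule add_forest_set[OF g fin(1,2)]) (use P nbb in auto)
    then show thesis using that by blast
  qed
  have xL: "x \<notin> T \<union> L" using x P(1) irrefl by auto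
  have nbx: "nb (T \<union> L) x = nb T x \<union> L" using P(1) by auto
  have nbu: "nb (T \<union> L) u = nb T u" if "u \<in> nb T x" for u using sep that by auto
  have iso: "isolated (T \<union> L) \<phi>' u" if "u \<in> nb T x" "isolated T \<phi> u" for u
  proof -
    have "u \<in> T" using that by simp
    then show ?thesis using isolated_free_cong(1)[OF nbu[OF that(1)] _ \<phi>'(3)] that(2) by simp
  qed
  define w' where "w' = (if L = {} then w else the_elem L)"
  have w': "u = w'" if "u \<in> L" for u
  proof -
    have "L = {u}" using card_le_1_eq[OF fin(2) L that] that by blast
    then show ?thesis by (simp add: w'_def)
  qed
  obtain \<psi> where \<psi>: "good r (insert x (T \<union> L)) \<psi>" "\<psi> x = 0" "\<forall>u \<in> T \<union> L. \<psi> u = \<phi>' u"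
  proof -
    have "\<exists>\<psi>. good r (insert x (T \<union> L)) \<psi> \<and> \<psi> x = 0 \<and> (\<forall>u \<in> T \<union> L. \<psi> u = \<phi>' u)"
    proof (rule add_forest_vertex[OF \<phi>'(1) _ xL])
      show "\<forall>u \<in> nb (T \<union> L) x. \<forall>u' \<in> nb (T \<union> L) x. \<phi>' u = \<phi>' u' \<longrightarrow> \<phi>' u \<noteq> 0 \<longrightarrow> u = u'"
      proof (intro ballI impI)
        fix u u' assume *: "u \<in> nb (T \<union> L) x" "u' \<in> nb (T \<union> L) x" "\<phi>' u = \<phi>' u'" "\<phi>' u \<noteq> 0"
        then have "u \<in> nb T x" "u' \<in> nb T x" using nbx \<phi>'(2) by auto
        then show "u = u'" using distinct * \<phi>'(3) by simp
      qed
      show "\<forall>u \<in> nb (T \<union> L) x. \<phi>' u = 0 \<longrightarrow> u = w' \<or> isolated (T \<union> L) \<phi>' u"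
      proof (intro ballI impI)
        fix u assume *: "u \<in> nb (T \<union> L) x" "\<phi>' u = 0"
        show "u = w' \<or> isolated (T \<union> L) \<phi>' u"
        proof (cases "u \<in> L")
          case False
          then have u: "u \<in> nb T x" using * nbx by auto
          then have "\<phi> u = 0" using * \<phi>'(3) by simp
          then have "L = {} \<and> u = w \<or> isolated T \<phi> u" using leaf u by blast
          then show ?thesis using iso[OF u] by (auto simp: w'_def)
        qed (use w' in blast)
      qed
    qed (use fin in auto)
    then show thesis using that by blast
  qed
  have Z': "\<forall>b \<in> Z. nb (insert x (T \<union> L)) b = {x, far x b}"
  proof
    fix b assume b: "b \<in> Z"
    have T': "insert x (T \<union> L) \<subseteq> S" using TS x(1) P(1) by auto
    have b': "d b = 2" "b \<in> N x" "far x b \<in> T" using b P(1,4) by blast+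
    show "nb (insert x (T \<union> L)) b = {x, far x b}"
      using nb_two[OF b'(1) x(1) b'(2) T'] b'(3) by simp
  qed
  have zx: "Z \<inter> insert x (T \<union> L) = {}" using P(1-3) irrefl by auto
  have "\<exists>\<chi>. good r (insert x (T \<union> L) \<union> Z) \<chi> \<and> (\<forall>b \<in> Z. \<chi> b = 0) \<and> (\<forall>u \<in> insert x (T \<union> L). \<chi> u = \<psi> u)"
  proof (rule add_forest_set[OF \<psi>(1) _ fin(3) zx])
    show "\<forall>b \<in> Z. \<forall>u \<in> nb (insert x (T \<union> L)) b. \<forall>u' \<in> nb (insert x (T \<union> L)) b. \<psi> u = \<psi> u' \<longrightarrow> u = u'"
    proof
      fix b assume b: "b \<in> Z"
      have "\<psi> (far x b) \<noteq> 0" using b Z P(4) \<psi>(3) \<phi>'(3) by simp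
      then show "\<forall>u \<in> nb (insert x (T \<union> L)) b. \<forall>u' \<in> nb (insert x (T \<union> L)) b. \<psi> u = \<psi> u' \<longrightarrow> u = u'"
        using Z'[rule_format, OF b] \<psi>(2) by simp
    qed
  qed (use fin P(5) in auto)
  then obtain \<chi> where \<chi>: "good r (insert x (T \<union> L) \<union> Z) \<chi>" "\<forall>b \<in> Z. \<chi> b = 0"
    "\<forall>u \<in> insert x (T \<union> L). \<chi> u = \<psi> u" by blast
  have "insert x (T \<union> L) \<union> Z = insert x (T \<union> L \<union> Z)" by auto
  then show ?thesis using \<chi> \<psi>(2,3) \<phi>'(2,3) by (intro exI[of _ \<chi>]) auto
qed

lemma nb_disj: "T \<subseteq> S \<Longrightarrow> N x \<inter> T = {} \<Longrightarrow> nb T x = {}"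
  unfolding nb_def by blast

lemma fill_two:
  assumes g: "good r T \<psi>" and TS: "T \<subseteq> S" and x: "x \<in> T"
    and P: "P \<subseteq> N x" "P \<inter> T = {}" "\<forall>b \<in> P. d b = 2 \<and> far x b \<in> T \<and> \<psi> (far x b) \<noteq> \<psi> x"
      "\<forall>b \<in> P. \<forall>b' \<in> P. \<not> E b b'"
  shows "\<exists>\<chi>. good r (T \<union> P) \<chi> \<and> (\<forall>b \<in> P. \<chi> b = 0) \<and> (\<forall>u \<in> T. \<chi> u = \<psi> u)"
proof (rule add_forest_set[OF g _ _ P(2,4)])
  show "finite T" "finite P" using TS finS P(1) finN[of x] finite_subset by blast+
  show "\<forall>b \<in> P. \<forall>u \<in> nb T b. \<forall>u' \<in> nb T b. \<psi> u = \<psi> u' \<longrightarrow> u = u'"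
  proof
    fix b assume "b \<in> P"
    then have b: "d b = 2" "b \<in> N x" "far x b \<in> T" "\<psi> (far x b) \<noteq> \<psi> x" using P(1,3) by blast+
    have "nb T b = {x, far x b}" using nb_two[OF b(1) _ b(2) TS] x b(3) TS by auto
    then show "\<forall>u \<in> nb T b. \<forall>u' \<in> nb T b. \<psi> u = \<psi> u' \<longrightarrow> u = u'" using b(4) by simp
  qed
qed

lemma far_in:
  assumes "x \<in> S" "b \<in> N x" "d b = 2"
  shows "far x b \<in> S" "far x b \<noteq> x" "E b (far x b)" "E (far x b) b" "N b = {x, far x b}" "b \<in> S" "E x b" "E b x"
  using two_far[OF assms(3) N_sym[OF assms(1,2)]] assms(2) sym by auto

lemma all_two_blocked:
  assumes x: "x \<in> S" and two: "\<forall>b \<in> N x. d b = 2" and indep: "\<forall>b \<in> N x. \<forall>b' \<in> N x. \<not> E b b'"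
  obtains \<phi> where "normal r (S - insert x (N x)) \<phi>" "good r (S - insert x (N x)) \<phi>"
    "\<forall>b \<in> N x. far x b \<in> S - insert x (N x)" "\<forall>j \<in> {1..r}. \<exists>b \<in> N x. \<phi> (far x b) = j"
proof -
  define T where "T = S - insert x (N x)"
  have Tn: "T \<subseteq> S" "x \<notin> T" "N x \<inter> T = {}" "insert x T \<subseteq> S" unfolding T_def using x by auto
  obtain \<phi> where n: "normal r T \<phi>" and g: "good r T \<phi>" and fin: "finite T"
    by (rule partial[of x "insert x (N x)"]) (use x T_def in auto)
  have far: "far x b \<in> T" if "b \<in> N x" for b
    using far_in[OF x that] two indep that unfolding T_def by blast
  have "\<exists>b \<in> N x. \<phi> (far x b) = j" if j: "j \<in> {1..r}" for j
  proof (rule ccontr)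
    assume no: "\<not> ?thesis"
    have nbx: "nb T x = {}" by (rule nb_disj[OF Tn(1,3)])
    obtain \<psi> where \<psi>: "good r (insert x T) \<psi>" "\<psi> x = j" "\<forall>u \<in> T. \<psi> u = \<phi> u"
      using add_coloured_vertex[OF g Tn(2), of j] j nbx by auto
    have "\<exists>\<chi>. good r (insert x T \<union> N x) \<chi> \<and> (\<forall>b \<in> N x. \<chi> b = 0) \<and> (\<forall>u \<in> insert x T. \<chi> u = \<psi> u)"
    proof (rule fill_two[OF \<psi>(1) Tn(4)])
      show "N x \<inter> insert x T = {}" using Tn irrefl by auto
      show "\<forall>b \<in> N x. d b = 2 \<and> far x b \<in> insert x T \<and> \<psi> (far x b) \<noteq> \<psi> x"
      proof
        fix b assume b: "b \<in> N x"
        show "d b = 2 \<and> far x b \<in> insert x T \<and> \<psi> (far x b) \<noteq> \<psi> x"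
          using two b far[OF b] no \<psi>(2,3) by auto
      qed
    qed (use indep in simp_all)
    moreover have "insert x T \<union> N x = S" unfolding T_def using x by auto
    ultimately show False using nocol by auto
  qed
  then show thesis using that n g far unfolding T_def by blast
qed

lemma all_two_cut:
  assumes x: "x \<in> S" "3 \<le> d x" and two: "\<forall>b \<in> N x. d b = 2" and indep: "\<forall>b \<in> N x. \<forall>b' \<in> N x. \<not> E b b'"
    and n: "normal r (S - insert x (N x)) \<phi>"
    and far: "\<forall>b \<in> N x. far x b \<in> S - insert x (N x)"
    and Z: "Z = {b \<in> N x. \<phi> (far x b) \<noteq> 0}" and N: "N x = L \<union> A \<union> Z" "L \<inter> Z = {}" "A \<inter> (L \<union> Z) = {}"
    and L: "card L \<le> 1" and A: "\<forall>a \<in> A. alpha a" "card A \<le> r"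
  shows False
proof -
  define T where "T = S - insert x (N x)"
  have Tn: "T \<subseteq> S" "x \<notin> T" "N x \<inter> T = {}" unfolding T_def using x by auto
  have g: "good r T \<phi>" using n normal_good unfolding T_def by blast
  have nbx: "nb T x = {}" by (rule nb_disj[OF Tn(1,3)])
  have "\<exists>\<psi>. good r (insert x (T \<union> L \<union> Z)) \<psi> \<and> \<psi> x = 0 \<and> (\<forall>b \<in> L \<union> Z. \<psi> b = 0) \<and> (\<forall>u \<in> T. \<psi> u = \<phi> u)"
  proof (rule add_forest_centre[OF g Tn(1) x(1) Tn(2)])
    show "L \<union> Z \<subseteq> N x" using N by blast
    show "(L \<union> Z) \<inter> T = {}" using N(1) Tn(3) by blast
    show "\<forall>b \<in> L \<union> Z. d b = 2 \<and> far x b \<in> T" using N(1) two far unfolding T_def by blast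
    show "\<forall>b \<in> L \<union> Z. \<forall>b' \<in> L \<union> Z. \<not> E b b'" using N(1) indep by blast
  qed (use N L Z nbx in auto)
  then obtain \<psi> where \<psi>: "good r (insert x (T \<union> L \<union> Z)) \<psi>" "\<psi> x = 0" "\<forall>b \<in> L \<union> Z. \<psi> b = 0"
    "\<forall>u \<in> T. \<psi> u = \<phi> u" by blast
  have TS: "insert x (T \<union> L \<union> Z) \<subseteq> S" using Tn(1) x(1) N(1) by auto
  have "\<exists>\<chi>. good r (insert x (T \<union> L \<union> Z) \<union> A) \<chi> \<and> (\<forall>u \<in> insert x (T \<union> L \<union> Z). \<chi> u = \<psi> u)"
  proof (rule cut_many[OF \<psi>(1) TS _ \<psi>(2)])
    show "A \<subseteq> N x" using N(1) by blast
    show "A \<inter> insert x (T \<union> L \<union> Z) = {}" using N(1,3) Tn(3) irrefl by auto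
    show "\<forall>a \<in> A. alpha a \<and> far x a \<in> insert x (T \<union> L \<union> Z) \<and> \<psi> (far x a) = 0"
    proof
      fix a assume a: "a \<in> A"
      then have "a \<in> N x" "a \<notin> Z" using N(1,3) by blast+
      then have "\<phi> (far x a) = 0" "far x a \<in> T" using Z far unfolding T_def by blast+
      then show "alpha a \<and> far x a \<in> insert x (T \<union> L \<union> Z) \<and> \<psi> (far x a) = 0"
        using a A(1) \<psi>(4) by simp
    qed
    have "\<not> E x u" if "u \<in> T" for u using nbx that unfolding nb_def by blast
    then have "\<psi> ` nb (insert x (T \<union> L \<union> Z)) x \<subseteq> {0}" using \<psi>(3) irrefl by auto
    then have "{1..r} - \<psi> ` nb (insert x (T \<union> L \<union> Z)) x = {1..r}" by auto
    then show "card A \<le> card ({1..r} - \<psi> ` nb (insert x (T \<union> L \<union> Z)) x)" using A(2) by simp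
  qed (use x in simp_all)
  moreover have "insert x (T \<union> L \<union> Z) \<union> A = S" unfolding T_def using N(1) x by auto
  ultimately show False using nocol by auto
qed

lemma dead_card:
  assumes x: "x \<in> S" and P: "P \<subseteq> N x" and bl: "\<forall>j \<in> {1..r}. \<exists>b \<in> P. \<phi> (far x b) = j"
    and Z: "Z = {b \<in> P. \<phi> (far x b) \<noteq> 0}"
  shows "r \<le> card Z"
proof -
  have "{1..r} \<subseteq> (\<lambda>b. \<phi> (far x b)) ` Z" using bl unfolding Z by force
  moreover have "finite Z" unfolding Z using P finN[of x] by (auto intro: finite_subset)
  ultimately show ?thesis using surj_card_le[of Z "{1..r}"] by simp
qed

lemma all_two:
  assumes x: "x \<in> S" "3 \<le> d x" and two: "\<forall>b \<in> N x. d b = 2" and indep: "\<forall>b \<in> N x. \<forall>b' \<in> N x. \<not> E b b'"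
  shows "r \<le> card {b \<in> N x. \<not> alpha b}" "r + 2 \<le> d x"
    "d x = r + 2 \<Longrightarrow> b \<in> N x \<Longrightarrow> \<not> alpha b"
    "d x = r + 3 \<Longrightarrow> 2 \<le> r \<Longrightarrow> r + 1 \<le> card {b \<in> N x. \<not> alpha b}"
proof -
  obtain \<phi> where \<phi>: "normal r (S - insert x (N x)) \<phi>"
    "\<forall>b \<in> N x. far x b \<in> S - insert x (N x)" "\<forall>j \<in> {1..r}. \<exists>b \<in> N x. \<phi> (far x b) = j"
    by (rule all_two_blocked[OF x(1) two indep])
  define Z where "Z = {b \<in> N x. \<phi> (far x b) \<noteq> 0}"
  define L where "L = N x - Z"
  have rZ: "r \<le> card Z" by (rule dead_card[OF x(1) subset_refl \<phi>(3) Z_def])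
  have ZN: "Z \<subseteq> N x" unfolding Z_def by blast
  have finZ: "finite Z" "finite L" using finite_subset[OF ZN finN] finN[of x] unfolding L_def by auto
  have cL: "card L = d x - card Z" unfolding L_def d_def using ZN finZ by (simp add: card_Diff_subset)
  have Zalpha: "\<not> alpha b" if "b \<in> Z" for b
  proof
    assume a: "alpha b"
    have b: "b \<in> N x" "\<phi> (far x b) \<noteq> 0" using that unfolding Z_def by auto
    have far: "far x b \<in> S - insert x (N x)" using \<phi>(2) b(1) by blast
    have "\<phi> (far x b) = 0"
      by (rule alpha_far_zero[OF a x(1) b(1) _ _ _ far \<phi>(1)]) (use x b(1) in auto)
    then show False using b(2) by simp
  qed
  have Zsub: "Z \<subseteq> {b \<in> N x. \<not> alpha b}" using Zalpha ZN by blast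
  have finn: "finite {b \<in> N x. \<not> alpha b}" using finN[of x] by (metis (no_types, lifting) finite_subset mem_Collect_eq subsetI)
  show nr: "r \<le> card {b \<in> N x. \<not> alpha b}"
    using rZ card_mono[OF finn Zsub] by linarith
  have contra: False if "L = L0 \<union> A" "L0 \<inter> A = {}" "card L0 \<le> 1" "\<forall>a \<in> A. alpha a" "card A \<le> r" for L0 A
    by (rule all_two_cut[OF x two indep \<phi>(1,2) Z_def, of L0 A]) (use that ZN L_def in auto)
  show dx: "r + 2 \<le> d x"
  proof (rule ccontr)
    assume "\<not> r + 2 \<le> d x"
    then have "card L \<le> 1" using cL rZ by linarith
    then show False using contra[of L "{}"] by simp
  qed
  show "\<not> alpha b" if dx: "d x = r + 2" and b: "b \<in> N x"
  proof
    assume a: "alpha b"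
    then have bL: "b \<in> L" using Zalpha b unfolding L_def by blast
    have "card (L - {b}) \<le> 1" using cL rZ dx bL finZ by simp
    then show False using contra[of "L - {b}" "{b}"] bL a r1 by auto
  qed
  show "r + 1 \<le> card {b \<in> N x. \<not> alpha b}" if dx: "d x = r + 3" and r: "2 \<le> r"
  proof (rule ccontr)
    assume "\<not> ?thesis"
    then have "card {b \<in> N x. \<not> alpha b} \<le> card Z" using rZ by linarith
    then have Zeq: "Z = {b \<in> N x. \<not> alpha b}" using card_seteq[OF finn Zsub] by blast
    have "card Z = r" using Zeq rZ \<open>\<not> r + 1 \<le> card {b \<in> N x. \<not> alpha b}\<close> by simp
    then have cL3: "card L = 3" using cL dx by simp
    then obtain l where l: "l \<in> L" by fastforce
    have "card (L - {l}) = 2" using cL3 l finZ by simp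
    moreover have "\<forall>a \<in> L - {l}. alpha a" using Zeq unfolding L_def by blast
    ultimately show False using contra[of "{l}" "L - {l}"] l r by auto
  qed
qed

end

section \<open>Girth at least six\<close>

locale mincex6 = mincex +
  assumes noC3: "\<lbrakk>E a b; E b c; E c a\<rbrakk> \<Longrightarrow> False"
    and noC4: "\<lbrakk>E a b; E b c; E c e; E e a; a \<noteq> c; b \<noteq> e\<rbrakk> \<Longrightarrow> False"
    and noC5: "\<lbrakk>E a b; E b c; E c e; E e f; E f a\<rbrakk> \<Longrightarrow> False"
    and r2: "2 \<le> r"
begin

lemma N_indep: "\<forall>b \<in> N x. \<forall>b' \<in> N x. \<not> E b b'"
  using noC3 sym by (meson in_nb)

lemma far_notin_N: "\<lbrakk>x \<in> S; b \<in> N x; d b = 2\<rbrakk> \<Longrightarrow> far x b \<notin> N x"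
  using far_in(3) N_indep by blast

lemma far_inj:
  assumes "x \<in> S" "b \<in> N x" "b' \<in> N x" "d b = 2" "d b' = 2" "b \<noteq> b'"
  shows "\<not> E (far x b) b'"
proof
  assume e: "E (far x b) b'"
  have "E x b" "E b (far x b)" "far x b \<noteq> x" "E b' x"
    using far_in[OF assms(1,2,4)] assms(3) sym by auto
  then show False using noC4[of x b "far x b" b'] e assms(6) by simp
qed

definition cutok :: "'a set \<Rightarrow> ('a \<Rightarrow> nat) \<Rightarrow> 'a \<Rightarrow> bool" where
  "cutok T \<phi> y \<longleftrightarrow> (\<exists>j \<in> {1..r}. isolated T \<phi> y \<or> free T \<phi> y j)"

lemma cutokI:
  assumes "normal r T \<phi>" "T \<subseteq> S" "y \<in> T" "a \<in> N y" "a \<notin> T" "d y \<le> r + 1"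
  shows "cutok T \<phi> y"
proof -
  have "card (nb T y) \<le> r" using card_nb_le[OF assms(2), of "{a}" y] assms by auto
  then have "isolated T \<phi> y \<or> (\<exists>j \<in> {1..r}. free T \<phi> y j)"
    using free_or_isolated[OF assms(1) _ assms(3)] assms(2) finS finite_subset by blast
  then show ?thesis unfolding cutok_def using r1 by force
qed

text \<open>After \<open>x\<close> has been put into the forest, one more neighbour \<open>c\<close> with a suitable far end can be
  added without joining components.\<close>

lemma cut_one:
  assumes g: "good r T' \<psi>" and T': "T' \<subseteq> S" "T \<subseteq> T'" "x \<in> T'" "x \<notin> T" "\<psi> x = 0"
    and T'T: "T' \<subseteq> insert x (T \<union> N x)" "\<forall>b \<in> T' - T. b \<in> N x \<longrightarrow> d b = 2"
    and zero: "\<forall>u \<in> nb T' x. \<psi> u = 0" and agree: "\<forall>u \<in> T. \<psi> u = \<phi> u"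
    and c: "c \<in> N x" "d c = 2" "c \<notin> T'" "far x c \<in> T" "\<phi> (far x c) = 0" and ok: "cutok T \<phi> (far x c)"
  shows "\<exists>\<chi>. good r (insert c T') \<chi>"
proof -
  have xS: "x \<in> S" using T' by blast
  obtain j where j: "j \<in> {1..r}" "isolated T \<phi> (far x c) \<or> free T \<phi> (far x c) j"
    using ok unfolding cutok_def by blast
  have "nb T' (far x c) = nb T (far x c)"
  proof
    show "nb T (far x c) \<subseteq> nb T' (far x c)" using T'(2) by (rule nb_mono)
    show "nb T' (far x c) \<subseteq> nb T (far x c)"
    proof
      fix u assume u: "u \<in> nb T' (far x c)"
      have "u \<in> T"
      proof (rule ccontr)
        assume uT: "u \<notin> T"
        then consider "u = x" | "u \<in> N x" "d u = 2" using u T'T by auto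
        then show False
        proof cases
          case 1
          then show False using far_notin_N[OF xS c(1,2)] u sym[of "far x c" x] far_in(1)[OF xS c(1,2)] by auto
        next
          case 2
          have "u \<noteq> c" using u c(3) by auto
          then show False using far_inj[OF xS c(1) 2(1) c(2) 2(2)] u by auto
        qed
      qed
      then show "u \<in> nb T (far x c)" using u by simp
    qed
  qed
  then have iso: "isolated T' \<psi> (far x c) \<or> free T' \<psi> (far x c) j"
    using j(2) isolated_free_cong[OF _ c(4) agree, of T'] by auto
  have "\<exists>\<chi>. good r (insert c T') \<chi> \<and> (\<chi> c = 0 \<or> \<chi> c = j) \<and> (\<forall>u \<in> T'. \<chi> u = \<psi> u)"
    by (rule cut[OF g T'(1,3,5) c(2,1,3) _ _ _ _ _ iso]) (use c agree T'(2) j(1) zero in auto)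
  then show ?thesis by blast
qed

lemma all_two_small:
  assumes x: "x \<in> S" "d x = r + 2" and two: "\<forall>b \<in> N x. d b = 2"
  shows "card {b \<in> N x. d (far x b) \<le> r + 1} \<le> r"
proof (rule ccontr)
  assume big: "\<not> ?thesis"
  note indep = N_indep[of x]
  obtain \<phi> where \<phi>: "normal r (S - insert x (N x)) \<phi>" "good r (S - insert x (N x)) \<phi>"
    "\<forall>b \<in> N x. far x b \<in> S - insert x (N x)" "\<forall>j \<in> {1..r}. \<exists>b \<in> N x. \<phi> (far x b) = j"
    by (rule all_two_blocked[OF x(1) two indep])
  define T where "T = S - insert x (N x)"
  have Tn: "T \<subseteq> S" "x \<notin> T" "N x \<inter> T = {}" unfolding T_def using x by auto
  have farT: "\<forall>b \<in> N x. far x b \<in> T" using \<phi>(3) unfolding T_def .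
  have n: "normal r T \<phi>" "good r T \<phi>" using \<phi>(1,2) unfolding T_def .
  define Z where "Z = {b \<in> N x. \<phi> (far x b) \<noteq> 0}"
  define L where "L = N x - Z"
  have rZ: "r \<le> card Z" by (rule dead_card[OF x(1) subset_refl \<phi>(4) Z_def])
  have ZN: "Z \<subseteq> N x" unfolding Z_def by blast
  have finZ: "finite Z" "finite L" using finite_subset[OF ZN finN] finN[of x] unfolding L_def by auto
  have cL: "card L = d x - card Z" unfolding L_def d_def using ZN finZ by (simp add: card_Diff_subset)
  have "L \<noteq> {}"
  proof
    assume "L = {}"
    then show False using all_two_cut[OF x(1) _ two indep \<phi>(1,3) Z_def, of L "{}"] x(2) r1 ZN L_def by auto
  qed
  obtain c where c: "c \<in> L" "d (far x c) \<le> r + 1"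
  proof (cases "\<exists>c \<in> L. d (far x c) \<le> r + 1")
    case False
    then have sub: "{b \<in> N x. d (far x b) \<le> r + 1} \<subseteq> Z" unfolding L_def by blast
    then have "r + 1 \<le> card Z" using big card_mono[OF finZ(1) sub] by linarith
    then have "card L \<le> 1" using cL x(2) by linarith
    then show thesis using all_two_cut[OF x(1) _ two indep \<phi>(1,3) Z_def, of L "{}"] x(2) r1 ZN L_def by auto
  qed (use that in blast)
  define L0 where "L0 = L - {c}"
  have cL0: "card L0 \<le> 1" unfolding L0_def using cL rZ x(2) c(1) finZ by simp
  have nbx: "nb T x = {}" by (rule nb_disj[OF Tn(1,3)])
  have LZ: "L0 \<union> Z \<subseteq> N x" "c \<in> N x" "c \<notin> L0 \<union> Z" "\<phi> (far x c) = 0" "L0 \<inter> Z = {}"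
    using ZN c(1) unfolding L0_def L_def Z_def by blast+
  have "\<exists>\<psi>. good r (insert x (T \<union> L0 \<union> Z)) \<psi> \<and> \<psi> x = 0 \<and> (\<forall>b \<in> L0 \<union> Z. \<psi> b = 0) \<and> (\<forall>u \<in> T. \<psi> u = \<phi> u)"
  proof (rule add_forest_centre[OF n(2) Tn(1) x(1) Tn(2) LZ(1) _ LZ(5)])
    show "(L0 \<union> Z) \<inter> T = {}" using LZ(1) Tn(3) by blast
    show "\<forall>b \<in> L0 \<union> Z. d b = 2 \<and> far x b \<in> T" using LZ(1) two farT by blast
    show "\<forall>b \<in> L0 \<union> Z. \<forall>b' \<in> L0 \<union> Z. \<not> E b b'" using LZ(1) indep by blast
    show "\<forall>b \<in> Z. \<phi> (far x b) \<noteq> 0" unfolding Z_def by blast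
  qed (use cL0 nbx in auto)
  then obtain \<psi> where \<psi>: "good r (insert x (T \<union> L0 \<union> Z)) \<psi>" "\<psi> x = 0" "\<forall>b \<in> L0 \<union> Z. \<psi> b = 0"
    "\<forall>u \<in> T. \<psi> u = \<phi> u" by blast
  have "\<exists>\<chi>. good r (insert c (insert x (T \<union> L0 \<union> Z))) \<chi>"
  proof (rule cut_one[OF \<psi>(1) _ _ _ Tn(2) \<psi>(2) _ _ _ \<psi>(4) LZ(2)])
    show "insert x (T \<union> L0 \<union> Z) \<subseteq> S" using Tn(1) x(1) LZ(1) by auto
    show "insert x (T \<union> L0 \<union> Z) \<subseteq> insert x (T \<union> N x)" using LZ(1) by blast
    have "\<not> E x u" if "u \<in> T" for u using nbx that unfolding nb_def by blast
    then show "\<forall>u \<in> nb (insert x (T \<union> L0 \<union> Z)) x. \<psi> u = 0" using \<psi>(3) irrefl by auto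
    show "c \<notin> insert x (T \<union> L0 \<union> Z)" using LZ(2,3) Tn(3) irrefl by auto
    show farc: "far x c \<in> T" "\<phi> (far x c) = 0" using farT LZ(2,4) by blast+
    have cc: "d c = 2" using two LZ(2) by blast
    have "c \<in> N (far x c)" using far_in[OF x(1) LZ(2) cc] by simp
    moreover have "c \<notin> T" using Tn(3) LZ(2) by blast
    ultimately show "cutok T \<phi> (far x c)" by (rule cutokI[OF n(1) Tn(1) farc(1) _ _ c(2)])
  qed (use two LZ(2) in auto)
  moreover have "insert c (insert x (T \<union> L0 \<union> Z)) = S"
    unfolding T_def L0_def L_def using ZN x(1) c(1) unfolding L_def by auto
  ultimately show False using nocol by auto
qed

lemma three_vertex:
  assumes v: "v \<in> S" and Nv: "N v = {a, b, w}" and ne: "a \<noteq> b" "a \<noteq> w" "b \<noteq> w"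
    and two: "d a = 2" "d b = 2" and w: "d w \<le> r + 1" and x: "d (far v a) \<le> r + 1"
    and y: "d (far v b) \<le> r + 1 \<or> d w \<le> r"
  shows False
proof -
  define T where "T = S - {v, a, b}"
  have aN: "a \<in> N v" "b \<in> N v" "w \<in> N v" using Nv by blast+
  have abS: "a \<in> S" "b \<in> S" "w \<in> S" "E v w" using aN by auto
  have vne: "v \<noteq> a" "v \<noteq> b" "v \<noteq> w" using aN irrefl by auto
  obtain \<phi> where n: "normal r T \<phi>" and g: "good r T \<phi>" and fin: "finite T"
    by (rule partial[of v "{v, a, b}"]) (use v abS T_def in auto)
  have Tn: "T \<subseteq> S" "v \<notin> T" "a \<notin> T" "b \<notin> T" "w \<in> T" "insert v T \<subseteq> S"
    unfolding T_def using v abS ne vne by auto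
  have nbv: "nb T v = {w}" using nb_Int[OF Nv Tn(1)] Tn by auto
  have farT: "far v a \<in> T" "far v b \<in> T"
    using far_in[OF v aN(1) two(1)] far_in[OF v aN(2) two(2)]
      far_notin_N[OF v aN(1) two(1)] far_notin_N[OF v aN(2) two(2)] aN unfolding T_def by auto
  have indep: "\<forall>b' \<in> {a, b}. \<forall>b'' \<in> {a, b}. \<not> E b' b''" using N_indep[of v] aN by blast
  have sep: "\<forall>u \<in> nb T v. \<forall>l \<in> {a, b}. \<not> E u l" unfolding nbv using N_indep[of v] aN by blast
  have wv: "v \<in> N w" using N_sym[OF v aN(3)] .
  have cw: "card (nb T w) \<le> r" "d w \<le> r \<Longrightarrow> card (nb T w) < r"
    using card_nb_le[OF Tn(1), of "{v}" w] wv Tn(2) w by auto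
  have centre: "\<exists>\<psi>. good r (insert v (T \<union> L \<union> Z)) \<psi> \<and> \<psi> v = 0 \<and> (\<forall>b \<in> L \<union> Z. \<psi> b = 0) \<and> (\<forall>u \<in> T. \<psi> u = \<phi> u)"
    if LZ: "L \<union> Z \<subseteq> {a, b}" "L \<inter> Z = {}" "card L \<le> 1" "\<forall>b \<in> Z. \<phi> (far v b) \<noteq> 0"
      "\<phi> w \<noteq> 0 \<or> L = {} \<or> isolated T \<phi> w" for L Z
  proof (rule add_forest_centre[OF g Tn(1) v Tn(2) _ _ LZ(2) _ _ LZ(3,4)])
    show "L \<union> Z \<subseteq> N v" "(L \<union> Z) \<inter> T = {}" using LZ(1) aN Tn(3,4) by blast+
    show "\<forall>b \<in> L \<union> Z. d b = 2 \<and> far v b \<in> T" using LZ(1) two farT by blast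
    show "\<forall>b \<in> L \<union> Z. \<forall>b' \<in> L \<union> Z. \<not> E b b'" using LZ(1) indep by blast
    show "\<forall>u \<in> nb T v. \<phi> u = 0 \<longrightarrow> L = {} \<and> u = w \<or> isolated T \<phi> u" using nbv LZ(5) by auto
    show "\<forall>u \<in> nb T v. \<forall>l \<in> L. \<not> E u l" using sep LZ(1) by blast
    show "\<forall>u \<in> nb T v. \<forall>u' \<in> nb T v. \<phi> u = \<phi> u' \<longrightarrow> \<phi> u \<noteq> 0 \<longrightarrow> u = u'" using nbv by simp
  qed
  have full: "insert v (T \<union> {a, b}) = S" unfolding T_def using v abS by auto
  have fin1: False if LZ: "L \<union> Z = {a, b}" "L \<inter> Z = {}" "card L \<le> 1" "\<forall>b \<in> Z. \<phi> (far v b) \<noteq> 0"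
      "\<phi> w \<noteq> 0 \<or> L = {} \<or> isolated T \<phi> w" for L Z
  proof -
    have "insert v (T \<union> L \<union> Z) = S" using full LZ(1) by blast
    then show False using centre[OF _ LZ(2-5)] LZ(1) nocol by auto
  qed
  have fin2: False if c: "c \<in> {a, b}" "L \<union> Z = {a, b} - {c}" "L \<inter> Z = {}" "card L \<le> 1"
      "\<forall>b \<in> Z. \<phi> (far v b) \<noteq> 0" "L = {} \<or> isolated T \<phi> w" "\<phi> w = 0" "\<phi> (far v c) = 0" "d (far v c) \<le> r + 1"
    for c L Z
  proof -
    have LZ: "L \<union> Z \<subseteq> {a, b}" using c(2) by blast
    obtain \<psi> where \<psi>: "good r (insert v (T \<union> L \<union> Z)) \<psi>" "\<psi> v = 0" "\<forall>b \<in> L \<union> Z. \<psi> b = 0" "\<forall>u \<in> T. \<psi> u = \<phi> u"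
      using centre[OF LZ c(3-5)] c(6) by blast
    have cN: "c \<in> N v" "d c = 2" "c \<notin> insert v (T \<union> L \<union> Z)" "far v c \<in> T" "c \<notin> T"
      using c(1,2) aN two Tn(3,4) vne farT by blast+
    have "\<exists>\<chi>. good r (insert c (insert v (T \<union> L \<union> Z))) \<chi>"
    proof (rule cut_one[OF \<psi>(1) _ _ _ Tn(2) \<psi>(2) _ _ _ \<psi>(4) cN(1-4) c(8)])
      show "insert v (T \<union> L \<union> Z) \<subseteq> S" using Tn(1) v LZ abS by blast
      show "insert v (T \<union> L \<union> Z) \<subseteq> insert v (T \<union> N v)" using LZ aN by blast
      show "\<forall>b \<in> insert v (T \<union> L \<union> Z) - T. b \<in> N v \<longrightarrow> d b = 2" using LZ two irrefl by auto
      have "nb (insert v (T \<union> L \<union> Z)) v \<subseteq> nb T v \<union> L \<union> Z" using irrefl by auto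
      then show "\<forall>u \<in> nb (insert v (T \<union> L \<union> Z)) v. \<psi> u = 0"
        using \<psi>(3,4) nbv c(7) Tn(5) by (metis Un_iff singletonD subsetD)
      have "c \<in> N (far v c)" using far_in[OF v cN(1,2)] by simp
      then show "cutok T \<phi> (far v c)" using cutokI[OF n Tn(1) cN(4) _ cN(5) c(9)] by blast
    qed auto
    moreover have "insert c (insert v (T \<union> L \<union> Z)) = S" using full c(1,2) by blast
    ultimately show False using nocol by auto
  qed
  have fin3: False if j: "j \<in> {1..r}" "free T \<phi> w j" "\<phi> (far v a) \<noteq> j" "\<phi> (far v b) \<noteq> j" for j
  proof -
    obtain \<psi> where \<psi>: "good r (insert v T) \<psi>" "\<psi> v = j" "\<forall>u \<in> T. \<psi> u = \<phi> u"
      using add_coloured_vertex[OF g Tn(2), of j] j nbv by auto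
    have "\<exists>\<chi>. good r (insert v T \<union> {a, b}) \<chi> \<and> (\<forall>b \<in> {a, b}. \<chi> b = 0) \<and> (\<forall>u \<in> insert v T. \<chi> u = \<psi> u)"
      by (rule fill_two[OF \<psi>(1) Tn(6), of v]) (use aN Tn vne two farT j \<psi>(2,3) indep in auto)
    moreover have "insert v T \<union> {a, b} = S" using full by blast
    ultimately show False using nocol by auto
  qed
  show False
  proof (cases "\<phi> (far v a) \<noteq> 0 \<and> \<phi> (far v b) \<noteq> 0")
    case True
    then show False using fin1[of "{}" "{a, b}"] by simp
  next
    case notboth: False
    show False
    proof (cases "isolated T \<phi> w")
      case True
      then have w0: "\<phi> w = 0" by (simp add: isolated_def)
      show False
      proof (cases "\<phi> (far v b) = 0")
        case False
        then show False using fin1[of "{a}" "{b}"] True ne by auto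
      next
        case b0: True
        show False
        proof (cases "\<phi> (far v a) = 0")
          case False
          then show False using fin1[of "{b}" "{a}"] True ne by auto
        next
          case a0: True
          show False using fin2[of a "{b}" "{}"] True w0 a0 x ne by auto
        qed
      qed
    next
      case False
      then obtain j where j: "j \<in> {1..r}" "free T \<phi> w j"
        using free_or_isolated[OF n fin Tn(5) cw(1)] by blast
      consider "\<phi> (far v b) = j" "\<phi> (far v a) = 0" | "\<phi> (far v a) = j" "\<phi> (far v b) = 0"
        using fin3[OF j] notboth j(1) by fastforce
      then show False
      proof cases
        case 1
        then have jb: "\<phi> (far v b) \<noteq> 0" using j by auto
        show False
        proof (cases "\<phi> w = 0")
          case True
          then show False using fin2[of a "{}" "{b}"] jb 1 x ne by auto
        next
          case False
          then show False using fin1[of "{a}" "{b}"] jb ne by auto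
        qed
      next
        case 2
        then have ja: "\<phi> (far v a) \<noteq> 0" using j by auto
        show False
        proof (cases "\<phi> w = 0")
          case False
          then show False using fin1[of "{b}" "{a}"] ja ne by auto
        next
          case w0: True
          show False
          proof (cases "d (far v b) \<le> r + 1")
            case True
            then show False using fin2[of b "{}" "{a}"] ja 2 w0 ne by auto
          next
            case nb: False
            then have c: "card (nb T w) < r" using y cw(2) by blast
            obtain u where u: "u \<in> nb T w" "\<phi> u = 0" using False w0 unfolding isolated_def by blast
            have "card (\<phi> ` (nb T w - {u})) \<le> card (nb T w - {u})" using fin by (intro card_image_le) simp
            also have "card (nb T w - {u}) < r - 1"
            proof -
              have "card (nb T w) > 0" using u(1) fin card_gt_0_iff[of "nb T w"] finite_nb[of T w] by blast
              moreover have "card (nb T w - {u}) = card (nb T w) - 1" using u(1) by (rule card_Diff_singleton)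
              ultimately show ?thesis using c by linarith
            qed
            finally have "card (\<phi> ` (nb T w - {u})) < r - 1" .
            moreover have "card (insert j (\<phi> ` (nb T w - {u}))) \<le> Suc (card (\<phi> ` (nb T w - {u})))"
              by (rule card_insert_le_m1) simp_all
            ultimately have "card (insert j (\<phi> ` (nb T w - {u}))) < r" by linarith
            then have "\<not> {1..r} \<subseteq> insert j (\<phi> ` (nb T w - {u}))"
              using card_mono[of "insert j (\<phi> ` (nb T w - {u}))" "{1..r}"] fin by auto
            then obtain j' where j': "j' \<in> {1..r}" "j' \<noteq> j" "j' \<notin> \<phi> ` (nb T w - {u})" by blast
            have "\<phi> z \<noteq> j'" if "z \<in> nb T w" for z
              using j'(1,3) u(2) that by (cases "z = u") auto
            then have "free T \<phi> w j'" using w0 j'(1) unfolding free_def by auto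
            then show False using fin3[OF j'(1)] j' 2 by auto
          qed
        qed
      qed
    qed
  qed
qed

lemma small_neighbour:
  assumes x: "x \<in> S" "d x = r + 2" and w: "w \<in> N x" "d w \<le> r + 1"
    and two: "\<forall>b \<in> N x - {w}. d b = 2" and al: "r \<le> card {b \<in> N x - {w}. alpha b}"
  shows False
proof -
  define P where "P = N x - {w}"
  define T where "T = S - insert x P"
  have xw: "x \<noteq> w" "w \<in> S" using w(1) irrefl by auto
  have xP: "x \<notin> P" unfolding P_def using irrefl by auto
  have PN: "P \<subseteq> N x" "w \<notin> P" "P \<subseteq> S" "insert w P = N x" unfolding P_def using w(1) by auto
  have finP: "finite P" using PN(1) finN finite_subset by blast
  have cP: "card P = r + 1" using x(2) w(1) finN[of x] unfolding P_def d_def by simp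
  obtain A where A: "A \<subseteq> {b \<in> P. alpha b}" "card A = r" "finite A"
    using obtain_subset_with_card_n[of r "{b \<in> P. alpha b}"] al unfolding P_def by auto
  have AP: "A \<subseteq> P" "\<forall>a \<in> A. alpha a" using A(1) by auto
  have "card (P - A) = 1" using A AP finP cP by (simp add: card_Diff_subset)
  then obtain b0 where b0: "P - A = {b0}" by (auto simp: card_1_singleton_iff)
  have PA: "P = insert b0 A" "b0 \<notin> A" "b0 \<in> P" using b0 AP by blast+
  obtain \<phi> where n: "normal r T \<phi>" and g: "good r T \<phi>" and fin: "finite T"
    by (rule partial[of x "insert x P"]) (use x PN(3) T_def in auto)
  have Tn: "T \<subseteq> S" "x \<notin> T" "P \<inter> T = {}" "w \<in> T" "insert x T \<subseteq> S"
    unfolding T_def using x PN xw by auto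
  have "nb T x = N x \<inter> T" using nb_Int[OF refl Tn(1)] .
  then have nbx: "nb T x = {w}" using PN(4) Tn(3,4) by blast
  have twoP: "\<forall>b \<in> P. d b = 2" using two unfolding P_def .
  have farT: "\<forall>b \<in> P. far x b \<in> T"
  proof
    fix b assume b: "b \<in> P"
    then have bN: "b \<in> N x" "d b = 2" using PN(1) twoP by blast+
    show "far x b \<in> T" using far_in[OF x(1) bN] far_notin_N[OF x(1) bN] PN(1) unfolding T_def by blast
  qed
  have far0: "\<phi> (far x a) = 0" if "a \<in> A" for a
    by (rule alpha_far_zero[OF _ x(1) _ _ Tn(1) _ _ n]) (use that AP PN Tn farT x r2 in auto)
  have indep: "\<forall>b \<in> P. \<forall>b' \<in> P. \<not> E b b'" using N_indep PN(1) by blast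
  have sep: "\<forall>l \<in> P. \<not> E w l" using N_indep PN(1) w(1) by blast
  have full: "insert x (T \<union> P) = S" unfolding T_def using x PN(3) by auto
  have cw: "card (nb T w) \<le> r"
    using card_nb_le[OF Tn(1), of "{x}" w] N_sym[OF x(1) w(1)] Tn(2) w(2) by auto
  have fin3: False if j: "j \<in> {1..r}" "free T \<phi> w j" "\<phi> (far x b0) \<noteq> j" for j
  proof -
    obtain \<psi> where \<psi>: "good r (insert x T) \<psi>" "\<psi> x = j" "\<forall>u \<in> T. \<psi> u = \<phi> u"
      using add_coloured_vertex[OF g Tn(2), of j] j nbx by auto
    have "\<exists>\<chi>. good r (insert x T \<union> P) \<chi> \<and> (\<forall>b \<in> P. \<chi> b = 0) \<and> (\<forall>u \<in> insert x T. \<chi> u = \<psi> u)"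
    proof (rule fill_two[OF \<psi>(1) Tn(5) _ PN(1) _ _ indep])
      show "P \<inter> insert x T = {}" using Tn(3) xP by simp
      show "\<forall>b \<in> P. d b = 2 \<and> far x b \<in> insert x T \<and> \<psi> (far x b) \<noteq> \<psi> x"
      proof
        fix b assume b: "b \<in> P"
        have "\<phi> (far x b) \<noteq> j" using b PA(1) far0[of b] j(1,3) by auto
        then show "d b = 2 \<and> far x b \<in> insert x T \<and> \<psi> (far x b) \<noteq> \<psi> x" using b twoP farT \<psi>(2,3) by simp
      qed
    qed simp
    moreover have "insert x T \<union> P = S" using full by simp
    ultimately show False using nocol by auto
  qed
  have finC: False if P3: "L \<union> Z \<union> C = P" "L \<inter> Z = {}" "C \<inter> (L \<union> Z) = {}" "card L \<le> 1" "\<forall>b \<in> Z. \<phi> (far x b) \<noteq> 0"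
      "C \<subseteq> A" "\<phi> w \<noteq> 0 \<or> L = {} \<or> isolated T \<phi> w" "card C < r \<or> \<phi> w = 0" for L Z C
  proof -
    have LZ: "L \<union> Z \<subseteq> P" using P3(1) by blast
    have "\<exists>\<psi>. good r (insert x (T \<union> L \<union> Z)) \<psi> \<and> \<psi> x = 0 \<and> (\<forall>b \<in> L \<union> Z. \<psi> b = 0) \<and> (\<forall>u \<in> T. \<psi> u = \<phi> u)"
    proof (rule add_forest_centre[OF g Tn(1) x(1) Tn(2) _ _ P3(2) _ _ P3(4,5)])
      show "L \<union> Z \<subseteq> N x" "(L \<union> Z) \<inter> T = {}" using LZ PN Tn(3) by blast+
      show "\<forall>b \<in> L \<union> Z. d b = 2 \<and> far x b \<in> T" using LZ twoP farT by blast
      show "\<forall>b \<in> L \<union> Z. \<forall>b' \<in> L \<union> Z. \<not> E b b'" using LZ indep by blast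
      show "\<forall>u \<in> nb T x. \<phi> u = 0 \<longrightarrow> L = {} \<and> u = w \<or> isolated T \<phi> u" using nbx P3(7) by auto
      show "\<forall>u \<in> nb T x. \<forall>l \<in> L. \<not> E u l" unfolding nbx using sep LZ by blast
      show "\<forall>u \<in> nb T x. \<forall>u' \<in> nb T x. \<phi> u = \<phi> u' \<longrightarrow> \<phi> u \<noteq> 0 \<longrightarrow> u = u'" using nbx by simp
    qed
    then obtain \<psi> where \<psi>: "good r (insert x (T \<union> L \<union> Z)) \<psi>" "\<psi> x = 0" "\<forall>b \<in> L \<union> Z. \<psi> b = 0"
      "\<forall>u \<in> T. \<psi> u = \<phi> u" by blast
    have "\<exists>\<chi>. good r (insert x (T \<union> L \<union> Z) \<union> C) \<chi> \<and> (\<forall>u \<in> insert x (T \<union> L \<union> Z). \<chi> u = \<psi> u)"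
    proof (rule cut_many[OF \<psi>(1) _ _ \<psi>(2)])
      show "insert x (T \<union> L \<union> Z) \<subseteq> S" using Tn(1) x(1) LZ PN(3) by blast
      show "C \<subseteq> N x" using P3(1) PN(1) by blast
      show "C \<inter> insert x (T \<union> L \<union> Z) = {}" using P3(1,3) Tn(3) xP by blast
      show "\<forall>a \<in> C. alpha a \<and> far x a \<in> insert x (T \<union> L \<union> Z) \<and> \<psi> (far x a) = 0"
      proof
        fix a assume a: "a \<in> C"
        then have "a \<in> A" "far x a \<in> T" using P3(6) AP farT by blast+
        then show "alpha a \<and> far x a \<in> insert x (T \<union> L \<union> Z) \<and> \<psi> (far x a) = 0"
          using AP(2) far0 \<psi>(4) by simp
      qed
      have "nb (insert x (T \<union> L \<union> Z)) x \<subseteq> insert w (L \<union> Z)" using nbx irrefl unfolding nb_def by blast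
      then have "\<psi> ` nb (insert x (T \<union> L \<union> Z)) x \<subseteq> {\<phi> w, 0}" using \<psi>(3,4) Tn(4) by auto
      then have sub: "{1..r} - {\<phi> w, 0} \<subseteq> {1..r} - \<psi> ` nb (insert x (T \<union> L \<union> Z)) x" by blast
      have "{1..r} - {\<phi> w, 0} = {1..r} - {\<phi> w}" by auto
      then have "r - 1 \<le> card ({1..r} - {\<phi> w, 0})" "\<phi> w = 0 \<Longrightarrow> card ({1..r} - {\<phi> w, 0}) = r"
        by (simp_all add: card_Diff_singleton_if)
      moreover have "card C \<le> r" using P3(6) A by (metis card_mono)
      ultimately have "card C \<le> card ({1..r} - {\<phi> w, 0})" using P3(8) by linarith
      also have "\<dots> \<le> card ({1..r} - \<psi> ` nb (insert x (T \<union> L \<union> Z)) x)" using sub by (intro card_mono) auto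
      finally show "card C \<le> card ({1..r} - \<psi> ` nb (insert x (T \<union> L \<union> Z)) x)" .
    qed (use x r2 in simp_all)
    moreover have "insert x (T \<union> L \<union> Z) \<union> C = S" using full P3(1) by blast
    ultimately show False using nocol by auto
  qed
  show False
  proof (cases "\<exists>j \<in> {1..r}. free T \<phi> w j")
    case True
    then obtain j where j: "j \<in> {1..r}" "free T \<phi> w j" by blast
    then have bj: "\<phi> (far x b0) = j" using fin3 by blast
    then have b00: "\<phi> (far x b0) \<noteq> 0" using j by auto
    show False
    proof (cases "\<phi> w = 0")
      case True
      show False using finC[of "{}" "{b0}" A] PA b00 True by auto
    next
      case False
      have "A \<noteq> {}" using A(2) r2 by auto
      then obtain a0 where a0: "a0 \<in> A" by blast
      have "card (A - {a0}) < r" using A(2,3) a0 r2 by simp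
      moreover have "{a0} \<union> {b0} \<union> (A - {a0}) = P" "a0 \<noteq> b0" using PA a0 by auto
      ultimately show False using finC[of "{a0}" "{b0}" "A - {a0}"] PA(2) b00 False by auto
    qed
  next
    case False
    then have iso: "isolated T \<phi> w" using free_or_isolated[OF n fin Tn(4) cw] by blast
    then have w0: "\<phi> w = 0" by (simp add: isolated_def)
    show False
    proof (cases "\<phi> (far x b0) = 0")
      case True
      show False using finC[of "{b0}" "{}" A] PA iso w0 by auto
    next
      case False
      show False using finC[of "{}" "{b0}" A] PA False w0 by auto
    qed
  qed
qed

definition Q :: "'a \<Rightarrow> 'a \<Rightarrow> 'a set" where "Q x w = N w - {x}"

definition eta :: "'a \<Rightarrow> 'a \<Rightarrow> bool" where
  "eta x w \<longleftrightarrow> w \<in> N x \<and> 3 \<le> d w \<and> (\<forall>a \<in> Q x w. d a = 2) \<and>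
     (card {a \<in> Q x w. \<not> alpha a} = 0 \<or>
      card {a \<in> Q x w. \<not> alpha a} = 1 \<and> card (Q x w) \<le> r + 1 \<or>
      card {a \<in> Q x w. \<not> alpha a} = 2 \<and> card (Q x w) = 2)"

lemma finQ [simp]: "finite (Q x w)"
  unfolding Q_def by (rule finite_Diff) (rule finN)

lemma resolve_colour:
  assumes g: "good r T \<psi>" and TS: "T \<subseteq> S" and x: "x \<in> T" and w: "w \<in> N x" "w \<notin> T" "nb T w = {x}"
    and q: "Q x w \<inter> T = {}" "\<forall>a \<in> Q x w. d a = 2 \<and> far w a \<in> T \<and> \<psi> (far w a) \<noteq> k"
    and k: "1 \<le> k" "k \<le> r" "free T \<psi> x k"
  shows "\<exists>\<chi>. good r (insert w (T \<union> Q x w)) \<chi> \<and> \<chi> w = k \<and> (\<forall>u \<in> T. \<chi> u = \<psi> u)"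
proof -
  have wS: "w \<in> S" using w(1) by simp
  obtain \<psi>' where \<psi>': "good r (insert w T) \<psi>'" "\<psi>' w = k" "\<forall>u \<in> T. \<psi>' u = \<psi> u"
    using add_coloured_vertex[OF g w(2) k(1,2)] w(3) k(3) by auto
  have QN: "Q x w \<subseteq> N w" unfolding Q_def by blast
  have "\<exists>\<chi>. good r (insert w T \<union> Q x w) \<chi> \<and> (\<forall>b \<in> Q x w. \<chi> b = 0) \<and> (\<forall>u \<in> insert w T. \<chi> u = \<psi>' u)"
  proof (rule fill_two[OF \<psi>'(1) _ _ QN])
    show "insert w T \<subseteq> S" using TS wS by simp
    show "Q x w \<inter> insert w T = {}" using q(1) QN irrefl by auto
    show "\<forall>b \<in> Q x w. d b = 2 \<and> far w b \<in> insert w T \<and> \<psi>' (far w b) \<noteq> \<psi>' w" using q(2) \<psi>'(2,3) by simp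
    show "\<forall>b \<in> Q x w. \<forall>b' \<in> Q x w. \<not> E b b'" using N_indep QN by blast
  qed simp
  then obtain \<chi> where "good r (insert w T \<union> Q x w) \<chi>" "\<forall>u \<in> insert w T. \<chi> u = \<psi>' u" by blast
  then show ?thesis using \<psi>'(2,3) by (intro exI[of _ \<chi>]) simp
qed

lemma resolve_forest:
  assumes g: "good r T \<psi>" and TS: "T \<subseteq> S" and x: "x \<in> T" and w: "w \<in> N x" "w \<notin> T" "nb T w = {x}" "d w \<noteq> 2"
    and q: "Q x w \<inter> T = {}" "\<forall>a \<in> Q x w. d a = 2 \<and> far w a \<in> T"
    and LZA: "Q x w = L \<union> Z \<union> A" "L \<inter> Z = {}" "A \<inter> (L \<union> Z) = {}" "card L \<le> 1" "\<forall>a \<in> Z. \<psi> (far w a) \<noteq> 0"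
      "\<forall>a \<in> A. alpha a \<and> \<psi> (far w a) = 0"
    and leaf: "\<psi> x \<noteq> 0 \<or> L = {}" and A: "card A \<le> r - 1"
  shows "\<exists>\<chi>. good r (insert w (T \<union> Q x w)) \<chi> \<and> (\<forall>u \<in> T. \<chi> u = \<psi> u)"
proof -
  have wS: "w \<in> S" using w(1) by simp
  have QN: "Q x w \<subseteq> N w" "x \<notin> Q x w" unfolding Q_def by blast+
  have xw: "E w x" using w(1) sym by auto
  have LQ: "L \<union> Z \<subseteq> Q x w" "A \<subseteq> Q x w" using LZA(1) by blast+
  have "\<exists>\<psi>'. good r (insert w (T \<union> L \<union> Z)) \<psi>' \<and> \<psi>' w = 0 \<and> (\<forall>b \<in> L \<union> Z. \<psi>' b = 0) \<and> (\<forall>u \<in> T. \<psi>' u = \<psi> u)"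
  proof (rule add_forest_centre[OF g TS wS w(2) _ _ LZA(2) _ _ LZA(4,5)])
    show "L \<union> Z \<subseteq> N w" "(L \<union> Z) \<inter> T = {}" using LQ QN q(1) by blast+
    show "\<forall>b \<in> L \<union> Z. d b = 2 \<and> far w b \<in> T" using LQ q(2) by blast
    show "\<forall>b \<in> L \<union> Z. \<forall>b' \<in> L \<union> Z. \<not> E b b'" using LQ QN N_indep[of w] by blast
    show "\<forall>u \<in> nb T w. \<psi> u = 0 \<longrightarrow> L = {} \<and> u = x \<or> isolated T \<psi> u" using w(3) leaf by auto
    have "x \<in> N w" using xw x TS by auto
    then have "\<forall>l \<in> L. \<not> E x l" using N_indep[of w] LQ QN(1) by blast
    then show "\<forall>u \<in> nb T w. \<forall>l \<in> L. \<not> E u l" unfolding w(3) by blast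
    show "\<forall>u \<in> nb T w. \<forall>u' \<in> nb T w. \<psi> u = \<psi> u' \<longrightarrow> \<psi> u \<noteq> 0 \<longrightarrow> u = u'" using w(3) by simp
  qed
  then obtain \<psi>' where \<psi>': "good r (insert w (T \<union> L \<union> Z)) \<psi>'" "\<psi>' w = 0" "\<forall>b \<in> L \<union> Z. \<psi>' b = 0"
    "\<forall>u \<in> T. \<psi>' u = \<psi> u" by blast
  have wQ: "w \<notin> Q x w" using QN(1) irrefl by auto
  have "\<exists>\<chi>. good r (insert w (T \<union> L \<union> Z) \<union> A) \<chi> \<and> (\<forall>u \<in> insert w (T \<union> L \<union> Z). \<chi> u = \<psi>' u)"
  proof (rule cut_many[OF \<psi>'(1) _ _ \<psi>'(2) w(4)])
    show "insert w (T \<union> L \<union> Z) \<subseteq> S" using TS wS LQ QN(1) by auto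
    show "A \<subseteq> N w" using LQ QN by blast
    show "A \<inter> insert w (T \<union> L \<union> Z) = {}" using LZA(3) q(1) LQ wQ by blast
    show "\<forall>a \<in> A. alpha a \<and> far w a \<in> insert w (T \<union> L \<union> Z) \<and> \<psi>' (far w a) = 0"
      using LZA(6) q(2) LQ(2) \<psi>'(4) by auto
    have "nb (insert w (T \<union> L \<union> Z)) w \<subseteq> insert x (L \<union> Z)" using w(3) irrefl unfolding nb_def by blast
    then have "\<psi>' ` nb (insert w (T \<union> L \<union> Z)) w \<subseteq> {\<psi> x, 0}" using \<psi>'(3,4) x by auto
    then have sub: "{1..r} - {\<psi> x, 0} \<subseteq> {1..r} - \<psi>' ` nb (insert w (T \<union> L \<union> Z)) w" by blast
    have "{1..r} - {\<psi> x, 0} = {1..r} - {\<psi> x}" by auto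
    then have "r - 1 \<le> card ({1..r} - {\<psi> x, 0})" by (simp add: card_Diff_singleton_if)
    also have "\<dots> \<le> card ({1..r} - \<psi>' ` nb (insert w (T \<union> L \<union> Z)) w)" using sub by (intro card_mono) auto
    finally show "card A \<le> card ({1..r} - \<psi>' ` nb (insert w (T \<union> L \<union> Z)) w)" using A by simp
  qed simp
  then obtain \<chi> where \<chi>: "good r (insert w (T \<union> L \<union> Z) \<union> A) \<chi>" "\<forall>u \<in> insert w (T \<union> L \<union> Z). \<chi> u = \<psi>' u" by blast
  have "insert w (T \<union> L \<union> Z) \<union> A = insert w (T \<union> Q x w)" using LZA(1) by blast
  then show ?thesis using \<chi> \<psi>'(4) by (intro exI[of _ \<chi>]) auto
qed

lemma resolve_eta:
  assumes g: "good r T \<psi>" and TS: "T \<subseteq> S" and x: "x \<in> T" "\<psi> x \<noteq> 0" and e: "eta x w"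
    and w: "w \<notin> T" "nb T w = {x}"
    and q: "Q x w \<inter> T = {}" "\<forall>a \<in> Q x w. far w a \<in> T" "\<forall>a \<in> Q x w. alpha a \<longrightarrow> \<psi> (far w a) = 0"
    and k: "1 \<le> k" "k \<le> r" "free T \<psi> x k"
  shows "\<exists>\<chi>. good r (insert w (T \<union> Q x w)) \<chi> \<and> (\<forall>u \<in> T. \<chi> u = \<psi> u)"
proof -
  have wN: "w \<in> N x" "d w \<noteq> 2" "\<forall>a \<in> Q x w. d a = 2" using e unfolding eta_def by auto
  show ?thesis
  proof (cases "\<forall>a \<in> Q x w. \<psi> (far w a) \<noteq> k")
    case True
    then show ?thesis using resolve_colour[OF g TS x(1) wN(1) w q(1) _ k] wN(3) q(2) by blast
  next
    case False
    then obtain a0 where a0: "a0 \<in> Q x w" "\<psi> (far w a0) \<noteq> 0" using k(1) by force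
    define Qn where "Qn = {a \<in> Q x w. \<not> alpha a}"
    have a0n: "a0 \<in> Qn" using a0 q(3) unfolding Qn_def by auto
    have finn: "finite Qn" unfolding Qn_def by simp
    have q2: "\<forall>a \<in> Q x w. d a = 2 \<and> far w a \<in> T" using wN(3) q(2) by blast
    have "card Qn \<noteq> 0" using a0n finn by auto
    then consider "card Qn = 1" "card (Q x w) \<le> r + 1" | "card (Q x w) = 2"
      using e unfolding eta_def Qn_def by metis
    then show ?thesis
    proof cases
      case 1
      then have Qn: "Qn = {a0}" using a0n by (auto simp: card_1_singleton_iff)
      define A where "A = Q x w - {a0}"
      have A: "\<forall>a \<in> A. alpha a \<and> \<psi> (far w a) = 0" "card A \<le> r" "finite A" "a0 \<notin> A" "Q x w = insert a0 A"
        using Qn q(3) 1(2) a0(1) unfolding A_def Qn_def by auto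
      show ?thesis
      proof (cases "A = {}")
        case True
        show ?thesis
          by (rule resolve_forest[OF g TS x(1) wN(1) w wN(2) q(1) q2, of "{}" "{a0}" "{}"])
            (use True A(5) a0(2) in auto)
      next
        case False
        then obtain l where l: "l \<in> A" by blast
        show ?thesis
          by (rule resolve_forest[OF g TS x(1) wN(1) w wN(2) q(1) q2, of "{l}" "{a0}" "A - {l}"])
            (use l A a0(2) x(2) in auto)
      qed
    next
      case 2
      define Z where "Z = {a \<in> Q x w. \<psi> (far w a) \<noteq> 0}"
      define L where "L = Q x w - Z"
      have "card L < card (Q x w)" unfolding L_def Z_def using a0 by (intro psubset_card_mono) auto
      then have "card L \<le> 1" using 2 by linarith
      then show ?thesis
        by (intro resolve_forest[OF g TS x(1) wN(1) w wN(2) q(1) q2, of L Z "{}"])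
          (use x(2) in \<open>auto simp: L_def Z_def\<close>)
    qed
  qed
qed

end

locale hub = mincex6 +
  fixes x :: 'a and P H :: "'a set"
  assumes xS: "x \<in> S" and NPH: "N x = P \<union> H" and PH: "P \<inter> H = {}"
    and twoP: "b \<in> P \<Longrightarrow> d b = 2" and etaH: "w \<in> H \<Longrightarrow> eta x w" and dx: "d x \<noteq> 2"
begin

definition T :: "'a set" where "T = S - insert x (N x) - (\<Union>w \<in> H. Q x w)"

lemma PN: "P \<subseteq> N x" "H \<subseteq> N x" using NPH by blast+

lemma TS: "T \<subseteq> S" "x \<notin> T" "N x \<inter> T = {}" "w \<in> H \<Longrightarrow> Q x w \<inter> T = {}"
  unfolding T_def by blast+

lemma QN: "Q x w \<subseteq> N w" "x \<notin> Q x w" unfolding Q_def by blast+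

lemma QD: assumes "w \<in> H" "a \<in> Q x w"
  shows "d a = 2" "a \<in> S" "E w a" "E a w" "E x w" "E w x" "w \<in> S" "a \<noteq> x" "w \<in> N x" "a \<in> N w"
proof -
  have "eta x w" using etaH assms(1) by blast
  then show "d a = 2" "w \<in> N x" using assms(2) unfolding eta_def by auto
  then show "E x w" "E w x" "w \<in> S" using sym by auto
  show "a \<in> N w" "a \<noteq> x" using assms(2) unfolding Q_def by auto
  then show "a \<in> S" "E w a" "E a w" using sym by auto
qed

lemma Q_notin_N: "w \<in> H \<Longrightarrow> a \<in> Q x w \<Longrightarrow> a \<notin> N x"
  using N_indep[of x] QD(3,9) by blast

lemma Q_disj: "w \<in> H \<Longrightarrow> w' \<in> H \<Longrightarrow> w \<noteq> w' \<Longrightarrow> Q x w \<inter> Q x w' = {}"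
proof (rule ccontr)
  assume h: "w \<in> H" "w' \<in> H" "w \<noteq> w'" "Q x w \<inter> Q x w' \<noteq> {}"
  then obtain a where a: "a \<in> Q x w" "a \<in> Q x w'" by blast
  show False using noC4[OF QD(5,3)[OF h(1) a(1)] QD(4,6)[OF h(2) a(2)]] QD(8)[OF h(1) a(1)] h(3) by simp
qed

lemma farP: assumes "b \<in> P" shows "far x b \<in> T"
proof -
  have b: "b \<in> N x" "d b = 2" using assms PN twoP by blast+
  note f = far_in[OF xS b]
  have "far x b \<notin> Q x w" if "w \<in> H" for w
  proof
    assume a: "far x b \<in> Q x w"
    have "w \<noteq> b" using that assms PH by blast
    then show False using noC4[OF QD(5,3)[OF that a] f(4,8)] f(2) by simp
  qed
  then show ?thesis using f far_notin_N[OF xS b] unfolding T_def by blast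
qed

lemma farQ: assumes w: "w \<in> H" and a: "a \<in> Q x w" shows "far w a \<in> T"
proof -
  note q = QD[OF w a]
  note f = far_in[OF q(7,10,1)]
  have 1: "far w a \<noteq> x" using f(3) q Q_notin_N[OF w a] sym[of a x] by auto
  have 2: "far w a \<notin> N x"
  proof
    assume "far w a \<in> N x"
    then have "E (far w a) x" using sym by auto
    then show False using noC4[OF q(5,3) f(3)] q(8) f(2) by simp
  qed
  have 3: "far w a \<notin> Q x w'" if w': "w' \<in> H" for w'
  proof
    assume b: "far w a \<in> Q x w'"
    note q' = QD[OF w' b]
    show False
    proof (cases "w' = w")
      case True
      then show False using noC3[OF q(3) f(3)] q'(4) by simp
    next
      case False
      show False by (rule noC5[OF q(5,3) f(3) q'(4,6)])
    qed
  qed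
  show ?thesis using 1 2 3 f(1) unfolding T_def by blast
qed

lemma full: "insert x (T \<union> P) \<union> (\<Union>w \<in> H. insert w (Q x w)) = S"
proof
  have "insert w (Q x w) \<subseteq> S" if "w \<in> H" for w
    using that PN(2) QN[of w] by auto
  then show "insert x (T \<union> P) \<union> (\<Union>w \<in> H. insert w (Q x w)) \<subseteq> S" using TS(1) xS PN(1) by auto
  show "S \<subseteq> insert x (T \<union> P) \<union> (\<Union>w \<in> H. insert w (Q x w))" unfolding T_def using NPH by blast
qed

lemma H_nb:
  assumes w: "w \<in> H" and T': "insert x T \<subseteq> T'" "T' \<subseteq> insert x (T \<union> P) \<union> (\<Union>w \<in> H - {w}. insert w (Q x w))"
  shows "w \<notin> T'" "nb T' w = {x}" "Q x w \<inter> T' = {}" "T' \<subseteq> S"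
proof -
  have e: "eta x w" "w \<in> N x" "3 \<le> d w" using etaH[OF w] unfolding eta_def by auto
  have QT: "Q x w \<inter> T' = {}"
  proof (rule ccontr)
    assume "Q x w \<inter> T' \<noteq> {}"
    then obtain a where a: "a \<in> Q x w" "a \<in> T'" by blast
    have "a \<notin> N x" "a \<noteq> x" "a \<notin> T" using Q_notin_N[OF w a(1)] QD[OF w a(1)] TS(4)[OF w] a(1) by blast+
    then obtain w' where w': "w' \<in> H" "w' \<noteq> w" "a \<in> insert w' (Q x w')" using a(2) T'(2) PN by blast
    then have "a \<in> Q x w'" using PN(2) \<open>a \<notin> N x\<close> by blast
    then show False using Q_disj[OF w w'(1)] w'(2) a(1) by blast
  qed
  show "w \<notin> T'"
  proof
    assume "w \<in> T'"
    then consider "w = x" | "w \<in> T" | "w \<in> P" | w' where "w' \<in> H" "w' \<noteq> w" "w \<in> Q x w'"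
      using T'(2) by blast
    then show False
    proof cases
      case 4
      then show False using QD(1)[OF 4(1,3)] e(3) by simp
    qed (use e(2) irrefl TS(3) PH w in auto)
  qed
  show "T' \<subseteq> S"
  proof -
    have "(\<Union>w \<in> H - {w}. insert w (Q x w)) \<subseteq> (\<Union>w \<in> H. insert w (Q x w))" by blast
    then show ?thesis using T'(2) full by blast
  qed
  then have "nb T' w = N w \<inter> T'" by (rule nb_Int[OF refl])
  moreover have "N w = insert x (Q x w)" unfolding Q_def using N_sym[OF xS e(2)] by blast
  ultimately show "nb T' w = {x}" using QT T'(1) by blast
  show "Q x w \<inter> T' = {}" by (rule QT)
qed

lemma resolve_all:
  assumes g: "good r T1 \<psi>" and T1: "insert x T \<subseteq> T1" "T1 \<subseteq> insert x (T \<union> P)" and j: "2 \<le> \<psi> x"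
    and al: "\<forall>w \<in> H. \<forall>a \<in> Q x w. alpha a \<longrightarrow> \<psi> (far w a) = 0"
  shows "\<exists>\<chi>. good r (T1 \<union> (\<Union>w \<in> H. insert w (Q x w))) \<chi> \<and> (\<forall>u \<in> T1. \<chi> u = \<psi> u)"
proof -
  have "\<exists>\<chi>. good r (T1 \<union> (\<Union>w \<in> K. insert w (Q x w))) \<chi> \<and> (\<forall>u \<in> T1. \<chi> u = \<psi> u)" if "finite K" "K \<subseteq> H" for K
    using that
  proof (induction K rule: finite_induct)
    case empty
    show ?case using g by auto
  next
    case (insert w K)
    define T' where "T' = T1 \<union> (\<Union>w \<in> K. insert w (Q x w))"
    obtain \<chi> where \<chi>: "good r T' \<chi>" "\<forall>u \<in> T1. \<chi> u = \<psi> u" using insert unfolding T'_def by auto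
    have w: "w \<in> H" using insert by blast
    have K: "K \<subseteq> H - {w}" using insert by blast
    have T': "insert x T \<subseteq> T'" "T' \<subseteq> insert x (T \<union> P) \<union> (\<Union>w \<in> H - {w}. insert w (Q x w))"
      using T1 K unfolding T'_def by blast+
    note h = H_nb[OF w T']
    have farT: "\<forall>a \<in> Q x w. far w a \<in> T1" using farQ[OF w] T1(1) by blast
    have xT: "x \<in> T1" using T1(1) by blast
    have "\<exists>\<chi>'. good r (insert w (T' \<union> Q x w)) \<chi>' \<and> (\<forall>u \<in> T'. \<chi>' u = \<chi> u)"
    proof (rule resolve_eta[OF \<chi>(1) h(4) _ _ etaH[OF w] h(1,2,3), of 1])
      show "x \<in> T'" "\<chi> x \<noteq> 0" using xT \<chi>(2) j unfolding T'_def by auto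
      show "\<forall>a \<in> Q x w. far w a \<in> T'" using farT unfolding T'_def by blast
      show "\<forall>a \<in> Q x w. alpha a \<longrightarrow> \<chi> (far w a) = 0" using farT \<chi>(2) al w by simp
      show "free T' \<chi> x 1" using j \<chi>(2) xT unfolding free_def by simp
    qed (use r1 in auto)
    then obtain \<chi>' where \<chi>': "good r (insert w (T' \<union> Q x w)) \<chi>'" "\<forall>u \<in> T'. \<chi>' u = \<chi> u" by blast
    have "insert w (T' \<union> Q x w) = T1 \<union> (\<Union>w \<in> insert w K. insert w (Q x w))" unfolding T'_def by blast
    then have "good r (T1 \<union> (\<Union>w \<in> insert w K. insert w (Q x w))) \<chi>'" using \<chi>'(1) by simp
    moreover have "\<forall>u \<in> T1. \<chi>' u = \<psi> u" using \<chi>'(2) \<chi>(2) unfolding T'_def by simp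
    ultimately show ?case by blast
  qed
  moreover have "finite H" using PN(2) finN finite_subset by blast
  ultimately show ?thesis by blast
qed

lemma hub_colouring:
  obtains \<phi> where "normal r T \<phi>" "good r T \<phi>" "\<forall>b \<in> P. alpha b \<longrightarrow> \<phi> (far x b) = 0"
    "\<forall>w \<in> H. \<forall>a \<in> Q x w. alpha a \<longrightarrow> \<phi> (far w a) = 0"
proof -
  define D where "D = insert x (N x) \<union> (\<Union>w \<in> H. Q x w)"
  have T_eq: "T = S - D" unfolding T_def D_def by blast
  have "D \<subseteq> S" unfolding D_def using xS QD(2) by auto
  then obtain \<phi> where n: "normal r T \<phi>" "good r T \<phi>"
    unfolding T_eq using partial[of x D] unfolding D_def by blast
  have 1: "\<phi> (far x b) = 0" if "b \<in> P" "alpha b" for b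
    by (rule alpha_far_zero[OF that(2) xS _ dx TS(1) _ farP[OF that(1)] n(1)]) (use PN(1) that(1) TS(3) in blast)+
  have 2: "\<phi> (far w a) = 0" if wa: "w \<in> H" "a \<in> Q x w" "alpha a" for w a
  proof (rule alpha_far_zero[OF wa(3) _ _ _ TS(1) _ farQ[OF wa(1,2)] n(1)])
    show "w \<in> S" "a \<in> N w" using QD[OF wa(1,2)] by blast+
    show "d w \<noteq> 2" using etaH[OF wa(1)] unfolding eta_def by auto
    show "a \<notin> T" using TS(4)[OF wa(1)] wa(2) by blast
  qed
  show thesis using that n 1 2 by blast
qed

lemma finish_coloured:
  assumes g: "good r (insert x T \<union> (\<Union>w \<in> H. insert w (Q x w))) \<chi>" and c: "\<forall>b \<in> P. \<chi> (far x b) \<noteq> \<chi> x"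
  shows False
proof -
  define T' where "T' = insert x T \<union> (\<Union>w \<in> H. insert w (Q x w))"
  have T'P: "T' \<union> P = S" unfolding T'_def using full by blast
  have "\<exists>\<chi>'. good r (T' \<union> P) \<chi>' \<and> (\<forall>b \<in> P. \<chi>' b = 0) \<and> (\<forall>u \<in> T'. \<chi>' u = \<chi> u)"
  proof (rule fill_two)
    show "good r T' \<chi>" using g unfolding T'_def .
    show "T' \<subseteq> S" using T'P by blast
    show "x \<in> T'" unfolding T'_def by blast
    show "P \<subseteq> N x" by (rule PN)
    show "P \<inter> T' = {}"
    proof -
      have "b \<notin> Q x w" if "b \<in> P" "w \<in> H" for b w using Q_notin_N[OF that(2)] that(1) PN(1) by blast
      moreover have "x \<notin> P" using PN(1) irrefl by auto
      ultimately show ?thesis unfolding T'_def using PH TS(3) PN(1) by blast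
    qed
    show "\<forall>b \<in> P. d b = 2 \<and> far x b \<in> T' \<and> \<chi> (far x b) \<noteq> \<chi> x" using twoP farP c unfolding T'_def by blast
    show "\<forall>b \<in> P. \<forall>b' \<in> P. \<not> E b b'" using N_indep PN(1) by blast
  qed
  then show False using nocol T'P by auto
qed

lemma colour_blocked:
  assumes g: "good r T \<phi>" and al: "\<forall>w \<in> H. \<forall>a \<in> Q x w. alpha a \<longrightarrow> \<phi> (far w a) = 0"
    and j: "j \<in> {1..r}" "2 \<le> j \<or> (\<exists>w. H = {w})"
  shows "\<exists>b \<in> P. \<phi> (far x b) = j"
proof (rule ccontr)
  assume no: "\<not> ?thesis"
  have nbx: "nb T x = {}" by (rule nb_disj[OF TS(1,3)])
  obtain \<psi> where \<psi>: "good r (insert x T) \<psi>" "\<psi> x = j" "\<forall>u \<in> T. \<psi> u = \<phi> u"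
    using add_coloured_vertex[OF g TS(2), of j] j nbx by auto
  have al': "\<forall>w \<in> H. \<forall>a \<in> Q x w. alpha a \<longrightarrow> \<psi> (far w a) = 0" using al farQ \<psi>(3) by simp
  have "\<exists>\<chi>. good r (insert x T \<union> (\<Union>w \<in> H. insert w (Q x w))) \<chi> \<and> (\<forall>u \<in> insert x T. \<chi> u = \<psi> u)"
  proof (cases "2 \<le> j")
    case True
    show ?thesis by (rule resolve_all[OF \<psi>(1) _ _ _ al']) (use True \<psi>(2) in auto)
  next
    case False
    then obtain w where H: "H = {w}" using j by blast
    then have w: "w \<in> H" by blast
    have T': "insert x T \<subseteq> insert x T" "insert x T \<subseteq> insert x (T \<union> P) \<union> (\<Union>w \<in> H - {w}. insert w (Q x w))" by blast+
    note h = H_nb[OF w T']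
    have "nb (insert x T) x = {}" using nbx irrefl unfolding nb_def by blast
    then have fr: "free (insert x T) \<psi> x 2" using False \<psi>(2) unfolding free_def by simp
    have "\<exists>\<chi>. good r (insert w (insert x T \<union> Q x w)) \<chi> \<and> (\<forall>u \<in> insert x T. \<chi> u = \<psi> u)"
      by (rule resolve_eta[OF \<psi>(1) h(4) _ _ etaH[OF w] h(1,2,3) _ _ _ _ fr])
        (use \<psi>(2) j(1) farQ[OF w] al' w r2 in auto)
    then show ?thesis unfolding H by simp
  qed
  then obtain \<chi> where \<chi>: "good r (insert x T \<union> (\<Union>w \<in> H. insert w (Q x w))) \<chi>" "\<forall>u \<in> insert x T. \<chi> u = \<psi> u" by blast
  show False by (rule finish_coloured[OF \<chi>(1)]) (use \<chi>(2) \<psi>(2,3) no farP in auto)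
qed

lemma few_alpha: "r - 1 \<le> card {b \<in> P. \<not> alpha b}"
proof -
  obtain \<phi> where \<phi>: "normal r T \<phi>" "good r T \<phi>" "\<forall>b \<in> P. alpha b \<longrightarrow> \<phi> (far x b) = 0"
    "\<forall>w \<in> H. \<forall>a \<in> Q x w. alpha a \<longrightarrow> \<phi> (far w a) = 0" by (rule hub_colouring)
  have "{2..r} \<subseteq> (\<lambda>b. \<phi> (far x b)) ` {b \<in> P. \<not> alpha b}"
  proof
    fix j assume "j \<in> {2..r}"
    then obtain b where "b \<in> P" "\<phi> (far x b) = j" "j \<noteq> 0" using colour_blocked[OF \<phi>(2,4), of j] by auto
    moreover from this have "\<not> alpha b" using \<phi>(3) by auto
    ultimately show "j \<in> (\<lambda>b. \<phi> (far x b)) ` {b \<in> P. \<not> alpha b}" by blast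
  qed
  moreover have "finite {b \<in> P. \<not> alpha b}" using finite_subset[OF PN(1) finN] by simp
  ultimately have "card {2..r} \<le> card {b \<in> P. \<not> alpha b}" by (rule surj_card_le[rotated])
  then show ?thesis by simp
qed

lemma forest_hub:
  assumes n: "good r T \<phi>" and L: "card {b \<in> P. \<phi> (far x b) = 0} \<le> 1"
  shows "\<exists>\<psi>. good r (insert x (T \<union> P)) \<psi> \<and> \<psi> x = 0 \<and> (\<forall>b \<in> P. \<psi> b = 0) \<and> (\<forall>u \<in> T. \<psi> u = \<phi> u)"
proof -
  have nbx: "nb T x = {}" by (rule nb_disj[OF TS(1,3)])
  define L where "L = {b \<in> P. \<phi> (far x b) = 0}"
  define Z where "Z = {b \<in> P. \<phi> (far x b) \<noteq> 0}"
  have LZ: "L \<union> Z = P" "L \<inter> Z = {}" unfolding L_def Z_def by blast+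
  have "\<exists>\<psi>. good r (insert x (T \<union> L \<union> Z)) \<psi> \<and> \<psi> x = 0 \<and> (\<forall>b \<in> L \<union> Z. \<psi> b = 0) \<and> (\<forall>u \<in> T. \<psi> u = \<phi> u)"
  proof (rule add_forest_centre[OF n TS(1) xS TS(2) _ _ LZ(2)])
    show "L \<union> Z \<subseteq> N x" "(L \<union> Z) \<inter> T = {}" using LZ PN TS(3) by blast+
    show "\<forall>b \<in> L \<union> Z. d b = 2 \<and> far x b \<in> T" using LZ twoP farP by blast
    show "\<forall>b \<in> L \<union> Z. \<forall>b' \<in> L \<union> Z. \<not> E b b'" using LZ N_indep PN(1) by blast
    show "card L \<le> 1" unfolding L_def by (rule L)
    show "\<forall>b \<in> Z. \<phi> (far x b) \<noteq> 0" unfolding Z_def by blast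
  qed (use nbx in simp_all)
  moreover have "T \<union> L \<union> Z = T \<union> P" using LZ(1) by blast
  ultimately show ?thesis using LZ(1) by simp
qed

lemma P_nb_x: "nb (insert x (T \<union> P)) x = P"
proof -
  have "insert x (T \<union> P) \<subseteq> S" using full by blast
  then have "nb (insert x (T \<union> P)) x = N x \<inter> insert x (T \<union> P)" by (rule nb_Int[OF refl])
  also have "x \<notin> N x" using irrefl by simp
  then have "N x \<inter> insert x (T \<union> P) = N x \<inter> (T \<union> P)" by simp
  also have "\<dots> = P" using TS(3) PN(1) by (simp add: Int_Un_distrib Int_absorb1)
  finally show ?thesis .
qed

lemma single_eta:
  assumes H: "H = {w}" and dxr: "d x = r + 2"
  shows False
proof -
  obtain \<phi> where \<phi>: "normal r T \<phi>" "good r T \<phi>" "\<forall>b \<in> P. alpha b \<longrightarrow> \<phi> (far x b) = 0"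
    "\<forall>w \<in> H. \<forall>a \<in> Q x w. alpha a \<longrightarrow> \<phi> (far w a) = 0" by (rule hub_colouring)
  have bl: "\<forall>j \<in> {1..r}. \<exists>b \<in> P. \<phi> (far x b) = j" using colour_blocked[OF \<phi>(2,4)] H by blast
  define Z where "Z = {b \<in> P. \<phi> (far x b) \<noteq> 0}"
  have rZ: "r \<le> card Z" by (rule dead_card[OF xS PN(1) bl Z_def])
  have w: "w \<in> H" "w \<in> N x" "w \<notin> P" using H PN(2) PH by blast+
  have finP: "finite P" using finite_subset[OF PN(1) finN] .
  have "N x = insert w P" using NPH H by blast
  then have cP: "card P = r + 1" using dxr w(3) finP unfolding d_def by simp
  have "{b \<in> P. \<phi> (far x b) = 0} = P - Z" unfolding Z_def by auto
  then have "card {b \<in> P. \<phi> (far x b) = 0} \<le> 1"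
    using cP rZ finP by (simp add: card_Diff_subset Z_def)
  then obtain \<psi> where \<psi>: "good r (insert x (T \<union> P)) \<psi>" "\<psi> x = 0" "\<forall>b \<in> P. \<psi> b = 0" "\<forall>u \<in> T. \<psi> u = \<phi> u"
    using forest_hub[OF \<phi>(2)] by blast
  define T' where "T' = insert x (T \<union> P)"
  have T': "insert x T \<subseteq> T'" "T' \<subseteq> insert x (T \<union> P) \<union> (\<Union>w \<in> H - {w}. insert w (Q x w))"
    unfolding T'_def by blast+
  note h = H_nb[OF w(1) T']
  have g': "good r T' \<psi>" using \<psi>(1) unfolding T'_def .
  have xT': "x \<in> T'" unfolding T'_def by blast
  have fr: "free T' \<psi> x k" if "1 \<le> k" for k
    using that \<psi>(2,3) P_nb_x unfolding free_def T'_def by simp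
  have e: "eta x w" "d w \<noteq> 2" "\<forall>a \<in> Q x w. d a = 2" using etaH[OF w(1)] unfolding eta_def by auto
  have q2: "\<forall>a \<in> Q x w. d a = 2 \<and> far w a \<in> T'" using e(3) farQ[OF w(1)] unfolding T'_def by blast
  have far\<psi>: "\<psi> (far w a) = \<phi> (far w a)" if "a \<in> Q x w" for a using \<psi>(4) farQ[OF w(1) that] by blast
  have full': "insert w (T' \<union> Q x w) = S" using full H unfolding T'_def by auto
  show False
  proof (cases "\<exists>k \<in> {1..r}. \<forall>a \<in> Q x w. \<psi> (far w a) \<noteq> k")
    case True
    then obtain k where k: "1 \<le> k" "k \<le> r" "\<forall>a \<in> Q x w. \<psi> (far w a) \<noteq> k" by auto
    show False
      using resolve_colour[OF g' h(4) xT' w(2) h(1,2,3) _ k(1,2) fr[OF k(1)]] q2 k(3) full' nocol by auto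
  next
    case False
    define Qn where "Qn = {a \<in> Q x w. \<not> alpha a}"
    define ZQ where "ZQ = {a \<in> Q x w. \<psi> (far w a) \<noteq> 0}"
    have "{1..r} \<subseteq> (\<lambda>a. \<psi> (far w a)) ` ZQ" using False unfolding ZQ_def by force
    moreover have "finite ZQ" unfolding ZQ_def by simp
    ultimately have rZQ: "r \<le> card ZQ" using surj_card_le[of ZQ "{1..r}"] by simp
    have ZQn: "ZQ \<subseteq> Qn" unfolding ZQ_def Qn_def using \<phi>(4) w(1) far\<psi> by auto
    then have "card ZQ \<le> card Qn" unfolding Qn_def by (intro card_mono) auto
    then have "card (Q x w) = 2" using rZQ r2 e(1) unfolding eta_def Qn_def by linarith
    then have ZQ: "ZQ = Q x w" using rZQ r2 card_seteq[of "Q x w" ZQ] unfolding ZQ_def by auto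
    have "\<exists>\<chi>. good r (insert w (T' \<union> Q x w)) \<chi> \<and> (\<forall>u \<in> T'. \<chi> u = \<psi> u)"
      by (rule resolve_forest[OF g' h(4) xT' w(2) h(1,2) e(2) h(3) q2, of "{}" ZQ "{}"])
        (use ZQ in \<open>auto simp: ZQ_def\<close>)
    then show False using full' nocol by auto
  qed
qed

lemma double_eta:
  assumes r: "r = 2" and P: "P = {b1, b2}" "alpha b1" and H: "H = {w, w'}" "w \<noteq> w'"
    and al: "\<forall>w \<in> H. \<forall>a \<in> Q x w. alpha a"
  shows False
proof -
  obtain \<phi> where \<phi>: "normal r T \<phi>" "good r T \<phi>" "\<forall>b \<in> P. alpha b \<longrightarrow> \<phi> (far x b) = 0"
    "\<forall>w \<in> H. \<forall>a \<in> Q x w. alpha a \<longrightarrow> \<phi> (far w a) = 0" by (rule hub_colouring)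
  have "\<exists>b \<in> P. \<phi> (far x b) = 2" using colour_blocked[OF \<phi>(2,4), of 2] r by auto
  moreover have "\<phi> (far x b1) = 0" using \<phi>(3) P by blast
  ultimately have "\<phi> (far x b2) = 2" using P by auto
  then have "{b \<in> P. \<phi> (far x b) = 0} \<subseteq> {b1}" using P by auto
  then have "card {b \<in> P. \<phi> (far x b) = 0} \<le> card {b1}" by (intro card_mono) auto
  then obtain \<psi> where \<psi>: "good r (insert x (T \<union> P)) \<psi>" "\<psi> x = 0" "\<forall>b \<in> P. \<psi> b = 0" "\<forall>u \<in> T. \<psi> u = \<phi> u"
    using forest_hub[OF \<phi>(2)] by auto
  define T' where "T' = insert x (T \<union> P)"
  have w: "w \<in> H" "w' \<in> H" "w \<in> N x" "w' \<in> N x" using H PN(2) by blast+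
  have g': "good r T' \<psi>" using \<psi>(1) unfolding T'_def .
  have T': "insert x T \<subseteq> T'" "T' \<subseteq> insert x (T \<union> P) \<union> (\<Union>w \<in> H - {w}. insert w (Q x w))"
    unfolding T'_def by blast+
  note h = H_nb[OF w(1) T']
  have far0: "\<psi> (far u a) = 0" "far u a \<in> T'" "d a = 2" if "u \<in> H" "a \<in> Q x u" for u a
    using \<psi>(4) farQ[OF that] \<phi>(4) al that alpha_two unfolding T'_def by auto
  have xT': "x \<in> T'" unfolding T'_def by blast
  have nbT': "nb T' x = P" unfolding T'_def by (rule P_nb_x)
  have fr: "free T' \<psi> x 1" using \<psi>(2,3) nbT' unfolding free_def by simp
  obtain \<chi> where \<chi>: "good r (insert w (T' \<union> Q x w)) \<chi>" "\<chi> w = 1" "\<forall>u \<in> T'. \<chi> u = \<psi> u"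
    using resolve_colour[OF g' h(4) xT' w(3) h(1,2,3) _ _ _ fr] far0[OF w(1)] r by auto
  define T'' where "T'' = insert w (T' \<union> Q x w)"
  have T''1: "insert x T \<subseteq> T''" "T'' \<subseteq> insert x (T \<union> P) \<union> (\<Union>w \<in> H - {w'}. insert w (Q x w))"
    unfolding T''_def T'_def using H by blast+
  note h'' = H_nb[OF w(2) T''1]
  have g'': "good r T'' \<chi>" using \<chi>(1) unfolding T''_def .
  have xT'': "x \<in> T''" unfolding T''_def T'_def by blast
  have "nb T'' x = insert w (nb T' x)"
  proof -
    have "nb T'' x = N x \<inter> T''" "nb T' x = N x \<inter> T'" using nb_Int[OF refl h''(4)] nb_Int[OF refl h(4)] by blast+
    moreover have "N x \<inter> Q x w = {}" using Q_notin_N[OF w(1)] by blast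
    then have "N x \<inter> T'' = insert w (N x \<inter> T')"
      using w(3) unfolding T''_def by (simp add: Int_Un_distrib del: in_nb)
    ultimately show ?thesis by simp
  qed
  then have nbT'': "nb T'' x = insert w P" using nbT' by simp
  have PT': "P \<subseteq> T'" unfolding T'_def by blast
  have "\<forall>y \<in> nb T'' x. \<chi> y \<noteq> 2" unfolding nbT'' using \<chi>(2,3) \<psi>(3) PT' by auto
  then have fr'': "free T'' \<chi> x 2" using \<chi>(3) \<psi>(2) xT' unfolding free_def by simp
  have "\<exists>\<chi>'. good r (insert w' (T'' \<union> Q x w')) \<chi>' \<and> \<chi>' w' = 2 \<and> (\<forall>u \<in> T''. \<chi>' u = \<chi> u)"
    by (rule resolve_colour[OF g'' h''(4) xT'' w(4) h''(1,2,3) _ _ _ fr''])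
      (use far0[OF w(2)] \<chi>(3) r in \<open>auto simp: T''_def\<close>)
  moreover have "insert w' (T'' \<union> Q x w') = S" using full H unfolding T''_def T'_def by auto
  ultimately show False using nocol by auto
qed

end

context mincex
begin

lemma finite_N_Collect: "finite {b \<in> N x. R b}"
  by (rule finite_subset[OF _ finN[of x]]) blast

lemma discharge:
  fixes \<tau> :: "'a \<Rightarrow> 'a \<Rightarrow> int"
  assumes "\<And>v. v \<in> S \<Longrightarrow> (\<Sum>u \<in> N v. \<tau> v u) \<le> ch v + (\<Sum>u \<in> N v. \<tau> u v)"
  shows "0 \<le> (\<Sum>v \<in> S. ch v)"
proof -
  have nb: "(\<Sum>u \<in> N v. f u) = (\<Sum>u \<in> S. if E v u then f u else 0)" for v and f :: "'a \<Rightarrow> int"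
    unfolding nb_def using finS by (simp add: sum.inter_filter)
  have "(\<Sum>v \<in> S. \<Sum>u \<in> N v. \<tau> u v) = (\<Sum>v \<in> S. \<Sum>u \<in> S. if E v u then \<tau> u v else 0)" unfolding nb ..
  also have "\<dots> = (\<Sum>u \<in> S. \<Sum>v \<in> S. if E v u then \<tau> u v else 0)" by (rule sum.swap)
  also have "\<dots> = (\<Sum>u \<in> S. \<Sum>v \<in> S. if E u v then \<tau> u v else 0)"
    by (intro sum.cong refl if_cong E_commute)
  also have "\<dots> = (\<Sum>u \<in> S. \<Sum>v \<in> N u. \<tau> u v)" unfolding nb ..
  finally have eq: "(\<Sum>v \<in> S. \<Sum>u \<in> N v. \<tau> u v) = (\<Sum>u \<in> S. \<Sum>v \<in> N u. \<tau> u v)" .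
  have "(\<Sum>v \<in> S. \<Sum>u \<in> N v. \<tau> v u) \<le> (\<Sum>v \<in> S. ch v + (\<Sum>u \<in> N v. \<tau> u v))"
    by (rule sum_mono) (rule assms)
  then show ?thesis unfolding sum.distrib eq by simp
qed

lemma alpha_big:
  assumes "alpha b" "x \<in> S" "b \<in> N x" "d x \<noteq> 2"
  shows "r + 2 \<le> d x"
proof -
  have b: "b \<in> S" "x \<in> N b" using assms(2,3) N_sym by auto
  obtain b' where b': "b' \<in> N b" "d b' = 2" "d b = 2" using assms(1) unfolding alpha_def by blast
  show ?thesis by (rule alpha_end[of b b']) (use b b' assms(4) in auto)
qed

end

context mincex6
begin

text \<open>The kinds of neighbours \<open>b\<close> of \<open>x\<close>: 1 for \<open>alpha\<close>, 2, 7, 3 for the other vertices of degree 2,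
  according to the degree of the far end, 4 for vertices of degree 3 and 5, 6 for vertices of degree \<open>r + 2\<close>
  all of whose other neighbours have degree 2.\<close>

definition kind :: "'a \<Rightarrow> 'a \<Rightarrow> nat" where
  "kind x b = (if d b = 2 then
       if alpha b then 1 else if d (far x b) = 3 then 2 else if d (far x b) \<le> r + 1 then 7 else 3
     else if (\<forall>a \<in> Q x b. d a = 2) then
       if d b = 3 then 4
       else if d b = r + 2 \<and> card {a \<in> Q x b. \<not> alpha a} = 1 then 5
       else if d b = r + 2 \<and> card {a \<in> Q x b. \<not> alpha a} = 0 then 6 else 0
     else 0)"

definition weight :: "nat \<Rightarrow> nat \<Rightarrow> int" where
  "weight n k = (if n = 2 then 0
     else if n = 3 then if k = 2 \<or> k = 7 then 2 else if k = 3 then 1 else 0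
     else if n \<le> r + 1 then if k = 2 \<or> k = 7 \<or> k = 3 then 2 else if k = 4 then 1 else 0
     else if k = 1 then 4 else if k = 2 then 3 else if k = 7 \<or> k = 3 \<or> k = 6 then 2
     else if k = 4 then int r - 1 else if k = 5 then 1 else 0)"

definition cnt :: "'a \<Rightarrow> nat \<Rightarrow> nat" where "cnt x k = card {b \<in> N x. kind x b = k}"

lemma kind_le: "kind x b \<le> 7"
  unfolding kind_def by simp

lemma sum_kinds:
  fixes f :: "nat \<Rightarrow> int"
  shows "(\<Sum>b \<in> N x. f (kind x b)) = (\<Sum>k \<le> 7. int (cnt x k) * f k)"
proof -
  have "(\<Sum>b \<in> N x. f (kind x b)) = (\<Sum>k \<in> {..7}. of_nat (card {b \<in> N x. kind x b = k}) * f k)"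
    by (rule sum_fun_comp) (auto simp: kind_le)
  then show ?thesis by (simp add: cnt_def)
qed

lemma upto7: "{..7::nat} = {0, 1, 2, 3, 4, 5, 6, 7}"
  by auto

lemma sum_cnt: "cnt x 0 + cnt x 1 + cnt x 2 + cnt x 3 + cnt x 4 + cnt x 5 + cnt x 6 + cnt x 7 = d x"
proof -
  have "int (d x) = (\<Sum>b \<in> N x. 1)" by (simp add: d_def)
  also have "\<dots> = (\<Sum>k \<le> 7. int (cnt x k) * 1)" using sum_kinds[of "\<lambda>_. 1" x] by simp
  finally show ?thesis unfolding upto7 by simp
qed

lemma out_cnt: "(\<Sum>b \<in> N x. weight (d x) (kind x b)) = weight (d x) 0 * cnt x 0 + weight (d x) 1 * cnt x 1 +
    weight (d x) 2 * cnt x 2 + weight (d x) 3 * cnt x 3 + weight (d x) 4 * cnt x 4 + weight (d x) 5 * cnt x 5 +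
    weight (d x) 6 * cnt x 6 + weight (d x) 7 * cnt x 7"
  unfolding sum_kinds upto7 by simp

lemma weight_nonneg: "0 \<le> weight n k"
  unfolding weight_def using r2 by simp

lemma cnt_0D: "cnt x k = 0 \<Longrightarrow> b \<in> N x \<Longrightarrow> kind x b \<noteq> k"
proof -
  assume c: "cnt x k = 0" and b: "b \<in> N x"
  have "finite {b \<in> N x. kind x b = k}" by (rule finite_N_Collect)
  then have "{b \<in> N x. kind x b = k} = {}" using c unfolding cnt_def by simp
  then show ?thesis using b by blast
qed

lemma far_ge_3:
  assumes "x \<in> S" "b \<in> N x" "d b = 2" "\<not> alpha b"
  shows "3 \<le> d (far x b)"
proof -
  have "far x b \<in> N b" "far x b \<in> S" using far_in[OF assms(1-3)] by auto
  then have "d (far x b) \<noteq> 2" using assms(3,4) unfolding alpha_def by blast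
  then show ?thesis using deg_ge_2[OF \<open>far x b \<in> S\<close>] by linarith
qed

lemma kind_two: "kind x b \<in> {1, 2, 3, 7} \<longleftrightarrow> d b = 2"
  unfolding kind_def by simp

lemma kind_alpha: "kind x b = 1 \<longleftrightarrow> alpha b"
  unfolding kind_def alpha_def by simp

lemma card_kinds:
  assumes "finite K" "\<And>b. b \<in> N x \<Longrightarrow> R b \<longleftrightarrow> kind x b \<in> K"
  shows "card {b \<in> N x. R b} = (\<Sum>k \<in> K. cnt x k)"
proof -
  have "{b \<in> N x. R b} = (\<Union>k \<in> K. {b \<in> N x. kind x b = k})" using assms(2) by blast
  also have "card \<dots> = (\<Sum>k \<in> K. card {b \<in> N x. kind x b = k})"
    by (rule card_UN_disjoint[OF assms(1)]; intro ballI impI; (rule finite_N_Collect)?) auto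
  finally show ?thesis unfolding cnt_def .
qed

lemma card_nonalpha: "card {b \<in> N x. d b = 2 \<and> \<not> alpha b} = cnt x 2 + cnt x 3 + cnt x 7"
proof -
  have "card {b \<in> N x. d b = 2 \<and> \<not> alpha b} = (\<Sum>k \<in> {2, 3, 7}. cnt x k)"
    by (rule card_kinds) (auto simp: kind_def)
  then show ?thesis by simp
qed

lemma card_two: "card {b \<in> N x. d b = 2} = cnt x 1 + cnt x 2 + cnt x 3 + cnt x 7"
proof -
  have "card {b \<in> N x. d b = 2} = (\<Sum>k \<in> {1, 2, 3, 7}. cnt x k)"
    by (rule card_kinds) (auto simp: kind_def)
  then show ?thesis by simp
qed

lemma kind_eta:
  assumes x: "x \<in> S" and w: "w \<in> N x" and k: "kind x w \<in> {4, 5, 6}"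
  shows "eta x w"
proof -
  have wx: "w \<in> S" "x \<in> N w" using w N_sym[OF x] by auto
  have two: "\<forall>a \<in> Q x w. d a = 2" and dw2: "d w \<noteq> 2" using k unfolding kind_def by (auto split: if_splits)
  have dw: "3 \<le> d w" using deg_ge_2[OF wx(1)] dw2 by linarith
  have cQ: "card (Q x w) = d w - 1" unfolding Q_def d_def using wx(2) finN[of w] by (simp del: in_nb)
  consider "d w = 3" | "d w = r + 2" "card {a \<in> Q x w. \<not> alpha a} = 1" | "d w = r + 2" "card {a \<in> Q x w. \<not> alpha a} = 0"
    using k unfolding kind_def by (auto split: if_splits)
  then show ?thesis
  proof cases
    case 1
    have "\<not> alpha a" if "a \<in> Q x w" for a
      using alpha_big[of a w] that wx(1) dw2 1 r2 unfolding Q_def by auto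
    then have "{a \<in> Q x w. \<not> alpha a} = Q x w" by blast
    then show ?thesis using w dw two cQ 1 unfolding eta_def by simp
  next
    case 2
    then show ?thesis using w dw two cQ unfolding eta_def by simp
  next
    case 3
    then show ?thesis using w dw two unfolding eta_def by simp
  qed
qed

lemma make_hub:
  assumes x: "x \<in> S" "d x \<noteq> 2" and c: "cnt x 0 = 0"
  shows "hub E S r x {b \<in> N x. d b = 2} {b \<in> N x. d b \<noteq> 2}"
proof (unfold_locales)
  show "eta x w" if "w \<in> {b \<in> N x. d b \<noteq> 2}" for w
  proof (rule kind_eta[OF x(1)])
    have "kind x w \<noteq> 0" using cnt_0D[OF c] that by blast
    then show "kind x w \<in> {4, 5, 6}" using that unfolding kind_def by (auto split: if_splits)
  qed (use that in blast)
qed (use x in auto)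

lemma card_eta: "card {b \<in> N x. d b \<noteq> 2} = cnt x 0 + cnt x 4 + cnt x 5 + cnt x 6"
proof -
  have "card {b \<in> N x. d b \<noteq> 2} = (\<Sum>k \<in> {0, 4, 5, 6}. cnt x k)"
    by (rule card_kinds) (auto simp: kind_def)
  then show ?thesis by simp
qed

lemma kinds_hub:
  assumes x: "x \<in> S" "3 \<le> d x" and c: "cnt x 0 = 0"
  shows "r - 1 \<le> cnt x 2 + cnt x 3 + cnt x 7"
    and "cnt x 4 + cnt x 5 + cnt x 6 = 1 \<Longrightarrow> d x \<noteq> r + 2"
    and "r = 2 \<Longrightarrow> d x = 4 \<Longrightarrow> 1 \<le> cnt x 1 \<Longrightarrow> cnt x 6 \<noteq> 2"
proof -
  interpret hub E S r x "{b \<in> N x. d b = 2}" "{b \<in> N x. d b \<noteq> 2}"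
    by (rule make_hub) (use x c in auto)
  have "{b \<in> {b \<in> N x. d b = 2}. \<not> alpha b} = {b \<in> N x. d b = 2 \<and> \<not> alpha b}" by blast
  then show "r - 1 \<le> cnt x 2 + cnt x 3 + cnt x 7" using few_alpha card_nonalpha by simp
  show "d x \<noteq> r + 2" if "cnt x 4 + cnt x 5 + cnt x 6 = 1"
  proof
    assume dx: "d x = r + 2"
    have "card {b \<in> N x. d b \<noteq> 2} = 1" using card_eta c that by simp
    then obtain w where "{b \<in> N x. d b \<noteq> 2} = {w}" by (auto simp: card_1_singleton_iff)
    then show False by (rule single_eta[OF _ dx])
  qed
  show "cnt x 6 \<noteq> 2" if r: "r = 2" and dx: "d x = 4" and c1: "1 \<le> cnt x 1"
  proof
    assume c6: "cnt x 6 = 2"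
    note fin = finite_N_Collect
    have "{b \<in> N x. kind x b = 6} \<subseteq> {b \<in> N x. d b \<noteq> 2}"
    proof
      fix b assume b: "b \<in> {b \<in> N x. kind x b = 6}"
      then have "kind x b \<notin> {1, 2, 3, 7}" by simp
      then show "b \<in> {b \<in> N x. d b \<noteq> 2}" using kind_two[of x b] b by blast
    qed
    then have "cnt x 6 \<le> card {b \<in> N x. d b \<noteq> 2}" unfolding cnt_def by (intro card_mono fin)
    obtain b1 where b1: "b1 \<in> N x" "alpha b1"
    proof -
      have "{b \<in> N x. kind x b = 1} \<noteq> {}" using c1 unfolding cnt_def by (metis card.empty not_one_le_zero)
      then show thesis using that kind_alpha by blast
    qed
    have tot: "card {b \<in> N x. d b = 2} + card {b \<in> N x. d b \<noteq> 2} = 4"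
      unfolding card_two card_eta using sum_cnt[of x] dx by simp
    show False
    proof (cases "card {b \<in> N x. d b = 2} = 2")
      case True
      then have H2: "card {b \<in> N x. d b \<noteq> 2} = 2" using tot by simp
      then have Heq: "{b \<in> N x. kind x b = 6} = {b \<in> N x. d b \<noteq> 2}"
        using card_seteq[OF fin \<open>{b \<in> N x. kind x b = 6} \<subseteq> _\<close>] c6 unfolding cnt_def by simp
      obtain w w' where w: "{b \<in> N x. d b \<noteq> 2} = {w, w'}" "w \<noteq> w'" using H2 by (auto simp: card_2_iff)
      have "card ({b \<in> N x. d b = 2} - {b1}) = 1" using True b1 alpha_two[OF b1(2)] by (simp del: in_nb)
      then obtain b2 where "{b \<in> N x. d b = 2} - {b1} = {b2}" by (auto simp: card_1_singleton_iff simp del: in_nb)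
      then have P: "{b \<in> N x. d b = 2} = {b1, b2}" using b1 alpha_two[OF b1(2)] by blast
      have "\<forall>a \<in> Q x u. alpha a" if u: "u \<in> {b \<in> N x. d b \<noteq> 2}" for u
      proof -
        have "kind x u = 6" using u Heq by blast
        then have "card {a \<in> Q x u. \<not> alpha a} = 0" unfolding kind_def by (auto split: if_splits)
        moreover have "finite {a \<in> Q x u. \<not> alpha a}" by simp
        ultimately have "{a \<in> Q x u. \<not> alpha a} = {}" by simp
        then show ?thesis by blast
      qed
      then show False using double_eta[OF r P b1(2) w] by blast
    next
      case False
      then have "card {b \<in> N x. d b = 2} = 1 \<or> card {b \<in> N x. d b = 2} = 0"
        using tot \<open>cnt x 6 \<le> card {b \<in> N x. d b \<noteq> 2}\<close> c6 by linarith
      moreover have "r - 1 \<le> cnt x 2 + cnt x 3 + cnt x 7"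
        using few_alpha card_nonalpha \<open>{b \<in> {b \<in> N x. d b = 2}. \<not> alpha b} = _\<close> by simp
      ultimately show False using card_two[of x] c1 r by linarith
    qed
  qed
qed

lemma kinds_all_two:
  assumes x: "x \<in> S" "3 \<le> d x" and c: "cnt x 0 = 0" "cnt x 4 = 0" "cnt x 5 = 0" "cnt x 6 = 0"
  shows "r \<le> cnt x 2 + cnt x 3 + cnt x 7" "r + 2 \<le> d x" "d x = r + 2 \<Longrightarrow> cnt x 1 = 0"
    "d x = r + 2 \<Longrightarrow> cnt x 2 + cnt x 7 \<le> r" "d x = r + 3 \<Longrightarrow> r + 1 \<le> cnt x 2 + cnt x 3 + cnt x 7"
proof -
  have "card {b \<in> N x. d b \<noteq> 2} = 0" using card_eta c by simp
  moreover have "finite {b \<in> N x. d b \<noteq> 2}" by (rule finite_N_Collect)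
  ultimately have "{b \<in> N x. d b \<noteq> 2} = {}" by simp
  then have two: "\<forall>b \<in> N x. d b = 2" by blast
  then have eq: "{b \<in> N x. \<not> alpha b} = {b \<in> N x. d b = 2 \<and> \<not> alpha b}" by blast
  note a = all_two[OF x two N_indep, unfolded eq card_nonalpha]
  show "r \<le> cnt x 2 + cnt x 3 + cnt x 7" "r + 2 \<le> d x" by (fact a)+
  show "r + 1 \<le> cnt x 2 + cnt x 3 + cnt x 7" if "d x = r + 3" by (rule a(4)[OF that r2])
  show c1: "cnt x 1 = 0" if "d x = r + 2"
  proof -
    have "{b \<in> N x. kind x b = 1} = {}" using a(3)[OF that] kind_alpha by blast
    then show ?thesis unfolding cnt_def by (metis card.empty)
  qed
  show "cnt x 2 + cnt x 7 \<le> r" if dx: "d x = r + 2"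
  proof -
    have "card {b \<in> N x. kind x b \<in> {2, 7}} = (\<Sum>k \<in> {2, 7}. cnt x k)" by (rule card_kinds) auto
    then have "cnt x 2 + cnt x 7 = card {b \<in> N x. kind x b \<in> {2, 7}}" by simp
    also have "\<dots> \<le> card {b \<in> N x. d (far x b) \<le> r + 1}"
    proof (rule card_mono)
      show "finite {b \<in> N x. d (far x b) \<le> r + 1}" by (rule finite_N_Collect)
      show "{b \<in> N x. kind x b \<in> {2, 7}} \<subseteq> {b \<in> N x. d (far x b) \<le> r + 1}"
        using r2 unfolding kind_def by (auto split: if_splits)
    qed
    also have "\<dots> \<le> r" by (rule all_two_small[OF x(1) dx two])
    finally show ?thesis .
  qed
qed

end

lemma kinds_arith_2:
  fixes c0 c1 c2 c3 c4 c5 c6 c7 d i :: nat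
  assumes sum: "c0 + c1 + c2 + c3 + c4 + c5 + c6 + c7 = d" and d: "4 \<le> d"
    and two: "c0 = 0 \<Longrightarrow> c4 + c5 + c6 = 0 \<Longrightarrow>
      (d = 4 \<longrightarrow> c1 = 0 \<and> c2 + c7 \<le> 2) \<and> (d = 5 \<longrightarrow> 3 \<le> c2 + c3 + c7)"
    and hub: "c0 = 0 \<Longrightarrow> 1 \<le> c2 + c3 + c7" "c0 = 0 \<Longrightarrow> c4 + c5 + c6 = 1 \<Longrightarrow> d \<noteq> 4"
      "c0 = 0 \<Longrightarrow> d = 4 \<Longrightarrow> 1 \<le> c1 \<Longrightarrow> c6 \<noteq> 2"
    and eps: "d = 4 \<Longrightarrow> c0 + c4 + c5 + c6 = 1 \<Longrightarrow> 2 \<le> c1 \<Longrightarrow> (if c1 = 3 then 2 else 1) \<le> i"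
  shows "4 * c1 + 3 * c2 + 2 * c3 + c4 + c5 + 2 * c6 + 2 * c7 + 18 \<le> 7 * d + i"
proof (cases "c0 = 0")
  case True
  then consider "c4 + c5 + c6 = 0" | "c4 + c5 + c6 = 1" | "2 \<le> c4 + c5 + c6" by linarith
  then show ?thesis
  proof cases
    case 1
    consider "d = 4" | "d = 5" | "6 \<le> d" using d by linarith
    then show ?thesis using two[OF True 1] sum True 1 by cases linarith+
  next
    case 2
    then have "5 \<le> d" using hub(2) True d by linarith
    then show ?thesis using hub(1) True sum 2 by linarith
  next
    case 3
    consider "5 \<le> d" | "d = 4" "c1 = 0" | "d = 4" "1 \<le> c1" using d by linarith
    then show ?thesis
    proof cases
      case 3
      have "c1 = 1" "c4 + c5 + c6 = 2" using hub(1) True sum 3 \<open>2 \<le> c4 + c5 + c6\<close> by linarith+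
      moreover have "c6 \<noteq> 2" using hub(3) True 3 by blast
      ultimately show ?thesis using sum 3 True by linarith
    qed (use hub(1) True sum 3 in linarith)+
  qed
next
  case False
  then consider "5 \<le> d" | "d = 4" "2 \<le> c0 + (c4 + c5 + c6)" | "d = 4" "c0 + c4 + c5 + c6 = 1" "c1 \<le> 1"
    | "d = 4" "c0 + c4 + c5 + c6 = 1" "c1 = 2" | "d = 4" "c0 + c4 + c5 + c6 = 1" "c1 = 3"
    using sum d by linarith
  then show ?thesis
  proof cases
    case 4
    then have "1 \<le> i" using eps by simp
    then show ?thesis using 4 sum False by linarith
  next
    case 5
    then have "2 \<le> i" using eps by simp
    then show ?thesis using 5 sum False by linarith
  qed (use False sum in linarith)+
qed

lemma kinds_arith_3:
  fixes c0 c1 c2 c3 c4 c5 c6 c7 d i :: nat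
  assumes sum: "c0 + c1 + c2 + c3 + c4 + c5 + c6 + c7 = d" and d: "5 \<le> d"
    and two: "c0 = 0 \<Longrightarrow> c4 + c5 + c6 = 0 \<Longrightarrow> 3 \<le> c2 + c3 + c7 \<and>
      (d = 5 \<longrightarrow> c1 = 0 \<and> c2 + c7 \<le> 3) \<and> (d = 6 \<longrightarrow> 4 \<le> c2 + c3 + c7)"
    and hub: "c0 = 0 \<Longrightarrow> 2 \<le> c2 + c3 + c7" "c0 = 0 \<Longrightarrow> c4 + c5 + c6 = 1 \<Longrightarrow> d \<noteq> 5"
    and eps: "d = 5 \<Longrightarrow> c0 + c4 + c5 + c6 = 1 \<Longrightarrow> 3 \<le> c1 \<Longrightarrow> (if c1 = 4 then 2 else 1) \<le> i"
  shows "4 * c1 + 3 * c2 + 2 * c3 + 2 * c4 + c5 + 2 * c6 + 2 * c7 + 16 \<le> 6 * d + i"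
proof (cases "c0 = 0")
  case True
  then consider "c4 + c5 + c6 = 0" | "c4 + c5 + c6 = 1" | "2 \<le> c4 + c5 + c6" by linarith
  then show ?thesis
  proof cases
    case 1
    consider "d = 5" | "d = 6" | "d = 7" | "8 \<le> d" using d by linarith
    then show ?thesis using two[OF True 1] sum True 1 by cases linarith+
  next
    case 2
    then have "6 \<le> d" using hub(2) True d by linarith
    then show ?thesis using hub(1) True sum 2 by linarith
  next
    case 3
    then show ?thesis using hub(1) True sum d by linarith
  qed
next
  case False
  then consider "6 \<le> d" | "d = 5" "2 \<le> c0 + (c4 + c5 + c6)" | "d = 5" "c0 + c4 + c5 + c6 = 1" "c1 \<le> 2"
    | "d = 5" "c0 + c4 + c5 + c6 = 1" "c1 = 3" | "d = 5" "c0 + c4 + c5 + c6 = 1" "c1 = 4"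
    using sum d by linarith
  then show ?thesis
  proof cases
    case 4
    then have "1 \<le> i" using eps by simp
    then show ?thesis using 4 sum False by linarith
  next
    case 5
    then have "2 \<le> i" using eps by simp
    then show ?thesis using 5 sum False by linarith
  qed (use False sum in linarith)+
qed

context mincex6
begin

definition transfer :: "'a \<Rightarrow> 'a \<Rightarrow> int" where "transfer v b = weight (d v) (kind v b)"

definition received :: "'a \<Rightarrow> int" where "received v = (\<Sum>u \<in> N v. transfer u v)"

lemma received_ge: "w \<in> N v \<Longrightarrow> transfer w v \<le> received v"
  unfolding received_def by (rule member_le_sum[OF _ _ finN]) (simp_all add: transfer_def weight_nonneg)

lemma received_nonneg: "0 \<le> received v"
  unfolding received_def transfer_def by (intro sum_nonneg weight_nonneg)

lemma two_received:
  assumes b: "b \<in> S" "d b = 2"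
  shows "4 \<le> received b"
proof -
  obtain u v where uv: "N b = {u, v}" "u \<noteq> v" using b(2) unfolding d_def card_2_iff by blast
  have uvS: "u \<in> S" "v \<in> S" "b \<in> N u" "b \<in> N v"
    using uv(1) N_sym[OF b(1)] nb_def by blast+
  have far: "far u b = v" "far v b = u" using far_eq[OF b(2)] uv by (metis insert_commute)+
  show ?thesis
  proof (cases "alpha b")
    case True
    then obtain b' where b': "b' \<in> N b" "d b' = 2" unfolding alpha_def by blast
    define x where "x = (if b' = u then v else u)"
    have x: "x \<in> N b" "x \<noteq> b'" using uv b'(1) unfolding x_def by auto
    have "r + 2 \<le> d x" by (rule alpha_end[OF b(1) _ b(2) b'(2) _ x]) (use b'(1) in auto)
    then have "transfer x b = 4" using kind_alpha[of x b] True r2 unfolding transfer_def weight_def by simp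
    then show ?thesis using received_ge[OF x(1)] by simp
  next
    case False
    have d3: "3 \<le> d u" "3 \<le> d v"
      using far_ge_3[OF uvS(1,3) b(2) False] far_ge_3[OF uvS(2,4) b(2) False] far by simp_all
    have "received b = transfer u b + transfer v b" unfolding received_def using uv by simp
    moreover have "kind u b = (if d v = 3 then 2 else if d v \<le> r + 1 then 7 else 3)"
      "kind v b = (if d u = 3 then 2 else if d u \<le> r + 1 then 7 else 3)"
      unfolding kind_def using b(2) False far by simp_all
    ultimately show ?thesis using d3 r2 unfolding transfer_def weight_def by simp
  qed
qed

lemma cnt_1_small:
  assumes "x \<in> S" "3 \<le> d x" "d x \<le> r + 1"
  shows "cnt x 1 = 0"
proof -
  have "{b \<in> N x. kind x b = 1} = {}"
    using alpha_big[of _ x] kind_alpha assms by fastforce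
  then show ?thesis unfolding cnt_def by (metis card.empty)
qed

lemma three_transfer:
  assumes x: "x \<in> S" "d x = 3" and r: "r = 2 \<or> r = 3"
  shows "(\<Sum>b \<in> N x. transfer x b) \<le> (if r = 2 then 3 else 2) + received x"
proof -
  have out: "(\<Sum>b \<in> N x. transfer x b) = 2 * int (cnt x 2 + cnt x 7) + int (cnt x 3)"
    unfolding transfer_def out_cnt using x(2) by (simp add: weight_def)
  have c1: "cnt x 1 = 0" using cnt_1_small[OF x(1)] x(2) r2 by simp
  have tot: "cnt x 0 + (cnt x 2 + cnt x 3 + cnt x 7) + (cnt x 4 + cnt x 5 + cnt x 6) = 3"
    using sum_cnt[of x] c1 x(2) by simp
  have ne3: "cnt x 2 + cnt x 3 + cnt x 7 \<noteq> 3"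
    using kinds_all_two(2)[OF x(1)] x(2) r2 tot by auto
  show ?thesis
  proof (cases "cnt x 2 + cnt x 3 + cnt x 7 = 2")
    case False
    then have "cnt x 2 + cnt x 3 + cnt x 7 \<le> 1" using tot ne3 by linarith
    then have "2 * int (cnt x 2 + cnt x 7) + int (cnt x 3) \<le> 2" by simp
    moreover have "(2::int) \<le> (if r = 2 then 3 else 2)" by simp
    ultimately show ?thesis unfolding out using received_nonneg[of x] by linarith
  next
    case True
    have "card {b \<in> N x. d b = 2} = 2" unfolding card_two using True c1 by simp
    then obtain a b where ab: "{b \<in> N x. d b = 2} = {a, b}" "a \<noteq> b" by (auto simp: card_2_iff)
    have "card {b \<in> N x. d b \<noteq> 2} = 1" unfolding card_eta using tot True by simp
    then obtain w where w: "{b \<in> N x. d b \<noteq> 2} = {w}" by (auto simp: card_1_singleton_iff)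
    have abN: "a \<in> N x" "b \<in> N x" "d a = 2" "d b = 2" using ab(1) by blast+
    have wN: "w \<in> N x" "d w \<noteq> 2" using w by blast+
    have Nx: "N x = {a, b, w}" using ab(1) w by blast
    have ne: "a \<noteq> w" "b \<noteq> w" using abN wN by auto
    have wS: "w \<in> S" using wN(1) by simp
    have dw3: "3 \<le> d w" using deg_ge_2[OF wS] wN(2) by linarith
    have "Q w x = {a, b}" unfolding Q_def using Nx ne by auto
    then have "kind w x = 4" unfolding kind_def using x(2) abN by simp
    then have inw: "weight (d w) 4 \<le> received x" using received_ge[OF wN(1)] unfolding transfer_def by simp
    define wt where "wt c = (if d (far x c) \<le> r + 1 then 2 else 1 :: int)" for c
    have tr: "transfer x c = wt c" if "c \<in> {a, b}" for c
    proof -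
      have c: "c \<in> N x" "d c = 2" using that abN by blast+
      have "\<not> alpha c" using alpha_big[of c x] x c r2 by auto
      then show ?thesis unfolding transfer_def kind_def weight_def wt_def using c(2) x(2) r2 by auto
    qed
    have "kind x w \<notin> {1, 2, 3, 7}" using kind_two[of x w] wN(2) by blast
    then have "transfer x w = 0" unfolding transfer_def weight_def using x(2) by simp
    then have out': "(\<Sum>b \<in> N x. transfer x b) = wt a + wt b"
      unfolding Nx using ab(2) ne tr by simp
    have Nx': "N x = {b, a, w}" using Nx by blast
    note t1 = three_vertex[OF x(1) Nx ab(2) ne abN(3,4)]
    note t2 = three_vertex[OF x(1) Nx' ab(2)[symmetric] ne(2,1) abN(4,3)]
    have w12: "wt a \<le> 2" "wt b \<le> 2" unfolding wt_def by simp_all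
    consider "d w = 3" | "d w = 4" | "5 \<le> d w" using dw3 by linarith
    then show ?thesis
    proof cases
      case 1
      have dw: "d w \<le> r + 1" "r = 3 \<longrightarrow> d w \<le> r" using 1 r2 by simp_all
      have "\<not> (d (far x a) \<le> r + 1 \<and> d (far x b) \<le> r + 1)" using t1[OF dw(1)] by blast
      then have "wt a + wt b \<le> 3" unfolding wt_def by auto
      moreover have "r = 3 \<longrightarrow> \<not> d (far x a) \<le> r + 1 \<and> \<not> d (far x b) \<le> r + 1"
        using t1[OF dw(1)] t2[OF dw(1)] dw(2) by blast
      then have "r = 3 \<longrightarrow> wt a + wt b \<le> 2" unfolding wt_def by auto
      ultimately show ?thesis unfolding out' using r received_nonneg[of x] by auto
    next
      case 2
      have "weight (d w) 4 = 1" using 2 r unfolding weight_def by auto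
      moreover have "r = 3 \<longrightarrow> \<not> (d (far x a) \<le> r + 1 \<and> d (far x b) \<le> r + 1)" using t1 2 by auto
      then have "r = 3 \<longrightarrow> wt a + wt b \<le> 3" unfolding wt_def by auto
      ultimately show ?thesis unfolding out' using r inw w12 by auto
    next
      case 3
      have "weight (d w) 4 = int r - 1" using 3 r unfolding weight_def by auto
      then show ?thesis unfolding out' using r inw w12 by auto
    qed
  qed
qed

lemma eps_received:
  assumes x: "x \<in> S" "d x = r + 2" and c: "cnt x 0 + cnt x 4 + cnt x 5 + cnt x 6 = 1" and c1: "r \<le> cnt x 1"
  shows "(if cnt x 1 = r + 1 then 2 else 1) \<le> received x"
proof -
  have "card {b \<in> N x. d b \<noteq> 2} = 1" unfolding card_eta by (rule c)
  then obtain w where w: "{b \<in> N x. d b \<noteq> 2} = {w}" by (auto simp: card_1_singleton_iff)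
  have wN: "w \<in> N x" "d w \<noteq> 2" using w by blast+
  have two: "\<forall>b \<in> N x - {w}. d b = 2" using w by blast
  have "{b \<in> N x - {w}. alpha b} = {b \<in> N x. kind x b = 1}"
    using wN(2) kind_alpha[of x] alpha_two by auto
  then have "r \<le> card {b \<in> N x - {w}. alpha b}" using c1 unfolding cnt_def by simp
  then have "\<not> d w \<le> r + 1" using small_neighbour[OF x wN(1) _ two] by blast
  then have dw: "r + 2 \<le> d w" by simp
  have Qw: "Q w x = N x - {w}" unfolding Q_def ..
  have "{a \<in> Q w x. \<not> alpha a} = {b \<in> N x. d b = 2 \<and> \<not> alpha b}" unfolding Qw using two wN(2) by auto
  then have cn: "card {a \<in> Q w x. \<not> alpha a} = cnt x 2 + cnt x 3 + cnt x 7" using card_nonalpha by simp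
  have tot: "cnt x 1 + (cnt x 2 + cnt x 3 + cnt x 7) = r + 1" using sum_cnt[of x] c x(2) by simp
  have k: "kind w x = (if cnt x 1 = r + 1 then 6 else 5)"
    unfolding kind_def cn using x(2) r2 two Qw tot c1 by auto
  have "transfer w x = (if cnt x 1 = r + 1 then 2 else 1)"
    unfolding transfer_def k weight_def using dw r2 by simp
  then show ?thesis using received_ge[OF wN(1)] by simp
qed

lemma big_out:
  assumes "r + 2 \<le> d x"
  shows "(\<Sum>b \<in> N x. transfer x b) = 4 * int (cnt x 1) + 3 * int (cnt x 2) + 2 * int (cnt x 3) + (int r - 1) * int (cnt x 4)
    + int (cnt x 5) + 2 * int (cnt x 6) + 2 * int (cnt x 7)"
  unfolding transfer_def out_cnt using assms r2 by (simp add: weight_def)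

lemma two_out:
  assumes "d x = 2"
  shows "(\<Sum>b \<in> N x. transfer x b) = 0"
  unfolding transfer_def weight_def using assms by simp

lemma sum_ge_5_colours:
  assumes r: "r = 2"
  shows "0 \<le> (\<Sum>v \<in> S. 7 * int (d v) - 18)"
proof (rule discharge[of transfer])
  fix x assume x: "x \<in> S"
  have "(\<Sum>b \<in> N x. transfer x b) \<le> 7 * int (d x) - 18 + received x"
  proof -
    consider "d x = 2" | "d x = 3" | "4 \<le> d x" using deg_ge_2[OF x] by linarith
    then show ?thesis
    proof cases
      case 1
      then show ?thesis using two_out[OF 1] two_received[OF x 1] by simp
    next
      case 2
      then show ?thesis using three_transfer[OF x 2] r by simp
    next
      case 3
      have x3: "3 \<le> d x" using 3 by simp
      have "4 * cnt x 1 + 3 * cnt x 2 + 2 * cnt x 3 + cnt x 4 + cnt x 5 + 2 * cnt x 6 + 2 * cnt x 7 + 18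
          \<le> 7 * d x + nat (received x)"
      proof (rule kinds_arith_2[OF sum_cnt 3])
        show "(d x = 4 \<longrightarrow> cnt x 1 = 0 \<and> cnt x 2 + cnt x 7 \<le> 2) \<and> (d x = 5 \<longrightarrow> 3 \<le> cnt x 2 + cnt x 3 + cnt x 7)"
          if "cnt x 0 = 0" "cnt x 4 + cnt x 5 + cnt x 6 = 0"
          using kinds_all_two[OF x x3] that r by simp
        show "1 \<le> cnt x 2 + cnt x 3 + cnt x 7" if "cnt x 0 = 0"
          using kinds_hub(1)[OF x x3 that] r by simp
        show "d x \<noteq> 4" if "cnt x 0 = 0" "cnt x 4 + cnt x 5 + cnt x 6 = 1"
          using kinds_hub(2)[OF x x3 that] r by simp
        show "cnt x 6 \<noteq> 2" if "cnt x 0 = 0" "d x = 4" "1 \<le> cnt x 1"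
          by (rule kinds_hub(3)[OF x x3 that(1) r that(2,3)])
        show "(if cnt x 1 = 3 then 2 else 1) \<le> nat (received x)"
          if "d x = 4" "cnt x 0 + cnt x 4 + cnt x 5 + cnt x 6 = 1" "2 \<le> cnt x 1"
          using eps_received[OF x _ that(2)] that r by (auto split: if_splits)
      qed
      then show ?thesis using received_nonneg[of x] 3 r big_out[of x] by simp
    qed
  qed
  then show "(\<Sum>b \<in> N x. transfer x b) \<le> 7 * int (d x) - 18 + (\<Sum>u \<in> N x. transfer u x)"
    unfolding received_def .
qed

lemma sum_ge_6_colours:
  assumes r: "r = 3"
  shows "0 \<le> (\<Sum>v \<in> S. 6 * int (d v) - 16)"
proof (rule discharge[of transfer])
  fix x assume x: "x \<in> S"
  have "(\<Sum>b \<in> N x. transfer x b) \<le> 6 * int (d x) - 16 + received x"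
  proof -
    consider "d x = 2" | "d x = 3" | "d x = 4" | "5 \<le> d x" using deg_ge_2[OF x] by linarith
    then show ?thesis
    proof cases
      case 1
      then show ?thesis using two_out[OF 1] two_received[OF x 1] by simp
    next
      case 2
      then show ?thesis using three_transfer[OF x 2] r by simp
    next
      case 3
      have c1: "cnt x 1 = 0" using cnt_1_small[OF x] 3 r by simp
      have "(\<Sum>b \<in> N x. transfer x b) = 2 * int (cnt x 2 + cnt x 3 + cnt x 7) + int (cnt x 4)"
      proof -
        have "d x \<noteq> 2" "d x \<noteq> 3" "d x \<le> r + 1" using 3 r by simp_all
        then show ?thesis unfolding transfer_def out_cnt by (simp add: weight_def)
      qed
      then show ?thesis using sum_cnt[of x] 3 received_nonneg[of x] by simp
    next
      case 4
      have x3: "3 \<le> d x" using 4 by simp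
      have "4 * cnt x 1 + 3 * cnt x 2 + 2 * cnt x 3 + 2 * cnt x 4 + cnt x 5 + 2 * cnt x 6 + 2 * cnt x 7 + 16
          \<le> 6 * d x + nat (received x)"
      proof (rule kinds_arith_3[OF sum_cnt 4])
        show "3 \<le> cnt x 2 + cnt x 3 + cnt x 7 \<and> (d x = 5 \<longrightarrow> cnt x 1 = 0 \<and> cnt x 2 + cnt x 7 \<le> 3) \<and>
            (d x = 6 \<longrightarrow> 4 \<le> cnt x 2 + cnt x 3 + cnt x 7)"
          if "cnt x 0 = 0" "cnt x 4 + cnt x 5 + cnt x 6 = 0"
          using kinds_all_two[OF x x3] that r by simp
        show "2 \<le> cnt x 2 + cnt x 3 + cnt x 7" if "cnt x 0 = 0"
          using kinds_hub(1)[OF x x3 that] r by simp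
        show "d x \<noteq> 5" if "cnt x 0 = 0" "cnt x 4 + cnt x 5 + cnt x 6 = 1"
          using kinds_hub(2)[OF x x3 that] r by simp
        show "(if cnt x 1 = 4 then 2 else 1) \<le> nat (received x)"
          if "d x = 5" "cnt x 0 + cnt x 4 + cnt x 5 + cnt x 6 = 1" "3 \<le> cnt x 1"
          using eps_received[OF x _ that(2)] that r by (auto split: if_splits)
      qed
      then show ?thesis using received_nonneg[of x] 4 r big_out[of x] by simp
    qed
  qed
  then show "(\<Sum>b \<in> N x. transfer x b) \<le> 6 * int (d x) - 16 + (\<Sum>u \<in> N x. transfer u x)"
    unfolding received_def .
qed

end

context mincex
begin

lemma fill_star:
  assumes g: "good r T \<psi>" and TS: "T \<subseteq> S" and x: "x \<in> T" "\<psi> x \<noteq> 0"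
    and P: "P \<subseteq> N x" "P \<inter> T = {}" "\<forall>b \<in> P. d b = 2 \<and> (far x b \<in> T \<longrightarrow> \<psi> (far x b) \<noteq> \<psi> x)"
  shows "\<exists>\<chi>. good r (T \<union> P) \<chi> \<and> (\<forall>b \<in> P. \<chi> b = 0) \<and> (\<forall>u \<in> T. \<chi> u = \<psi> u)"
proof -
  have fin: "finite T" "finite P" using TS finS P(1) finN[of x] finite_subset by blast+
  have xS: "x \<in> S" using x TS by blast
  have "\<exists>\<chi>. good r (T \<union> K) \<chi> \<and> (\<forall>b \<in> K. \<chi> b = 0) \<and> (\<forall>u \<in> T. \<chi> u = \<psi> u)" if "finite K" "K \<subseteq> P" for K
    using that
  proof (induction K rule: finite_induct)
    case empty
    show ?case using g by auto
  next
    case (insert b K)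
    then obtain \<chi> where \<chi>: "good r (T \<union> K) \<chi>" "\<forall>b \<in> K. \<chi> b = 0" "\<forall>u \<in> T. \<chi> u = \<psi> u" by auto
    have b: "b \<in> P" "b \<in> N x" "d b = 2" "b \<notin> T \<union> K" using insert P by blast+
    have TK: "T \<union> K \<subseteq> S" using TS insert(4) P(1) by auto
    have nbb: "nb (T \<union> K) b = {x, far x b} \<inter> (T \<union> K)" by (rule nb_two[OF b(3) xS b(2) TK])
    have "\<chi> (far x b) \<noteq> \<chi> x" if "far x b \<in> T \<union> K"
      using that \<chi>(2,3) P(3) b(1) x by auto
    then have "\<forall>u \<in> nb (T \<union> K) b. \<forall>u' \<in> nb (T \<union> K) b. \<chi> u = \<chi> u' \<longrightarrow> u = u'"
      unfolding nbb by auto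
    then obtain \<chi>' where \<chi>': "good r (insert b (T \<union> K)) \<chi>'" "\<chi>' b = 0" "\<forall>u \<in> T \<union> K. \<chi>' u = \<chi> u"
      using add_forest_leaf[OF \<chi>(1) _ b(4)] fin insert(1) by auto
    have "good r (T \<union> insert b K) \<chi>'" using \<chi>'(1) by simp
    moreover have "\<forall>b \<in> insert b K. \<chi>' b = 0" "\<forall>u \<in> T. \<chi>' u = \<psi> u" using \<chi>' \<chi>(2,3) by auto
    ultimately show ?case by blast
  qed
  from this[OF fin(2)] show ?thesis by blast
qed

lemma not_all_alpha:
  assumes x: "x \<in> S" "3 \<le> d x"
  shows "\<exists>b \<in> N x. \<not> alpha b"
proof (rule ccontr)
  assume "\<not> ?thesis"
  then have al: "\<forall>b \<in> N x. alpha b" by blast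
  define T where "T = S - insert x (N x)"
  have Tn: "T \<subseteq> S" "x \<notin> T" "N x \<inter> T = {}" "insert x T \<subseteq> S" unfolding T_def using x by auto
  obtain \<phi> where n: "normal r T \<phi>" and g: "good r T \<phi>"
    by (rule partial[of x "insert x (N x)"]) (use x T_def in auto)
  have nbx: "nb T x = {}" by (rule nb_disj[OF Tn(1,3)])
  obtain \<psi> where \<psi>: "good r (insert x T) \<psi>" "\<psi> x = 1" "\<forall>u \<in> T. \<psi> u = \<phi> u"
    using add_coloured_vertex[OF g Tn(2), of 1] r1 nbx by auto
  have "\<exists>\<chi>. good r (insert x T \<union> N x) \<chi> \<and> (\<forall>b \<in> N x. \<chi> b = 0) \<and> (\<forall>u \<in> insert x T. \<chi> u = \<psi> u)"
  proof (rule fill_star[OF \<psi>(1) Tn(4)])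
    show "N x \<inter> insert x T = {}" using Tn(3) irrefl by auto
    show "\<forall>b \<in> N x. d b = 2 \<and> (far x b \<in> insert x T \<longrightarrow> \<psi> (far x b) \<noteq> \<psi> x)"
    proof
      fix b assume b: "b \<in> N x"
      have a: "alpha b" using al b by blast
      have "\<psi> (far x b) \<noteq> \<psi> x" if f: "far x b \<in> insert x T"
      proof -
        have fT: "far x b \<in> T" using f far_in(2)[OF x(1) b alpha_two[OF a]] by blast
        have "b \<notin> T" using b Tn(3) by blast
        then have "\<phi> (far x b) = 0" using alpha_far_zero[OF a x(1) b _ Tn(1) _ fT n] x(2) by simp
        then show ?thesis using \<psi>(2,3) fT by simp
      qed
      then show "d b = 2 \<and> (far x b \<in> insert x T \<longrightarrow> \<psi> (far x b) \<noteq> \<psi> x)" using alpha_two[OF a] by blast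
    qed
  qed (use \<psi>(2) in auto)
  moreover have "insert x T \<union> N x = S" unfolding T_def using x by auto
  ultimately show False using nocol by auto
qed

end

section \<open>One class besides the forest\<close>

locale mincex1 = mincex E S 1 for E :: "'a \<Rightarrow> 'a \<Rightarrow> bool" and S :: "'a set"
begin

lemma alpha_3_neighbour:
  assumes x: "x \<in> S" "d x = 3" and b: "b \<in> N x" "alpha b"
  shows "\<exists>y \<in> N x. 3 \<le> d y"
proof (rule ccontr)
  assume no: "\<not> ?thesis"
  have two: "\<forall>y \<in> N x. d y = 2"
  proof
    fix y assume y: "y \<in> N x"
    then have "2 \<le> d y" using deg_ge_2[of y] by simp
    then show "d y = 2" using no y by force
  qed
  show False
  proof (cases "\<forall>b \<in> N x. \<forall>b' \<in> N x. \<not> E b b'")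
    case True
    then show False using all_two(3)[OF x(1) _ two True _ b(1)] x(2) b(2) by simp
  next
    case False
    then obtain e f where ef: "e \<in> N x" "f \<in> N x" "E e f" by blast
    have ne: "e \<noteq> f" using ef(3) irrefl by auto
    have "card (N x - {e, f}) = 1"
    proof -
      have "card (N x) = 3" using x(2) unfolding d_def .
      then show ?thesis using ef(1,2) ne by (simp add: card_Diff_subset del: in_nb)
    qed
    then obtain c where c: "N x - {e, f} = {c}" by (auto simp: card_1_singleton_iff simp del: in_nb)
    then have Nx: "N x = {e, f, c}" "c \<noteq> e" "c \<noteq> f" "c \<in> N x" using ef by blast+
    have dd: "d e = 2" "d f = 2" "d c = 2" using two ef Nx(4) by blast+
    have xe: "x \<noteq> e" "x \<noteq> f" "x \<noteq> c" using ef(1,2) Nx(4) irrefl by auto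
    have fe: "f \<in> N e" "e \<in> N f" using ef sym by auto
    have Ne: "N e = {x, f}" using two_far(1)[OF dd(1) fe(1)] N_sym[OF x(1) ef(1)] xe by auto
    have Nf: "N f = {x, e}" using two_far(1)[OF dd(2) fe(2)] N_sym[OF x(1) ef(2)] xe by auto
    note fc = far_in[OF x(1) Nx(4) dd(3)]
    define y where "y = far x c"
    have "c \<notin> N e" "c \<notin> N f" using Ne Nf Nx(2,3) xe by auto
    then have yne: "y \<noteq> e" "y \<noteq> f" "y \<noteq> x" "y \<noteq> c" unfolding y_def using fc irrefl by auto
    define T where "T = S - {x, e, f, c}"
    have efS: "e \<in> S" "f \<in> S" "c \<in> S" "y \<in> S" using ef Nx(4) fc(1) unfolding y_def by auto
    have Tn: "T \<subseteq> S" "x \<notin> T" "e \<notin> T" "f \<notin> T" "c \<notin> T" "y \<in> T" "insert x T \<subseteq> S"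
      unfolding T_def using yne efS x by auto
    obtain \<phi> where n: "normal 1 T \<phi>" and g: "good 1 T \<phi>" and fin: "finite T"
      by (rule partial[of x "{x, e, f, c}"]) (use x efS T_def in auto)
    have nbx: "nb T x = {}" using nb_Int[OF Nx(1) Tn(1)] Tn by auto
    have full: "insert x T \<union> {e, f, c} = S" unfolding T_def using x efS by auto
    show False
    proof (cases "\<phi> y = 1")
      case False
      obtain \<psi> where \<psi>: "good 1 (insert x T) \<psi>" "\<psi> x = 1" "\<forall>u \<in> T. \<psi> u = \<phi> u"
        using add_coloured_vertex[OF g Tn(2), of 1] nbx by auto
      have fx: "far x e = f" "far x f = e" using far_eq[OF dd(1) Ne] far_eq[OF dd(2) Nf] xe by auto
      have "\<exists>\<chi>. good 1 (insert x T \<union> N x) \<chi> \<and> (\<forall>b \<in> N x. \<chi> b = 0) \<and> (\<forall>u \<in> insert x T. \<chi> u = \<psi> u)"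
      proof (rule fill_star[OF \<psi>(1) Tn(7)])
        show "N x \<inter> insert x T = {}" unfolding Nx(1) using Tn xe by auto
        show "\<forall>b \<in> N x. d b = 2 \<and> (far x b \<in> insert x T \<longrightarrow> \<psi> (far x b) \<noteq> \<psi> x)"
          unfolding Nx(1) using dd fx Tn xe \<psi>(2,3) False unfolding y_def by auto
      qed (use \<psi>(2) in auto)
      then show False unfolding Nx(1) full using nocol by auto
    next
      case True
      obtain \<psi>1 where \<psi>1: "good 1 (insert x T) \<psi>1" "\<psi>1 x = 0" "\<forall>u \<in> T. \<psi>1 u = \<phi> u"
        using add_forest_leaf[OF g fin Tn(2)] nbx by auto
      have nbc: "nb (insert x T) c = {x, y}" using nb_Int[OF fc(5) Tn(7)] Tn(6) unfolding y_def by auto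
      have y1: "\<psi>1 y = 1" using \<psi>1(3) Tn(6) True by simp
      have "\<exists>\<psi>. good 1 (insert c (insert x T)) \<psi> \<and> \<psi> c = 0 \<and> (\<forall>u \<in> insert x T. \<psi> u = \<psi>1 u)"
        by (rule add_forest_leaf[OF \<psi>1(1)]) (use fin nbc \<psi>1(2) y1 Tn(5) xe(3) in simp_all)
      then obtain \<psi>2 where \<psi>2: "good 1 (insert c (insert x T)) \<psi>2" "\<psi>2 c = 0" "\<forall>u \<in> insert x T. \<psi>2 u = \<psi>1 u"
        by blast
      have S2: "insert c (insert x T) \<subseteq> S" using full by blast
      have nbf: "nb (insert c (insert x T)) f = {x}" using nb_Int[OF Nf S2] Tn(3) Nx(2) xe by auto
      have "\<exists>\<psi>. good 1 (insert f (insert c (insert x T))) \<psi> \<and> \<psi> f = 0 \<and> (\<forall>u \<in> insert c (insert x T). \<psi> u = \<psi>2 u)"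
        by (rule add_forest_leaf[OF \<psi>2(1)]) (use fin nbf Tn(4) xe(2) Nx(3) in auto)
      then obtain \<psi>3 where \<psi>3: "good 1 (insert f (insert c (insert x T))) \<psi>3" "\<psi>3 f = 0"
        "\<forall>u \<in> insert c (insert x T). \<psi>3 u = \<psi>2 u" by blast
      define T3 where "T3 = insert f (insert c (insert x T))"
      have S3: "T3 \<subseteq> S" using full unfolding T3_def by blast
      have eT3: "e \<notin> T3" using Tn(3) ne xe Nx(2) unfolding T3_def by auto
      have nbe: "nb T3 e = {x, f}" using nb_Int[OF Ne S3] unfolding T3_def by auto
      have nbx3: "nb T3 x = {f, c}" using nb_Int[OF Nx(1) S3] eT3 unfolding T3_def by auto
      have nbf3: "nb T3 f = {x}" using nb_Int[OF Nf S3] eT3 unfolding T3_def by auto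
      have col: "\<psi>3 x = 0" "\<psi>3 f = 0" "\<psi>3 c = 0" using \<psi>3(2,3) \<psi>2(2,3) \<psi>1(2) by auto
      have "\<exists>\<chi>. good 1 (insert e T3) \<chi> \<and> \<chi> e = 1 \<and> (\<forall>u \<in> T3. \<chi> u = \<psi>3 u)"
        by (rule add_coloured_vertex[OF \<psi>3(1)[folded T3_def] eT3])
          (use nbe nbx3 nbf3 col in \<open>auto simp: free_def\<close>)
      moreover have "insert e T3 = S" using full unfolding T3_def by blast
      ultimately show False using nocol by auto
    qed
  qed
qed

lemma cut_set:
  assumes g: "good 1 T \<psi>" and TS: "T \<subseteq> S" and finO: "finite O'" and O: "O' \<inter> T = {}"
    and f: "\<forall>u \<in> O'. alpha u \<and> u \<in> N (f u) \<and> d (f u) \<noteq> 2 \<and> f u \<in> T \<and> \<psi> (f u) = 0 \<and>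
      (\<forall>y \<in> nb T (f u). \<psi> y \<noteq> 1) \<and> (\<forall>u' \<in> O'. u' \<in> N (f u) \<longrightarrow> u' = u)"
  shows "\<exists>\<chi>. good 1 (T \<union> O') \<chi> \<and> (\<forall>u \<in> T. \<chi> u = \<psi> u)"
proof -
  have "\<exists>\<chi>. good 1 (T \<union> K) \<chi> \<and> (\<forall>u \<in> T. \<chi> u = \<psi> u)" if "finite K" "K \<subseteq> O'" for K
    using that
  proof (induction K rule: finite_induct)
    case empty
    show ?case using g by auto
  next
    case (insert u K)
    then obtain \<chi> where \<chi>: "good 1 (T \<union> K) \<chi>" "\<forall>u \<in> T. \<chi> u = \<psi> u" by auto
    define p where "p = f u"
    have uO: "u \<in> O'" using insert by blast
    have u: "alpha u" "u \<in> N p" "d p \<noteq> 2" "p \<in> T" "\<psi> p = 0" "\<forall>y \<in> nb T p. \<psi> y \<noteq> 1"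
      "\<forall>u' \<in> O'. u' \<in> N p \<longrightarrow> u' = u" using f uO unfolding p_def by blast+
    have uTK: "u \<notin> T \<union> K" using uO O insert(2) by blast
    have KS: "K \<subseteq> S" using insert(4) f by auto
    have TK: "T \<union> K \<subseteq> S" using TS KS by blast
    have pS: "p \<in> S" using u(4) TS by blast
    have du: "d u = 2" by (rule alpha_two[OF u(1)])
    have nbp: "\<forall>y \<in> nb (T \<union> K) p. \<chi> y \<noteq> 1"
    proof
      fix y assume y: "y \<in> nb (T \<union> K) p"
      then have yN: "y \<in> N p" using TK by auto
      have "y \<notin> K" using u(7) yN insert(2,4) by blast
      then have "y \<in> nb T p" using y by auto
      then show "\<chi> y \<noteq> 1" using u(6) \<chi>(2) by simp
    qed
    have "\<exists>\<chi>'. good 1 (insert u (T \<union> K)) \<chi>' \<and> (\<forall>u \<in> T \<union> K. \<chi>' u = \<chi> u)"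
    proof (cases "far p u \<in> T \<union> K \<and> \<chi> (far p u) = 0")
      case True
      have le1: "card (nb (T \<union> K) (far p u)) \<le> 1" by (rule alpha_far_nb[OF u(1) pS u(2,3) TK uTK])
      have finn: "finite (nb (T \<union> K) (far p u))" using TK finS finite_subset by (intro finite_nb) blast
      have eq: "y = y'" if "y \<in> nb (T \<union> K) (far p u)" "y' \<in> nb (T \<union> K) (far p u)" for y y'
        by (rule card_le_1_eq[OF finn le1 that])
      have iso: "isolated (T \<union> K) \<chi> (far p u) \<or> free (T \<union> K) \<chi> (far p u) 1"
      proof (cases "\<exists>y \<in> nb (T \<union> K) (far p u). \<chi> y = 1")
        case True
        then have "\<forall>y \<in> nb (T \<union> K) (far p u). \<chi> y = 1" using eq by blast
        then show ?thesis using \<open>far p u \<in> T \<union> K \<and> \<chi> (far p u) = 0\<close> by (simp add: isolated_def)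
      next
        case False
        then show ?thesis using \<open>far p u \<in> T \<union> K \<and> \<chi> (far p u) = 0\<close> by (simp add: free_def)
      qed
      have "\<exists>\<chi>'. good 1 (insert u (T \<union> K)) \<chi>' \<and> (\<chi>' u = 0 \<or> \<chi>' u = 1) \<and> (\<forall>u \<in> T \<union> K. \<chi>' u = \<chi> u)"
        by (rule cut[OF \<chi>(1) TK _ _ du u(2) uTK _ _ _ _ nbp iso]) (use True u \<chi>(2) in auto)
      then show ?thesis by blast
    next
      case False
      have fin: "finite (T \<union> K)" using TK finS finite_subset by blast
      have nbu: "nb (T \<union> K) u = {p, far p u} \<inter> (T \<union> K)" by (rule nb_two[OF du pS u(2) TK])
      show ?thesis
      proof (cases "far p u \<in> T \<union> K")
        case True
        then have "\<chi> (far p u) \<noteq> 0" using False by simp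
        moreover have "\<chi> p = 0" using u(4,5) \<chi>(2) by simp
        ultimately have "\<forall>y \<in> nb (T \<union> K) u. \<forall>y' \<in> nb (T \<union> K) u. \<chi> y = \<chi> y' \<longrightarrow> y = y'"
          unfolding nbu by auto
        then show ?thesis using add_forest_leaf[OF \<chi>(1) fin uTK] by blast
      next
        case False
        then have "nb (T \<union> K) u = {p}" using nbu u(4) by auto
        moreover have "free (T \<union> K) \<chi> p 1" using u(4,5) \<chi>(2) nbp unfolding free_def by simp
        ultimately have "\<exists>\<chi>'. good 1 (insert u (T \<union> K)) \<chi>' \<and> \<chi>' u = 1 \<and> (\<forall>u \<in> T \<union> K. \<chi>' u = \<chi> u)"
          by (intro add_coloured_vertex[OF \<chi>(1) uTK]) simp_all
        then show ?thesis by blast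
      qed
    qed
    then obtain \<chi>' where "good 1 (insert u (T \<union> K)) \<chi>'" "\<forall>u \<in> T \<union> K. \<chi>' u = \<chi> u" by blast
    then have "good 1 (T \<union> insert u K) \<chi>' \<and> (\<forall>u \<in> T. \<chi>' u = \<psi> u)" using \<chi>(2) by simp
    then show ?case by blast
  qed
  from this[OF finO] show ?thesis by blast
qed

definition bad :: "'a \<Rightarrow> bool" where
  "bad v \<longleftrightarrow> v \<in> S \<and> d v = 3 \<and> (\<exists>a b y. N v = {a, b, y} \<and> a \<noteq> b \<and> alpha a \<and> alpha b \<and> 3 \<le> d y)"

definition weak :: "'a \<Rightarrow> bool" where
  "weak v \<longleftrightarrow> v \<in> S \<and> d v = 3 \<and>
     (\<exists>a m y. N v = {a, m, y} \<and> alpha a \<and> d m = 2 \<and> \<not> alpha m \<and> 3 \<le> d y)"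

definition triple :: "'a \<Rightarrow> bool" where
  "triple v \<longleftrightarrow> v \<in> S \<and> d v = 3 \<and> (\<forall>m \<in> N v. d m = 2 \<and> \<not> alpha m) \<and> card {m \<in> N v. weak (far v m)} = 2"

definition link :: "'a \<Rightarrow> bool" where
  "link u \<longleftrightarrow> u \<in> S \<and> d u = 2 \<and>
     (if alpha u then \<forall>w \<in> N u. if d w = 2 then bad (far u w) else bad w
      else \<exists>p q. N u = {p, q} \<and> weak p \<and> (weak q \<or> triple q))"

definition W :: "'a set" where "W = {v \<in> S. bad v \<or> weak v \<or> triple v \<or> link v}"

lemma deg3: "bad v \<Longrightarrow> d v = 3" "weak v \<Longrightarrow> d v = 3" "triple v \<Longrightarrow> d v = 3"
  unfolding bad_def weak_def triple_def by auto

lemma W_cases: "v \<in> W \<Longrightarrow> d v = 2 \<and> link v \<or> d v = 3 \<and> (bad v \<or> weak v \<or> triple v)"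
proof -
  assume "v \<in> W"
  then consider "bad v" | "weak v" | "triple v" | "link v" unfolding W_def by blast
  then show ?thesis
  proof cases
    case 4
    then have "d v = 2" unfolding link_def by simp
    then show ?thesis using 4 by simp
  qed (simp_all add: deg3)
qed

lemma alpha_nbs:
  assumes "alpha u" "u \<in> S" "p \<in> N u" "d p \<noteq> 2"
  shows "\<exists>u'. N u = {p, u'} \<and> u' \<noteq> p \<and> d u' = 2"
proof -
  have "N u = {p, far p u}" "far p u \<noteq> p" using two_far[OF alpha_two[OF assms(1)] assms(3)] by blast+
  then show ?thesis using assms(1,4) unfolding alpha_def by auto
qed

lemma nonalpha_nb: "\<lbrakk>d m = 2; \<not> alpha m; p \<in> N m\<rbrakk> \<Longrightarrow> d p \<noteq> 2"
  unfolding alpha_def by blast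

lemma bad_nb: assumes "bad v" "u \<in> N v" shows "alpha u \<or> 3 \<le> d u"
proof -
  obtain a b y where v: "N v = {a, b, y}" "alpha a" "alpha b" "3 \<le> d y" using assms(1) unfolding bad_def by blast
  have "u \<in> {a, b, y}" using assms(2) unfolding v(1) .
  then show ?thesis using v by blast
qed

lemma bad_not_weak: "bad v \<Longrightarrow> \<not> weak v"
proof
  assume b: "bad v" and w: "weak v"
  from w obtain m where "m \<in> N v" "d m = 2" "\<not> alpha m" unfolding weak_def by blast
  then show False using bad_nb[OF b, of m] by auto
qed

lemma triple_nb: "\<lbrakk>triple v; u \<in> N v\<rbrakk> \<Longrightarrow> d u = 2 \<and> \<not> alpha u"
  unfolding triple_def by blast

lemma bad_not_triple: "bad v \<Longrightarrow> \<not> triple v"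
  using triple_nb unfolding bad_def by blast

lemma weak_not_triple: "weak v \<Longrightarrow> \<not> triple v"
  using triple_nb unfolding weak_def by blast

lemma W_real:
  assumes "x \<in> W" "y \<in> N x" "d x = 3" "3 \<le> d y"
  shows "bad x \<or> weak x"
  using W_cases[OF assms(1)] triple_nb[of x y] assms by auto

lemma link_alpha:
  assumes "link u" "alpha u" "w \<in> N u"
  shows "d w \<noteq> 2 \<Longrightarrow> bad w" "d w = 2 \<Longrightarrow> bad (far u w)"
  using assms unfolding link_def by auto

lemma link_nonalpha:
  assumes "link m" "\<not> alpha m" "w \<in> N m"
  shows "weak w \<or> triple w" "triple w \<Longrightarrow> w' \<in> N m \<Longrightarrow> w' \<noteq> w \<Longrightarrow> weak w'"
proof -
  obtain p q where m: "N m = {p, q}" "weak p" "weak q \<or> triple q" using assms(1,2) unfolding link_def by auto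
  then show "weak w \<or> triple w" using assms(3) by auto
  show "weak w'" if "triple w" "w' \<in> N m" "w' \<noteq> w"
    using m weak_not_triple that assms(3) by auto
qed

lemma weak_alpha:
  assumes "weak v" "u \<in> N v" "alpha u"
  shows "u \<notin> W"
proof
  assume "u \<in> W"
  then have l: "link u" using W_cases[of u] alpha_two[OF assms(3)] by auto
  have vS: "v \<in> S" using assms(1) unfolding weak_def by blast
  have "bad v" by (rule link_alpha(1)[OF l assms(3) N_sym[OF vS assms(2)]]) (use deg3(2)[OF assms(1)] in simp)
  then show False using bad_not_weak assms(1) by blast
qed

lemma bad_real:
  assumes "bad v" "N v = {p, q, u}" "3 \<le> d u"
  shows "alpha p \<and> alpha q"
proof -
  obtain a b y where v: "N v = {a, b, y}" "a \<noteq> b" "alpha a" "alpha b" "3 \<le> d y"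
    using assms(1) unfolding bad_def by blast
  have "a \<noteq> u" "b \<noteq> u" using alpha_two v(3,4) assms(3) by auto
  then have "{a, b} \<subseteq> {p, q}" using v(1) assms(2) by auto
  then have "{p, q} = {a, b}" using v(2) by auto
  then show ?thesis using v(3,4) by auto
qed

lemma real_partner:
  assumes "bad y \<or> weak y" "x \<in> N y" "3 \<le> d x"
  shows "\<exists>t s. N y = {t, s, x} \<and> alpha t \<and> d s = 2 \<and> t \<noteq> s"
proof (cases "bad y")
  case True
  then obtain a b y' where y: "N y = {a, b, y'}" "a \<noteq> b" "alpha a" "alpha b" unfolding bad_def by blast
  have "a \<noteq> x" "b \<noteq> x" using alpha_two y(3,4) assms(3) by auto
  then have "x = y'" using assms(2) y(1) by auto
  then show ?thesis using y alpha_two by blast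
next
  case False
  then obtain a m y' where y: "N y = {a, m, y'}" "alpha a" "d m = 2" "\<not> alpha m" using assms(1) unfolding weak_def by blast
  have "a \<noteq> x" "m \<noteq> x" using alpha_two y(2,3) assms(3) by auto
  then have "x = y'" using assms(2) y(1) by auto
  then show ?thesis using y by blast
qed

end

locale W_cycle = mincex1 +
  fixes v :: "nat \<Rightarrow> 'a" and n :: nat
  assumes n3: "3 \<le> n" and vn: "v n = v 0" and inj: "inj_on v {..<n}"
    and adj: "i < n \<Longrightarrow> E (v i) (v (Suc i))" and vW: "i < n \<Longrightarrow> v i \<in> W"
    and bad0: "bad (v 0)" and alpha1: "alpha (v 1)" and N0: "N (v 0) \<subseteq> W"
begin

definition C :: "'a set" where "C = v ` {..<n}"

lemma v_eq: "i < n \<Longrightarrow> j < n \<Longrightarrow> v i = v j \<longleftrightarrow> i = j"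
  using inj by (auto dest: inj_onD)

lemma vS: "i < n \<Longrightarrow> v i \<in> S"
  using vW unfolding W_def by blast

lemma vS': "i \<le> n \<Longrightarrow> v i \<in> S"
  using vS[of i] vS[of 0] vn n3 by (cases "i = n") auto

lemma v_ne: "Suc i < n \<Longrightarrow> v i \<noteq> v (Suc (Suc i))"
  using v_eq[of i "Suc (Suc i)"] v_eq[of i 0] vn n3 by (cases "Suc (Suc i) = n") auto

lemma cyc_nb: "Suc i < n \<Longrightarrow> v i \<in> N (v (Suc i))" "Suc i < n \<Longrightarrow> v (Suc (Suc i)) \<in> N (v (Suc i))"
  using adj[of i] adj[of "Suc i"] vS'[of i] vS'[of "Suc (Suc i)"] sym by auto

lemma vC: "i \<le> n \<Longrightarrow> v i \<in> C"
  unfolding C_def using vn n3 by (cases "i = n") auto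

lemma CE: assumes "c \<in> C" "c \<noteq> v 0" obtains i where "c = v (Suc i)" "Suc i < n"
  using assms unfolding C_def by (metis imageE lessThan_iff not0_implies_Suc)

lemma two_nb: "Suc i < n \<Longrightarrow> d (v (Suc i)) = 2 \<Longrightarrow> N (v (Suc i)) = {v i, v (Suc (Suc i))}"
  using two_far(1)[OF _ cyc_nb(1)] cyc_nb(2) v_ne by (metis insert_iff singletonD)

definition off :: "nat \<Rightarrow> 'a" where
  "off i = (SOME y. y \<in> N (v i) \<and> y \<noteq> v (i - 1) \<and> y \<noteq> v (Suc i))"

lemma off: assumes "Suc i < n" "d (v (Suc i)) = 3"
  shows "N (v (Suc i)) = {v i, v (Suc (Suc i)), off (Suc i)}" "off (Suc i) \<noteq> v i" "off (Suc i) \<noteq> v (Suc (Suc i))"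
proof -
  have "card (N (v (Suc i)) - {v i, v (Suc (Suc i))}) = 1"
    using cyc_nb[OF assms(1)] v_ne[OF assms(1)] assms(2) unfolding d_def
    by (simp add: card_Diff_subset del: in_nb)
  then obtain y where y: "N (v (Suc i)) - {v i, v (Suc (Suc i))} = {y}" by (auto simp: card_1_singleton_iff simp del: in_nb)
  have yN: "y \<in> N (v (Suc i)) \<and> y \<noteq> v i \<and> y \<noteq> v (Suc (Suc i))" using y by blast
  have un: "z = y" if "z \<in> N (v (Suc i)) \<and> z \<noteq> v i \<and> z \<noteq> v (Suc (Suc i))" for z using y that by blast
  have "off (Suc i) = y" unfolding off_def diff_Suc_1 by (rule some_equality, rule yN, rule un)
  then show "N (v (Suc i)) = {v i, v (Suc (Suc i)), off (Suc i)}" "off (Suc i) \<noteq> v i" "off (Suc i) \<noteq> v (Suc (Suc i))"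
    using y cyc_nb[OF assms(1)] by blast+
qed

definition o0 :: 'a where "o0 = (SOME y. y \<in> N (v 0) \<and> y \<noteq> v (n - 1) \<and> y \<noteq> v 1)"

lemma o0: "N (v 0) = {v (n - 1), v 1, o0}" "o0 \<noteq> v (n - 1)" "o0 \<noteq> v 1"
proof -
  have n1: "Suc (n - 1) = n" using n3 by simp
  have nb: "v (n - 1) \<in> N (v 0)" "v 1 \<in> N (v 0)" "v (n - 1) \<noteq> v 1"
    using adj[of "n - 1"] adj[of 0] n1 vn n3 vS[of "n - 1"] vS[of 1] sym v_eq[of "n - 1" 1] by auto
  have "card (N (v 0) - {v (n - 1), v 1}) = 1"
    using nb deg3(1)[OF bad0] unfolding d_def by (simp add: card_Diff_subset del: in_nb)
  then obtain y where y: "N (v 0) - {v (n - 1), v 1} = {y}" by (auto simp: card_1_singleton_iff simp del: in_nb)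
  have yN: "y \<in> N (v 0) \<and> y \<noteq> v (n - 1) \<and> y \<noteq> v 1" using y by blast
  have un: "z = y" if "z \<in> N (v 0) \<and> z \<noteq> v (n - 1) \<and> z \<noteq> v 1" for z using y that by blast
  have "o0 = y" unfolding o0_def by (rule some_equality, rule yN, rule un)
  then show "N (v 0) = {v (n - 1), v 1, o0}" "o0 \<noteq> v (n - 1)" "o0 \<noteq> v 1" using y nb by blast+
qed

lemma two_in_C: assumes "c \<in> C" "d c = 2" "x \<in> N c"
  shows "\<exists>i. Suc i < n \<and> c = v (Suc i) \<and> (x = v i \<or> x = v (Suc (Suc i)))"
proof -
  have "c \<noteq> v 0" using assms(2) deg3(1)[OF bad0] by auto
  then obtain i where i: "c = v (Suc i)" "Suc i < n" using CE assms(1) by blast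
  then show ?thesis using two_nb[OF i(2)] assms(2,3) by auto
qed

lemma two_in_C_nb: "\<lbrakk>c \<in> C; d c = 2; x \<in> N c\<rbrakk> \<Longrightarrow> x \<in> C"
proof -
  assume "c \<in> C" "d c = 2" "x \<in> N c"
  then obtain i where "Suc i < n" "x = v i \<or> x = v (Suc (Suc i))" using two_in_C by blast
  then show "x \<in> C" using vC[of i] vC[of "Suc (Suc i)"] by auto
qed

lemma off_notin_C: assumes i: "Suc i < n" "d (v (Suc i)) = 3" "d (off (Suc i)) = 2"
  shows "off (Suc i) \<notin> C"
proof
  assume c: "off (Suc i) \<in> C"
  have "off (Suc i) \<in> N (v (Suc i))" using off(1)[OF i(1,2)] by blast
  then have "v (Suc i) \<in> N (off (Suc i))" by (rule N_sym[OF vS[OF i(1)]])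
  then obtain j where j: "Suc j < n" "off (Suc i) = v (Suc j)" "v (Suc i) = v j \<or> v (Suc i) = v (Suc (Suc j))"
    using two_in_C[OF c i(3)] by blast
  show False
  proof (cases "v (Suc i) = v j")
    case True
    then have "j = Suc i" using v_eq i(1) j(1) by auto
    then show False using j(2) off(3)[OF i(1,2)] by simp
  next
    case False
    then have "v (Suc i) = v (Suc (Suc j))" using j(3) by blast
    then have "Suc i = Suc (Suc j)"
      using v_eq[of "Suc i" "Suc (Suc j)"] v_eq[of "Suc i" 0] vn i(1) j(1) by (cases "Suc (Suc j) = n") auto
    then show False using j(2) off(2)[OF i(1,2)] by simp
  qed
qed

definition Offs :: "'a set" where "Offs = {off (Suc i) |i. Suc i < n \<and> d (v (Suc i)) = 3 \<and> alpha (off (Suc i))}"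
definition Mids :: "'a set" where "Mids = {off (Suc i) |i. Suc i < n \<and> triple (v (Suc i))}"
definition ext :: bool where "ext \<longleftrightarrow> 3 \<le> d o0 \<and> o0 \<notin> C"
definition cutv :: 'a where "cutv = (SOME t. \<exists>s. N o0 = {t, s, v 0} \<and> alpha t \<and> d s = 2 \<and> t \<noteq> s)"
definition Ys :: "'a set" where "Ys = (if ext then {o0} else {})"
definition Ts :: "'a set" where "Ts = (if ext then {cutv} else {})"
definition T0 :: "'a set" where "T0 = S - (C \<union> Offs \<union> Mids \<union> Ys \<union> Ts)"
definition T1 :: "'a set" where "T1 = insert (v 0) (T0 \<union> Ys)"

lemma o0N: "o0 \<in> N (v 0)" "o0 \<in> S" "E (v 0) o0" "v 0 \<in> N o0" "o0 \<in> W"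
proof -
  show "o0 \<in> N (v 0)" using o0(1) by blast
  then show "o0 \<in> S" "E (v 0) o0" by auto
  show "v 0 \<in> N o0" by (rule N_sym[OF vS \<open>o0 \<in> N (v 0)\<close>]) (use n3 in simp)
  show "o0 \<in> W" using N0 \<open>o0 \<in> N (v 0)\<close> by blast
qed

lemma o0_real: "3 \<le> d o0 \<Longrightarrow> bad o0 \<or> weak o0"
  using W_real[OF o0N(5,4)] W_cases[OF o0N(5)] deg3(1)[OF bad0] by auto

lemma cutv: assumes ext
  shows "\<exists>s. N o0 = {cutv, s, v 0} \<and> alpha cutv \<and> d s = 2 \<and> cutv \<noteq> s"
proof -
  have "\<exists>t s. N o0 = {t, s, v 0} \<and> alpha t \<and> d s = 2 \<and> t \<noteq> s"
    by (rule real_partner[OF o0_real o0N(4)]) (use assms deg3(1)[OF bad0] in \<open>auto simp: ext_def\<close>)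
  then show ?thesis unfolding cutv_def by (rule someI_ex)
qed

lemma Offs_E: assumes "u \<in> Offs"
  obtains i where "u = off (Suc i)" "Suc i < n" "d (v (Suc i)) = 3" "alpha u" "u \<in> N (v (Suc i))" "v (Suc i) \<in> N u" "u \<notin> C"
proof -
  obtain i where i: "u = off (Suc i)" "Suc i < n" "d (v (Suc i)) = 3" "alpha u" using assms unfolding Offs_def by blast
  have "u \<in> N (v (Suc i))" using off(1)[OF i(2,3)] i(1) by blast
  moreover from this have "v (Suc i) \<in> N u" by (rule N_sym[OF vS[OF i(2)]])
  moreover have "u \<notin> C" using off_notin_C[OF i(2,3)] i(1) alpha_two[OF i(4)] by simp
  ultimately show thesis using that i by blast
qed

lemma Mids_E: assumes "u \<in> Mids"
  obtains i where "u = off (Suc i)" "Suc i < n" "triple (v (Suc i))" "d u = 2" "\<not> alpha u" "u \<in> N (v (Suc i))" "v (Suc i) \<in> N u" "u \<notin> C"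
proof -
  obtain i where i: "u = off (Suc i)" "Suc i < n" "triple (v (Suc i))" using assms unfolding Mids_def by blast
  have u: "u \<in> N (v (Suc i))" using off(1)[OF i(2) deg3(3)[OF i(3)]] i(1) by blast
  moreover from this have "v (Suc i) \<in> N u" by (rule N_sym[OF vS[OF i(2)]])
  moreover have "d u = 2" "\<not> alpha u" using triple_nb[OF i(3) u] by blast+
  moreover have "u \<notin> C" using off_notin_C[OF i(2) deg3(3)[OF i(3)]] i(1) \<open>d u = 2\<close> by simp
  ultimately show thesis using that i by blast
qed

lemma alpha_unique: "\<lbrakk>alpha u; u \<in> S; p \<in> N u; q \<in> N u; d p = 3; d q = 3\<rbrakk> \<Longrightarrow> p = q"
  using alpha_nbs[of u p] by fastforce

lemma cutv_facts: assumes ext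
  shows "alpha cutv" "cutv \<in> N o0" "o0 \<in> N cutv" "cutv \<notin> C" "cutv \<notin> Offs" "cutv \<notin> Mids" "cutv \<in> S" "d o0 = 3"
proof -
  obtain s where s: "N o0 = {cutv, s, v 0}" "alpha cutv" using cutv[OF assms] by blast
  show "alpha cutv" by (rule s(2))
  show t: "cutv \<in> N o0" using s(1) by blast
  then show tS: "cutv \<in> S" by simp
  show ot: "o0 \<in> N cutv" by (rule N_sym[OF o0N(2) t])
  show "d o0 = 3" using W_cases[OF o0N(5)] assms unfolding ext_def by auto
  show "cutv \<notin> C" using two_in_C_nb[of cutv o0] alpha_two[OF s(2)] ot assms unfolding ext_def by blast
  show "cutv \<notin> Mids" using Mids_E s(2) by metis
  show "cutv \<notin> Offs"
  proof
    assume "cutv \<in> Offs"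
    then obtain i where i: "Suc i < n" "d (v (Suc i)) = 3" "v (Suc i) \<in> N cutv" by (rule Offs_E)
    then have "v (Suc i) = o0" using alpha_unique[OF s(2) tS i(3) ot i(2) \<open>d o0 = 3\<close>] by blast
    then show False using assms vC[of "Suc i"] i(1) unfolding ext_def by auto
  qed
qed

lemma degs_off: "u \<in> Offs \<union> Mids \<union> Ts \<Longrightarrow> d u = 2 \<and> u \<in> S \<and> u \<notin> C"
proof -
  assume "u \<in> Offs \<union> Mids \<union> Ts"
  then consider "u \<in> Offs" | "u \<in> Mids" | "ext" "u = cutv" unfolding Ts_def by (auto split: if_splits)
  then show ?thesis
  proof cases
    case 1 then show ?thesis by (rule Offs_E) (use alpha_two in auto)
  next
    case 2 then show ?thesis by (rule Mids_E) auto
  next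
    case 3 then show ?thesis using cutv_facts[OF 3(1)] alpha_two by blast
  qed
qed

lemma T1_facts: "T0 \<subseteq> S" "T1 \<subseteq> S" "T0 \<inter> C = {}" "T1 \<inter> C = {v 0}" "v 0 \<notin> T0" "v 0 \<in> T1" "T0 \<subseteq> T1" "T1 \<inter> (Offs \<union> Mids \<union> Ts) = {}"
  "Ys \<inter> C = {}" "Ys \<inter> T0 = {}"
proof -
  have v0: "v 0 \<in> S" "v 0 \<in> C" using vS[of 0] vC[of 0] n3 by auto
  have Ysd: "\<forall>u \<in> Ys. u \<in> S \<and> u \<notin> C \<and> d u \<noteq> 2" unfolding Ys_def using o0N(2) by (auto simp: ext_def)
  show "T0 \<subseteq> S" "T0 \<inter> C = {}" "Ys \<inter> T0 = {}" unfolding T0_def by blast+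
  show "v 0 \<notin> T0" using v0 unfolding T0_def by blast
  show "Ys \<inter> C = {}" using Ysd by blast
  show "v 0 \<in> T1" "T0 \<subseteq> T1" unfolding T1_def by blast+
  show "T1 \<subseteq> S" unfolding T1_def T0_def using v0 Ysd by blast
  show "T1 \<inter> C = {v 0}" unfolding T1_def T0_def using v0 Ysd by blast
  have "d (v 0) \<noteq> 2" using deg3(1)[OF bad0] by simp
  then show "T1 \<inter> (Offs \<union> Mids \<union> Ts) = {}" unfolding T1_def T0_def using degs_off Ysd by blast
qed

lemma start:
  obtains \<psi> where "good 1 T1 \<psi>" "\<psi> (v 0) = 0" "\<forall>u \<in> Ys. \<psi> u = 0" "o0 \<in> T1 \<Longrightarrow> \<psi> o0 = 0"
    "\<And>s. ext \<Longrightarrow> s \<in> N o0 \<Longrightarrow> s \<in> T1 \<Longrightarrow> \<psi> s = 0"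
proof -
  define D where "D = S \<inter> (C \<union> Offs \<union> Mids \<union> Ys \<union> Ts)"
  have v0: "v 0 \<in> D" "D \<subseteq> S" "S - D = T0" unfolding D_def T0_def using vS[of 0] vC[of 0] n3 by auto
  obtain \<phi> where n: "normal 1 T0 \<phi>" and g: "good 1 T0 \<phi>" and fin: "finite T0"
    using partial[OF v0(1,2)] unfolding v0(3) by blast
  note T = T1_facts
  have pend: "\<phi> s = 0" if s: "s \<in> T0" "d s = 2" "p \<in> N s" "p \<notin> T0" for s p
  proof (rule normal_pendant[OF n fin s(1)])
    show "card (nb T0 s) \<le> 1" using card_nb_le[OF T(1), of "{p}" s] s by auto
  qed
  have nC: "v (n - 1) \<in> C" "v 1 \<in> C" using vC n3 by auto
  show thesis
  proof (cases ext)
    case True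
    obtain s where s: "N o0 = {cutv, s, v 0}" "alpha cutv" "d s = 2" "cutv \<noteq> s" using cutv[OF True] by blast
    have Ys: "Ys = {o0}" "Ts = {cutv}" using True unfolding Ys_def Ts_def by auto
    have oT: "o0 \<notin> T0" "cutv \<notin> T0" using Ys unfolding T0_def by blast+
    have nbo: "nb T0 o0 \<subseteq> {s}" using nb_Int[OF s(1) T(1)] oT T(5) by auto
    have "\<exists>\<psi>. good 1 (insert o0 T0) \<psi> \<and> \<psi> o0 = 0 \<and> (\<forall>u \<in> T0. \<psi> u = \<phi> u)"
      by (rule add_forest_leaf[OF g fin oT(1)]) (use nbo in blast)
    then obtain \<psi> where \<psi>: "good 1 (insert o0 T0) \<psi>" "\<psi> o0 = 0" "\<forall>u \<in> T0. \<psi> u = \<phi> u" by blast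
    have vo: "v 0 \<notin> insert o0 T0" using T(5) irrefl o0N(3) by auto
    have oS: "insert o0 T0 \<subseteq> S" using T(1) o0N(2) by blast
    have nbv: "nb (insert o0 T0) (v 0) \<subseteq> {o0}" unfolding nb_Int[OF o0(1) oS] using nC T(3) o0(2,3) by blast
    have "\<exists>\<psi>'. good 1 (insert (v 0) (insert o0 T0)) \<psi>' \<and> \<psi>' (v 0) = 0 \<and> (\<forall>u \<in> insert o0 T0. \<psi>' u = \<psi> u)"
      by (rule add_forest_leaf[OF \<psi>(1) _ vo]) (use nbv fin in blast)+
    then obtain \<psi>' where \<psi>': "good 1 (insert (v 0) (insert o0 T0)) \<psi>'" "\<psi>' (v 0) = 0" "\<forall>u \<in> insert o0 T0. \<psi>' u = \<psi> u"
      by blast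
    have T1: "insert (v 0) (insert o0 T0) = T1" unfolding T1_def Ys by blast
    have o0': "\<psi>' o0 = 0" using \<psi>'(3) \<psi>(2) by simp
    have s0: "\<psi>' s' = 0" if "s' \<in> N o0" "s' \<in> T1" for s'
    proof -
      have "s' \<notin> Ts" using that(2) T(8) by blast
      moreover have "s' \<in> {cutv, s, v 0}" using that(1) unfolding s(1) .
      ultimately consider "s' = s" | "s' = v 0" unfolding Ys(2) by blast
      then show ?thesis
      proof cases
        case 1
        have "s \<noteq> v 0" "s \<noteq> o0" using s(3) deg3(1)[OF bad0] that(1) 1 irrefl by auto
        then have sT: "s \<in> T0" using that(2) 1 unfolding T1_def Ys(1) by blast
        have "o0 \<in> N s" using N_sym[OF o0N(2)] s(1) by blast
        then have "\<phi> s = 0" by (rule pend[OF sT s(3) _ oT(1)])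
        then show ?thesis using 1 \<psi>'(3) \<psi>(3) sT by simp
      qed (use \<psi>'(2) in simp)
    qed
    show thesis by (rule that[of \<psi>']) (use \<psi>'(1,2) T1 o0' Ys(1) s0 in simp_all)
  next
    case False
    have Ys: "Ys = {}" unfolding Ys_def using False by simp
    have nbv: "nb T0 (v 0) \<subseteq> {o0}" unfolding nb_Int[OF o0(1) T(1)] using nC T(3) by blast
    have "\<exists>\<psi>'. good 1 (insert (v 0) T0) \<psi>' \<and> \<psi>' (v 0) = 0 \<and> (\<forall>u \<in> T0. \<psi>' u = \<phi> u)"
      by (rule add_forest_leaf[OF g fin T(5)]) (use nbv in blast)
    then obtain \<psi>' where \<psi>': "good 1 (insert (v 0) T0) \<psi>'" "\<psi>' (v 0) = 0" "\<forall>u \<in> T0. \<psi>' u = \<phi> u"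
      by blast
    have T1: "insert (v 0) T0 = T1" unfolding T1_def Ys by simp
    have "\<psi>' o0 = 0" if "o0 \<in> T1"
    proof -
      have "o0 \<noteq> v 0" using o0N(3) irrefl by auto
      then have oT: "o0 \<in> T0" using that T1 by blast
      then have "o0 \<notin> C" using T(3) by blast
      then have "d o0 = 2" using False W_cases[OF o0N(5)] unfolding ext_def by auto
      then have "\<phi> o0 = 0" using pend[OF oT _ o0N(4) T(5)] by blast
      then show ?thesis using \<psi>'(3) oT by simp
    qed
    then show thesis by (intro that[of \<psi>']) (use \<psi>'(1,2) T1 Ys False in auto)
  qed
qed

definition needs_cut :: "nat \<Rightarrow> bool" where
  "needs_cut i \<longleftrightarrow> alpha (v (Suc i)) \<and> bad (v i) \<and> 3 \<le> d (off i)"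

definition opp :: "nat \<Rightarrow> 'a" where "opp i = far (v (Suc i)) (off (Suc i))"

definition Tk :: "nat \<Rightarrow> 'a set" where "Tk k = T1 \<union> v ` {k..<n}"

text \<open>The cycle is coloured downwards from \<open>v n = v 0\<close>. Colour 1 is used only where colour 0 could
  close a cycle of the forest, through the edge leaving the cycle at the next vertex to be coloured or
  through the third neighbour of a \<open>triple\<close> vertex.\<close>

definition Inv :: "('a \<Rightarrow> nat) \<Rightarrow> nat \<Rightarrow> ('a \<Rightarrow> nat) \<Rightarrow> bool" where
  "Inv \<psi>0 k \<psi> \<longleftrightarrow> good 1 (Tk k) \<psi> \<and> (\<forall>u \<in> T1. \<psi> u = \<psi>0 u) \<and>
     (\<forall>j. k \<le> Suc j \<and> Suc j < n \<and> \<psi> (v (Suc j)) = 1 \<longrightarrow> triple (v (Suc j)) \<or> needs_cut j) \<and>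
     (\<forall>j. k = Suc j \<and> k < n \<and> needs_cut j \<and> off j \<in> Tk k \<longrightarrow> \<psi> (v k) \<noteq> \<psi> (off j)) \<and>
     (\<forall>j. k \<le> Suc j \<and> Suc j < n \<and> triple (v (Suc j)) \<and> opp j \<in> Tk k \<longrightarrow> \<psi> (v (Suc j)) \<noteq> \<psi> (opp j))"

lemma Tk_S: "1 \<le> k \<Longrightarrow> Tk k \<subseteq> S"
  unfolding Tk_def using T1_facts(2) vS by auto

lemma v_in_Tk: "k \<le> i \<Longrightarrow> i \<le> n \<Longrightarrow> v i \<in> Tk k"
  unfolding Tk_def using T1_facts(6) vn by (cases "i = n") auto

lemma v_notin_Tk: "1 \<le> i \<Longrightarrow> i < k \<Longrightarrow> i < n \<Longrightarrow> v i \<notin> Tk k"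
proof
  assume i: "1 \<le> i" "i < k" "i < n" and m: "v i \<in> Tk k"
  then consider "v i \<in> T1" | j where "k \<le> j" "j < n" "v i = v j" unfolding Tk_def by auto
  then show False
  proof cases
    case 1
    then have "v i = v 0" using T1_facts(4) vC[of i] i(3) by auto
    then show False using v_eq[of i 0] i by simp
  next
    case 2
    then show False using v_eq[OF i(3) 2(2)] i(2) by simp
  qed
qed

lemma Tk_C: "x \<in> Tk k \<Longrightarrow> x \<in> T1 \<or> x \<in> C"
  unfolding Tk_def C_def by auto

lemma extra_notin_Tk: "x \<in> Offs \<union> Mids \<union> Ts \<Longrightarrow> x \<notin> Tk k"
  using T1_facts(8) degs_off Tk_C by blast

lemma Tk_Suc: "Suc i < n \<Longrightarrow> insert (v (Suc i)) (Tk (Suc (Suc i))) = Tk (Suc i)"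
proof -
  assume "Suc i < n"
  then have "{Suc i..<n} = insert (Suc i) {Suc (Suc i)..<n}" by auto
  then show ?thesis unfolding Tk_def by auto
qed

lemma opp: assumes "Suc i < n" "triple (v (Suc i))"
  shows "off (Suc i) \<in> N (v (Suc i))" "d (off (Suc i)) = 2" "\<not> alpha (off (Suc i))" "off (Suc i) \<notin> C"
    "N (off (Suc i)) = {v (Suc i), opp i}" "opp i \<noteq> v (Suc i)" "d (opp i) \<noteq> 2" "off (Suc i) \<in> Mids"
    "off (Suc i) \<in> N (opp i)" "opp i \<in> S"
proof -
  show m: "off (Suc i) \<in> N (v (Suc i))" using off(1)[OF assms(1) deg3(3)[OF assms(2)]] by blast
  show t: "d (off (Suc i)) = 2" "\<not> alpha (off (Suc i))" using triple_nb[OF assms(2) m] by blast+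
  show "off (Suc i) \<notin> C" by (rule off_notin_C[OF assms(1) deg3(3)[OF assms(2)] t(1)])
  note f = far_in[OF vS[OF assms(1)] m t(1), folded opp_def]
  show "N (off (Suc i)) = {v (Suc i), opp i}" "opp i \<noteq> v (Suc i)" "opp i \<in> S" by (fact f)+
  then show "d (opp i) \<noteq> 2" using nonalpha_nb[OF t, of "opp i"] by blast
  show "off (Suc i) \<in> N (opp i)" using f(4,6) by simp
  show "off (Suc i) \<in> Mids" unfolding Mids_def using assms by blast
qed

lemma opp_cycle: assumes j: "Suc j < n" "triple (v (Suc j))" and i: "Suc i < n" "opp j = v (Suc i)"
  shows "triple (v (Suc i))" "opp i = v (Suc j)"
proof -
  note o = opp[OF j]
  have m: "off (Suc j) \<in> N (v (Suc i))" using o(9) unfolding i(2) .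
  have d3: "d (v (Suc i)) = 3" "bad (v (Suc i)) \<or> weak (v (Suc i)) \<or> triple (v (Suc i))"
    using W_cases[OF vW[OF i(1)]] o(7) i(2) by auto
  note c = off[OF i(1) d3(1)]
  have "off (Suc j) \<noteq> v i" "off (Suc j) \<noteq> v (Suc (Suc i))" using o(4) vC[of i] vC[of "Suc (Suc i)"] i(1) by auto
  then have eq: "off (Suc j) = off (Suc i)" using m unfolding c(1) by blast
  have "\<not> bad (v (Suc i))" using bad_nb[OF _ m] o(2,3) by auto
  moreover have "\<not> weak (v (Suc i))"
  proof
    assume w: "weak (v (Suc i))"
    then obtain a where a: "a \<in> N (v (Suc i))" "alpha a" unfolding weak_def by blast
    have "a \<notin> W" by (rule weak_alpha[OF w a])
    then have "a \<noteq> v i" "a \<noteq> v (Suc (Suc i))" using vW[of i] vW[of "Suc (Suc i)"] vW[of 0] vn i(1)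
      by (auto, cases "Suc (Suc i) = n", auto)
    then have "a = off (Suc i)" using a(1) unfolding c(1) by blast
    then show False using a(2) eq o(3) by simp
  qed
  ultimately show t: "triple (v (Suc i))" using d3(2) by blast
  have "N (off (Suc i)) = {v (Suc i), v (Suc j)}" using o(5) unfolding i(2) eq by blast
  moreover have "v (Suc i) \<noteq> v (Suc j)" using o(6) i(2) by simp
  ultimately show "opp i = v (Suc j)" unfolding opp_def using far_eq opp(2)[OF i(1) t] by blast
qed

lemma off_real_ne: "Suc i < n \<Longrightarrow> needs_cut i \<Longrightarrow> off i \<noteq> v (Suc i)"
  using alpha_two unfolding needs_cut_def by force

lemma Inv_step:
  assumes inv: "Inv \<psi>0 (Suc (Suc i)) \<psi>" and i: "Suc i < n"
    and g: "good 1 (Tk (Suc i)) \<psi>'" and agree: "\<forall>u \<in> Tk (Suc (Suc i)). \<psi>' u = \<psi> u"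
    and q1: "\<psi>' (v (Suc i)) = 1 \<Longrightarrow> triple (v (Suc i)) \<or> needs_cut i"
    and q2: "needs_cut i \<Longrightarrow> off i \<in> Tk (Suc (Suc i)) \<Longrightarrow> \<psi>' (v (Suc i)) \<noteq> \<psi> (off i)"
    and q3: "triple (v (Suc i)) \<Longrightarrow> opp i \<in> Tk (Suc (Suc i)) \<Longrightarrow> \<psi>' (v (Suc i)) \<noteq> \<psi> (opp i)"
  shows "Inv \<psi>0 (Suc i) \<psi>'"
proof -
  let ?c = "v (Suc i)"
  let ?T = "Tk (Suc (Suc i))"
  have T: "Tk (Suc i) = insert ?c ?T" using Tk_Suc[OF i] by simp
  have old: "\<psi>' (v (Suc j)) = \<psi> (v (Suc j))" if "Suc (Suc i) \<le> Suc j" "Suc j < n" for j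
    using agree v_in_Tk[of "Suc (Suc i)" "Suc j"] that by simp
  note I = inv[unfolded Inv_def]
  have p1: "triple (v (Suc j)) \<or> needs_cut j" if "Suc i \<le> Suc j" "Suc j < n" "\<psi>' (v (Suc j)) = 1" for j
  proof (cases "j = i")
    case False
    then have "Suc (Suc i) \<le> Suc j" using that(1) by simp
    then show ?thesis using I old[of j] that by auto
  qed (use q1 that in blast)
  have p2: "\<psi>' ?c \<noteq> \<psi>' (off i)" if "needs_cut i" "off i \<in> Tk (Suc i)"
  proof -
    have "off i \<in> ?T" using that(2) off_real_ne[OF i that(1)] unfolding T by blast
    then show ?thesis using q2[OF that(1)] agree by simp
  qed
  have p3: "\<psi>' (v (Suc j)) \<noteq> \<psi>' (opp j)"
    if j: "Suc i \<le> Suc j" "Suc j < n" "triple (v (Suc j))" "opp j \<in> Tk (Suc i)" for j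
  proof (cases "j = i")
    case True
    then have "opp i \<in> ?T" using j(3,4) opp(6)[OF i] unfolding T by auto
    then show ?thesis using q3 j(3) True agree by simp
  next
    case False
    then have sj: "Suc (Suc i) \<le> Suc j" using j(1) by simp
    show ?thesis
    proof (cases "opp j = ?c")
      case True
      have "triple ?c" "opp i = v (Suc j)" by (rule opp_cycle[OF j(2,3) i True])+
      moreover have "v (Suc j) \<in> ?T" using v_in_Tk[OF sj] j(2) by simp
      ultimately have "\<psi>' ?c \<noteq> \<psi> (v (Suc j))" using q3 by simp
      then show ?thesis using True old[OF sj j(2)] by simp
    next
      case False
      then have "opp j \<in> ?T" using j(4) unfolding T by blast
      then have "\<psi> (v (Suc j)) \<noteq> \<psi> (opp j)" using I sj j(2,3) by blast
      then show ?thesis using old[OF sj j(2)] agree \<open>opp j \<in> ?T\<close> by simp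
    qed
  qed
  have "\<forall>u \<in> T1. \<psi>' u = \<psi>0 u" using I agree unfolding Tk_def by auto
  then show ?thesis unfolding Inv_def using g p1 p2 p3 by auto
qed

lemma le_one: "good 1 T \<psi> \<Longrightarrow> u \<in> T \<Longrightarrow> \<psi> u \<noteq> 1 \<Longrightarrow> \<psi> u = 0"
  using good_le[of 1 T \<psi> u] by simp

lemma Inv_zero:
  assumes inv: "Inv \<psi>0 k \<psi>" and z: "\<psi>0 (v 0) = 0" and k: "1 \<le> k" "k \<le> i" "i \<le> n" and bw: "bad (v i) \<or> weak (v i)"
  shows "\<psi> (v i) = 0"
proof (cases "i = n")
  case True
  then show ?thesis using inv z vn T1_facts(6) unfolding Inv_def by simp
next
  case False
  then obtain j where j: "i = Suc j" "Suc j < n" using k by (cases i) auto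
  have "\<not> triple (v (Suc j))" using bw bad_not_triple weak_not_triple j by blast
  moreover have "\<not> needs_cut j" using bw deg3 alpha_two j(1) unfolding needs_cut_def by force
  ultimately have "\<psi> (v (Suc j)) \<noteq> 1" using inv k(2) j unfolding Inv_def by blast
  moreover have "v (Suc j) \<in> Tk k" using v_in_Tk k j by blast
  moreover have "good 1 (Tk k) \<psi>" using inv unfolding Inv_def by blast
  ultimately show ?thesis using le_one[of "Tk k" \<psi> "v (Suc j)"] j(1) by simp
qed

lemma nb_Tk:
  assumes "1 \<le> i" "Suc i < n"
  shows "d (v (Suc i)) = 2 \<Longrightarrow> nb (Tk (Suc (Suc i))) (v (Suc i)) = {v (Suc (Suc i))}"
    "d (v (Suc i)) = 3 \<Longrightarrow> nb (Tk (Suc (Suc i))) (v (Suc i)) =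
      insert (v (Suc (Suc i))) ({off (Suc i)} \<inter> Tk (Suc (Suc i)))"
proof -
  have T: "Tk (Suc (Suc i)) \<subseteq> S" by (rule Tk_S) simp
  have vi: "v i \<notin> Tk (Suc (Suc i))" by (rule v_notin_Tk) (use assms in simp_all)
  have nx: "v (Suc (Suc i)) \<in> Tk (Suc (Suc i))" by (rule v_in_Tk) (use assms in simp_all)
  show "d (v (Suc i)) = 2 \<Longrightarrow> nb (Tk (Suc (Suc i))) (v (Suc i)) = {v (Suc (Suc i))}"
    unfolding nb_Int[OF two_nb[OF assms(2)] T] using vi nx by blast
  show "nb (Tk (Suc (Suc i))) (v (Suc i)) = insert (v (Suc (Suc i))) ({off (Suc i)} \<inter> Tk (Suc (Suc i)))"
    if "d (v (Suc i)) = 3"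
    unfolding nb_Int[OF off(1)[OF assms(2) that] T] using vi nx by blast
qed

lemma next_two:
  assumes i: "Suc i < n" and d2: "d (v (Suc (Suc i))) = 2"
  shows "Suc (Suc i) < n" "N (v (Suc (Suc i))) = {v (Suc i), v (Suc (Suc (Suc i)))}"
proof -
  have "v (Suc (Suc i)) \<noteq> v 0" using d2 deg3(1)[OF bad0] by auto
  then show lt: "Suc (Suc i) < n" using i vn by (cases "Suc (Suc i) = n") auto
  show "N (v (Suc (Suc i))) = {v (Suc i), v (Suc (Suc (Suc i)))}" by (rule two_nb[OF lt d2])
qed

lemma free_next:
  assumes inv: "Inv \<psi>0 (Suc (Suc i)) \<psi>" and z: "\<psi>0 (v 0) = 0" and i: "Suc i < n"
    and d2: "d (v (Suc (Suc i))) = 2" and nc: "\<not> needs_cut (Suc i)"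
    and bw: "bad (v (Suc (Suc (Suc i)))) \<or> weak (v (Suc (Suc (Suc i))))"
  shows "free (Tk (Suc (Suc i))) \<psi> (v (Suc (Suc i))) 1"
proof -
  note nx = next_two[OF i d2]
  let ?T = "Tk (Suc (Suc i))"
  have "\<not> triple (v (Suc (Suc i)))" using deg3(3) d2 by force
  then have "\<psi> (v (Suc (Suc i))) \<noteq> 1" using inv nc nx(1) unfolding Inv_def by blast
  moreover have "\<psi> (v (Suc (Suc (Suc i)))) = 0" by (rule Inv_zero[OF inv z]) (use nx(1) bw in simp_all)
  moreover have "nb ?T (v (Suc (Suc i))) \<subseteq> {v (Suc (Suc (Suc i)))}"
  proof -
    have "v (Suc i) \<notin> ?T" by (rule v_notin_Tk) (use i in simp_all)
    then show ?thesis unfolding nb_Int[OF nx(2) Tk_S[of "Suc (Suc i)", simplified]] by blast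
  qed
  ultimately show ?thesis unfolding free_def by auto
qed

lemma loop_step:
  assumes inv: "Inv \<psi>0 (Suc (Suc i)) \<psi>" and z: "\<psi>0 (v 0) = 0" and i: "1 \<le> i" "Suc i < n"
  shows "\<exists>\<psi>'. Inv \<psi>0 (Suc i) \<psi>'"
proof -
  let ?c = "v (Suc i)" and ?nx = "v (Suc (Suc i))"
  define T where "T = Tk (Suc (Suc i))"
  have g: "good 1 T \<psi>" using inv unfolding Inv_def T_def by blast
  have cT: "?c \<notin> T" unfolding T_def by (rule v_notin_Tk) (use i in simp_all)
  have TS: "T \<subseteq> S" unfolding T_def by (rule Tk_S) simp
  have fin: "finite T" using TS finS finite_subset by blast
  have nxT: "?nx \<in> T" unfolding T_def by (rule v_in_Tk) (use i in simp_all)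
  have Tc: "insert ?c T = Tk (Suc i)" unfolding T_def by (rule Tk_Suc[OF i(2)])
  have zero: "\<exists>\<psi>'. Inv \<psi>0 (Suc i) \<psi>'"
    if leaf: "\<forall>u \<in> nb T ?c. \<forall>u' \<in> nb T ?c. \<psi> u = \<psi> u' \<longrightarrow> u = u'"
      and q2: "needs_cut i \<Longrightarrow> off i \<in> T \<Longrightarrow> \<psi> (off i) \<noteq> 0"
      and q3: "triple ?c \<Longrightarrow> opp i \<in> T \<Longrightarrow> \<psi> (opp i) \<noteq> 0"
  proof -
    obtain \<psi>' where \<psi>': "good 1 (insert ?c T) \<psi>'" "\<psi>' ?c = 0" "\<forall>u \<in> T. \<psi>' u = \<psi> u"
      using add_forest_leaf[OF g fin cT leaf] by blast
    have "Inv \<psi>0 (Suc i) \<psi>'"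
    proof (rule Inv_step[OF inv i(2)])
      show "good 1 (Tk (Suc i)) \<psi>'" using \<psi>'(1) unfolding Tc .
      show "\<forall>u \<in> Tk (Suc (Suc i)). \<psi>' u = \<psi> u" using \<psi>'(3) unfolding T_def .
      show "triple ?c \<or> needs_cut i" if "\<psi>' ?c = 1" using that \<psi>'(2) by simp
      show "\<psi>' ?c \<noteq> \<psi> (off i)" if "needs_cut i" "off i \<in> Tk (Suc (Suc i))"
        using q2[OF that(1)] that(2) \<psi>'(2) unfolding T_def by simp
      show "\<psi>' ?c \<noteq> \<psi> (opp i)" if "triple ?c" "opp i \<in> Tk (Suc (Suc i))"
        using q3[OF that(1)] that(2) \<psi>'(2) unfolding T_def by simp
    qed
    then show ?thesis by blast
  qed
  have one: "\<exists>\<psi>'. Inv \<psi>0 (Suc i) \<psi>'"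
    if nb: "nb T ?c = {?nx}" and fr: "free T \<psi> ?nx 1" and q1: "triple ?c \<or> needs_cut i"
      and q2: "needs_cut i \<Longrightarrow> off i \<in> T \<Longrightarrow> \<psi> (off i) \<noteq> 1"
      and q3: "triple ?c \<Longrightarrow> opp i \<in> T \<Longrightarrow> \<psi> (opp i) \<noteq> 1"
  proof -
    have "\<exists>\<psi>'. good 1 (insert ?c T) \<psi>' \<and> \<psi>' ?c = 1 \<and> (\<forall>u \<in> T. \<psi>' u = \<psi> u)"
      by (rule add_coloured_vertex[OF g cT]) (simp_all add: nb fr[simplified])
    then obtain \<psi>' where \<psi>': "good 1 (insert ?c T) \<psi>'" "\<psi>' ?c = 1" "\<forall>u \<in> T. \<psi>' u = \<psi> u" by blast
    have "Inv \<psi>0 (Suc i) \<psi>'"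
    proof (rule Inv_step[OF inv i(2)])
      show "good 1 (Tk (Suc i)) \<psi>'" using \<psi>'(1) unfolding Tc .
      show "\<forall>u \<in> Tk (Suc (Suc i)). \<psi>' u = \<psi> u" using \<psi>'(3) unfolding T_def .
      show "triple ?c \<or> needs_cut i" by (rule q1)
      show "\<psi>' ?c \<noteq> \<psi> (off i)" if "needs_cut i" "off i \<in> Tk (Suc (Suc i))"
        using q2[OF that(1)] that(2) \<psi>'(2) unfolding T_def by simp
      show "\<psi>' ?c \<noteq> \<psi> (opp i)" if "triple ?c" "opp i \<in> Tk (Suc (Suc i))"
        using q3[OF that(1)] that(2) \<psi>'(2) unfolding T_def by simp
    qed
    then show ?thesis by blast
  qed
  consider "d ?c = 2" "link ?c" | "d ?c = 3" "bad ?c \<or> weak ?c" | "d ?c = 3" "triple ?c"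
    using W_cases[OF vW[OF i(2)]] by blast
  then show ?thesis
  proof cases
    case 1
    have nb: "nb T ?c = {?nx}" unfolding T_def by (rule nb_Tk(1)[OF i 1(1)])
    have nt: "\<not> triple ?c" using 1(1) deg3(3) by force
    show ?thesis
    proof (cases "needs_cut i \<and> \<not> (off i \<in> T \<and> \<psi> (off i) = 1)")
      case True
      have ac: "alpha ?c" "bad (v i)" using True unfolding needs_cut_def by blast+
      have nxN: "?nx \<in> N ?c" by (rule cyc_nb(2)[OF i(2)])
      have "d ?nx = 2"
      proof -
        obtain u' where u': "N ?c = {v i, u'}" "d u' = 2"
          using alpha_nbs[OF ac(1) vS[OF i(2)] cyc_nb(1)[OF i(2)]] deg3(1)[OF ac(2)] by auto
        have "?nx \<in> {v i, u'}" using nxN unfolding u'(1) .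
        then show ?thesis using u'(2) v_ne[OF i(2)] by auto
      qed
      then have nx2: "d ?nx = 2" .
      note nx = next_two[OF i(2) nx2]
      have "bad (far ?c ?nx)" by (rule link_alpha(2)[OF 1(2) ac(1) nxN nx2])
      moreover have "far ?c ?nx = v (Suc (Suc (Suc i)))"
        by (rule far_eq[OF nx2 nx(2)]) (rule v_ne[OF nx(1)])
      ultimately have b: "bad (v (Suc (Suc (Suc i))))" by simp
      have nnc: "\<not> needs_cut (Suc i)" using 1(1) deg3(1) unfolding needs_cut_def by force
      have "free T \<psi> ?nx 1" unfolding T_def by (rule free_next[OF inv z i(2) nx2 nnc]) (use b in blast)
      then show ?thesis by (rule one[OF nb]) (use True nt in auto)
    next
      case False
      then show ?thesis by (intro zero) (use nb nt in auto)
    qed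
  next
    case 2
    have nb: "nb T ?c = insert ?nx ({off (Suc i)} \<inter> T)" unfolding T_def by (rule nb_Tk(2)[OF i 2(1)])
    have nt: "\<not> triple ?c" using 2(2) bad_not_triple weak_not_triple by blast
    have nnc: "\<not> needs_cut i" using 2(1) alpha_two unfolding needs_cut_def by force
    note o = off[OF i(2) 2(1)]
    show ?thesis
    proof (cases "off (Suc i) \<in> T")
      case False
      then show ?thesis by (intro zero) (use nb nt nnc in auto)
    next
      case True
      have na: "\<not> alpha (off (Suc i))"
      proof
        assume "alpha (off (Suc i))"
        then have "off (Suc i) \<in> Offs" unfolding Offs_def using i(2) 2(1) by blast
        then show False using extra_notin_Tk True unfolding T_def by blast
      qed
      have oN: "off (Suc i) \<in> N ?c" using o(1) by blast
      have b: "bad ?c"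
      proof (rule ccontr)
        assume "\<not> bad ?c"
        then have w: "weak ?c" using 2(2) by blast
        then obtain a where a: "a \<in> N ?c" "alpha a" unfolding weak_def by blast
        have "a \<notin> W" by (rule weak_alpha[OF w a])
        then have "a \<noteq> v i" "a \<noteq> ?nx" using vW[of i] vW[of "Suc (Suc i)"] vW[of 0] vn i(2)
          by (auto, cases "Suc (Suc i) = n", auto)
        then have "a = off (Suc i)" using a(1) unfolding o(1) by blast
        then show False using a(2) na by simp
      qed
      have d3: "3 \<le> d (off (Suc i))" using bad_nb[OF b oN] na by blast
      have an: "alpha ?nx" using bad_real[OF b o(1) d3] by blast
      have lt: "Suc (Suc i) < n" by (rule next_two(1)[OF i(2) alpha_two[OF an]])
      have "needs_cut (Suc i)" unfolding needs_cut_def using an b d3 by blast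
      then have "\<psi> ?nx \<noteq> \<psi> (off (Suc i))" using inv lt True unfolding Inv_def T_def by blast
      then show ?thesis by (intro zero) (use nb nt nnc in auto)
    qed
  next
    case 3
    note o = opp[OF i(2) 3(2)]
    have nnc: "\<not> needs_cut i" using 3(1) alpha_two unfolding needs_cut_def by force
    have oT: "off (Suc i) \<notin> T" unfolding T_def using extra_notin_Tk o(8) by blast
    have nb: "nb T ?c = {?nx}" using nb_Tk(2)[OF i 3(1)] oT unfolding T_def by simp
    show ?thesis
    proof (cases "opp i \<in> T \<and> \<psi> (opp i) = 1")
      case True
      then show ?thesis by (intro zero) (use nb nnc in auto)
    next
      case False
      have nxN: "?nx \<in> N ?c" by (rule cyc_nb(2)[OF i(2)])
      have nx2: "d ?nx = 2" "\<not> alpha ?nx" using triple_nb[OF 3(2) nxN] by blast+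
      note nx = next_two[OF i(2) nx2(1)]
      have l: "link ?nx" using W_cases[OF vW[OF nx(1)]] nx2(1) by auto
      have "weak (v (Suc (Suc (Suc i))))"
        by (rule link_nonalpha(2)[OF l nx2(2) _ 3(2)]) (use nx(2) v_ne[OF nx(1)] in \<open>simp_all del: in_nb\<close>)
      moreover have "\<not> needs_cut (Suc i)" using nx2(2) unfolding needs_cut_def by blast
      ultimately have "free T \<psi> ?nx 1" unfolding T_def by (intro free_next[OF inv z i(2) nx2(1)]) blast+
      then show ?thesis by (rule one[OF nb]) (use False 3(2) nnc in auto)
    qed
  qed
qed

lemma loop:
  assumes "Inv \<psi>0 n \<psi>" "\<psi>0 (v 0) = 0"
  shows "\<exists>\<psi>'. Inv \<psi>0 2 \<psi>'"
proof -
  have "\<exists>\<psi>'. Inv \<psi>0 (n - k) \<psi>'" if "k \<le> n - 2" for k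
    using that
  proof (induction k)
    case 0
    then show ?case using assms(1) by auto
  next
    case (Suc k)
    then obtain \<psi>' where inv: "Inv \<psi>0 (n - k) \<psi>'" by auto
    obtain i where i: "n - k = Suc (Suc i)" "n - Suc k = Suc i" "1 \<le> i" "Suc i < n"
    proof -
      have "n - k = Suc (Suc (n - k - 2))" "n - Suc k = Suc (n - k - 2)" "1 \<le> n - k - 2" "Suc (n - k - 2) < n"
        using Suc(2) by linarith+
      then show thesis using that by blast
    qed
    have "Inv \<psi>0 (Suc (Suc i)) \<psi>'" using inv unfolding i(1) .
    from loop_step[OF this assms(2) i(3,4)] show ?case unfolding i(2) .
  qed
  from this[of "n - 2"] show ?thesis using n3 by simp
qed

lemma not_one_before:
  assumes inv: "Inv \<psi>0 2 \<psi>" and i: "2 \<le> i" "i < n" and d3: "d (v (Suc i)) = 3"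
  shows "\<psi> (v i) \<noteq> 1"
proof
  assume 1: "\<psi> (v i) = 1"
  obtain j where j: "i = Suc j" using i by (cases i) auto
  have S: "v (Suc i) \<in> N (v i)" using cyc_nb(2)[of j] i j by simp
  consider "triple (v i)" | "needs_cut j" using inv 1 i j unfolding Inv_def by blast
  then show False
  proof cases
    case 1
    then show False using triple_nb[OF 1 S] d3 by simp
  next
    case 2
    then have a: "alpha (v i)" "d (v j) = 3" unfolding needs_cut_def j using deg3 by auto
    have "v j = v (Suc i)"
      by (rule alpha_unique[OF a(1) vS[OF i(2)] _ S a(2) d3]) (use cyc_nb(1)[of j] i j in simp)
    then show False using v_ne[of j] i j by simp
  qed
qed

lemma start_edge:
  assumes inv: "Inv \<psi>0 2 \<psi>" and z: "\<psi>0 (v 0) = 0" and o: "o0 \<in> T1 \<Longrightarrow> \<psi>0 o0 = 0"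
  shows "\<exists>\<psi>'. good 1 (Tk 1) \<psi>' \<and> \<psi>' (v 1) = 1 \<and> (\<forall>u \<in> Tk 2. \<psi>' u = \<psi> u)" "d (v 2) = 2" "2 < n"
proof -
  have n1: "Suc 0 < n" and n2: "Suc (Suc 0) = 2" using n3 by auto
  have a1: "alpha (v (Suc 0))" using alpha1 by simp
  note N1 = two_nb[OF n1 alpha_two[OF a1]]
  have d2: "d (v (Suc (Suc 0))) = 2"
    using alpha_nbs[OF a1 vS[OF n1] cyc_nb(1)[OF n1]] deg3(1)[OF bad0] cyc_nb(2)[OF n1] v_ne[OF n1]
    by (auto simp del: in_nb)
  then show "d (v 2) = 2" unfolding n2 .
  note nx = next_two[OF n1 d2]
  show "2 < n" using nx(1) by simp
  have "bad (far (v (Suc 0)) (v (Suc (Suc 0))))"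
  proof (rule link_alpha(2)[OF _ a1 cyc_nb(2)[OF n1] d2])
    show "link (v (Suc 0))" using W_cases[OF vW[OF n1]] alpha_two[OF a1] by auto
  qed
  moreover have "far (v (Suc 0)) (v (Suc (Suc 0))) = v (Suc (Suc (Suc 0)))"
    by (rule far_eq[OF d2 nx(2)]) (rule v_ne[OF nx(1)])
  ultimately have b: "bad (v (Suc (Suc (Suc 0))))" by simp
  have nnc: "\<not> needs_cut (Suc 0)" using alpha_two[OF a1] deg3(1) unfolding needs_cut_def by force
  have f2: "free (Tk 2) \<psi> (v 2) 1" using free_next[OF inv[folded n2] z n1 d2 nnc] b unfolding n2 by blast
  have g: "good 1 (Tk 2) \<psi>" using inv unfolding Inv_def by blast
  have v0: "\<psi> (v 0) = 0" using inv z T1_facts(6) unfolding Inv_def by simp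
  have nS: "Suc (n - 2) < n" "Suc (Suc (n - 2)) = n" "Suc (n - 2) = n - 1" using n3 by auto
  have vn1: "\<psi> (v (n - 1)) \<noteq> 1"
    by (rule not_one_before[OF inv]) (use n3 vn deg3(1)[OF bad0] in simp_all)
  have v1: "v 1 \<notin> Tk 2" by (rule v_notin_Tk) (use n3 in simp_all)
  have o1: "\<psi> o0 \<noteq> 1" if oT: "o0 \<in> Tk 2"
  proof (cases "o0 \<in> T1")
    case True
    then show ?thesis using o inv unfolding Inv_def by simp
  next
    case False
    then have oC: "o0 \<in> C" using Tk_C[OF oT] by blast
    have "o0 \<noteq> v 0" using o0N(3) irrefl by auto
    then obtain i where i: "o0 = v (Suc i)" "Suc i < n" using CE[OF oC] by blast
    have i1: "2 \<le> Suc i" using i(1) o0(3) by (cases i) auto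
    show ?thesis
    proof (cases "d o0 = 2")
      case True
      have "v 0 = v i \<or> v 0 = v (Suc (Suc i))" using two_nb[OF i(2)] True o0N(4) unfolding i(1) by blast
      then have "i = 0 \<or> Suc (Suc i) = n"
        using v_eq[of 0 i] v_eq[of 0 "Suc (Suc i)"] i(2) by (cases "Suc (Suc i) = n") auto
      then have "o0 = v 1 \<or> o0 = v (n - 1)" using i(1) by auto
      then show ?thesis using o0(2,3) by blast
    next
      case False
      then have "3 \<le> d o0" using W_cases[OF o0N(5)] by auto
      then have bw: "bad (v (Suc i)) \<or> weak (v (Suc i))" using o0_real i(1) by simp
      have "\<psi> (v (Suc i)) = 0" by (rule Inv_zero[OF inv z _ i1 _ bw]) (use i(2) in simp_all)
      then show ?thesis using i(1) by simp
    qed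
  qed
  have f0: "free (Tk 2) \<psi> (v 0) 1"
    unfolding free_def nb_Int[OF o0(1) Tk_S[of 2, simplified]] using v0 vn1 o1 v1 by auto
  have nb1: "nb (Tk 2) (v 1) \<subseteq> {v 0, v 2}"
    using nb_Int[OF N1 Tk_S[of 2, simplified]] unfolding n2 by (simp del: in_nb)
  have "\<exists>\<psi>'. good 1 (insert (v 1) (Tk 2)) \<psi>' \<and> \<psi>' (v 1) = 1 \<and> (\<forall>u \<in> Tk 2. \<psi>' u = \<psi> u)"
  proof (rule add_coloured_vertex[OF g v1])
    show "\<forall>z \<in> nb (Tk 2) (v 1). free (Tk 2) \<psi> z 1" using nb1 f0 f2 by blast
    show "\<forall>u \<in> nb (Tk 2) (v 1). \<forall>u' \<in> nb (Tk 2) (v 1). \<psi> u = \<psi> u' \<longrightarrow> 1 < \<psi> u \<longrightarrow> u = u'"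
      using good_le[OF g] by fastforce
  qed simp_all
  then show "\<exists>\<psi>'. good 1 (Tk 1) \<psi>' \<and> \<psi>' (v 1) = 1 \<and> (\<forall>u \<in> Tk 2. \<psi>' u = \<psi> u)"
    using Tk_Suc[OF n1] unfolding n2 by simp
qed

lemma contradiction: False
proof -
  obtain \<psi>0 where s: "good 1 T1 \<psi>0" "\<psi>0 (v 0) = 0" "\<forall>u \<in> Ys. \<psi>0 u = 0" "o0 \<in> T1 \<Longrightarrow> \<psi>0 o0 = 0"
    "\<And>s. ext \<Longrightarrow> s \<in> N o0 \<Longrightarrow> s \<in> T1 \<Longrightarrow> \<psi>0 s = 0" using start by blast
  have "Tk n = T1" unfolding Tk_def by simp
  then have init: "Inv \<psi>0 n \<psi>0" unfolding Inv_def using s(1) by auto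
  obtain \<psi> where inv: "Inv \<psi>0 2 \<psi>" using loop[OF init s(2)] by blast
  note e = start_edge[OF inv s(2,4)]
  obtain \<phi> where \<phi>: "good 1 (Tk 1) \<phi>" "\<phi> (v 1) = 1" "\<forall>u \<in> Tk 2. \<phi> u = \<psi> u" using e(1) by blast
  have T1\<phi>: "\<phi> u = \<psi>0 u" if "u \<in> T1" for u
    using \<phi>(3) inv that unfolding Inv_def Tk_def by simp
  have v\<phi>: "\<phi> (v i) = \<psi> (v i)" if "2 \<le> i" "i \<le> n" for i
    using \<phi>(3) v_in_Tk[OF that] by blast
  have TS: "Tk 1 \<subseteq> S" by (rule Tk_S) simp
  have fin: "finite (Tk 1)" using TS finS finite_subset by blast
  have OS: "Offs \<union> Ts \<subseteq> S" using degs_off by blast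
  have d1: "d (v 1) = 2" by (rule alpha_two[OF alpha1])
  have big: "2 \<le> Suc i" if "d (v (Suc i)) = 3" for i using that d1 by (cases i) auto
  have disj: "(Offs \<union> Ts) \<inter> Tk 1 = {}" using extra_notin_Tk by blast
  define ok where "ok u p \<longleftrightarrow> alpha u \<and> u \<in> N p \<and> d p \<noteq> 2 \<and> p \<in> Tk 1 \<and> \<phi> p = 0 \<and>
      (\<forall>y \<in> nb (Tk 1) p. \<phi> y \<noteq> 1) \<and> (\<forall>u' \<in> Offs \<union> Ts. u' \<in> N p \<longrightarrow> u' = u)" for u p
  have "\<forall>u \<in> Offs \<union> Ts. \<exists>p. ok u p"
  proof
    fix u assume "u \<in> Offs \<union> Ts"
    then consider "u \<in> Offs" | "u \<in> Ts" by blast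
    then show "\<exists>p. ok u p"
    proof cases
      case 1
      then obtain i where i: "u = off (Suc i)" "Suc i < n" "d (v (Suc i)) = 3" "alpha u" "u \<in> N (v (Suc i))"
        by (rule Offs_E)
      note o = off[OF i(2,3)]
      have nt: "\<not> triple (v (Suc i))" using triple_nb i(4,5) by blast
      then have bw: "bad (v (Suc i)) \<or> weak (v (Suc i))" using W_cases[OF vW[OF i(2)]] i(3) by auto
      have z: "\<phi> (v (Suc i)) = 0"
        using Inv_zero[OF inv s(2) _ big[OF i(3)] _ bw] v\<phi>[OF big[OF i(3)]] i(2) by simp
      have uT: "off (Suc i) \<notin> Tk 1" using disj 1 i(1) by blast
      have i2: "2 \<le> i"
      proof -
        have "i \<noteq> 1" using i(3) e(2) by (auto simp: numeral_2_eq_2)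
        then show ?thesis using big[OF i(3)] by simp
      qed
      have before: "\<phi> (v i) \<noteq> 1"
        using not_one_before[OF inv i2 _ i(3)] v\<phi>[OF i2] i(2) by simp
      have after: "\<phi> (v (Suc (Suc i))) \<noteq> 1"
      proof (cases "Suc (Suc i) = n")
        case True
        then show ?thesis using T1\<phi>[OF T1_facts(6)] s(2) vn by simp
      next
        case False
        then have lt: "Suc (Suc i) < n" using i(2) by simp
        have "\<not> triple (v (Suc (Suc i)))"
          using triple_nb[of "v (Suc (Suc i))" "v (Suc i)"] cyc_nb(1)[OF lt] i(3) by auto
        moreover have "\<not> needs_cut (Suc i)" using alpha_two[OF i(4)] i(1) unfolding needs_cut_def by simp
        ultimately have "\<psi> (v (Suc (Suc i))) \<noteq> 1" using inv lt unfolding Inv_def by auto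
        then show ?thesis using v\<phi>[of "Suc (Suc i)"] lt by simp
      qed
      have "ok u (v (Suc i))"
        unfolding ok_def
      proof (intro conjI ballI impI)
        show "alpha u" "u \<in> N (v (Suc i))" "\<phi> (v (Suc i)) = 0" by fact+
        show "d (v (Suc i)) \<noteq> 2" using i(3) by simp
        show "v (Suc i) \<in> Tk 1" by (rule v_in_Tk) (use i(2) in simp_all)
        show "\<phi> y \<noteq> 1" if "y \<in> nb (Tk 1) (v (Suc i))" for y
          using that before after uT unfolding nb_Int[OF o(1) TS] by blast
        show "u' = u" if "u' \<in> Offs \<union> Ts" "u' \<in> N (v (Suc i))" for u'
        proof -
          have "u' \<notin> C" using degs_off that(1) by blast
          then have "u' \<noteq> v i" "u' \<noteq> v (Suc (Suc i))" using vC[of i] vC[of "Suc (Suc i)"] i(2) by auto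
          then show ?thesis using that(2) unfolding o(1) i(1) by blast
        qed
      qed
      then show ?thesis by blast
    next
      case 2
      then have x: "ext" "u = cutv" unfolding Ts_def by (auto split: if_splits)
      note c = cutv_facts[OF x(1)]
      obtain s' where s': "N o0 = {cutv, s', v 0}" "d s' = 2" using cutv[OF x(1)] by blast
      have Ys: "Ys = {o0}" using x(1) unfolding Ys_def by simp
      then have oT: "o0 \<in> T1" unfolding T1_def by blast
      have s'N: "s' \<in> N o0" using s'(1) by blast
      have s'C: "s' \<notin> C"
        using two_in_C_nb[OF _ s'(2) N_sym[OF o0N(2) s'N]] x(1) unfolding ext_def by blast
      have "ok u o0"
        unfolding ok_def x(2)
      proof (intro conjI ballI impI)
        show "alpha cutv" "cutv \<in> N o0" by fact+
        show "d o0 \<noteq> 2" using c(8) by simp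
        show "o0 \<in> Tk 1" using oT unfolding Tk_def by blast
        show "\<phi> o0 = 0" using T1\<phi>[OF oT] s(4)[OF oT] by simp
        show "\<phi> y \<noteq> 1" if "y \<in> nb (Tk 1) o0" for y
        proof -
          have "y \<in> N o0" "y \<in> Tk 1" using that TS by auto
          then have "y = s' \<or> y = v 0" using disj 2 x(2) unfolding s'(1) by blast
          then have "y \<in> T1" using Tk_C[OF \<open>y \<in> Tk 1\<close>] s'C T1_facts(6) by blast
          then show ?thesis using T1\<phi> s(5)[OF x(1) \<open>y \<in> N o0\<close>] by simp
        qed
        show "u' = cutv" if u': "u' \<in> Offs \<union> Ts" "u' \<in> N o0" for u'
        proof (cases "u' \<in> Ts")
          case True
          then show ?thesis unfolding Ts_def using x(1) by simp
        next
          case False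
          then have "u' \<in> Offs" using u'(1) by blast
          then obtain i where i: "Suc i < n" "d (v (Suc i)) = 3" "alpha u'" "v (Suc i) \<in> N u'" "u' \<in> S"
            using OS by (auto elim: Offs_E)
          have "v (Suc i) = o0"
            by (rule alpha_unique[OF i(3,5,4) N_sym[OF o0N(2) u'(2)] i(2) c(8)])
          then show ?thesis using x(1) vC[of "Suc i"] i(1) unfolding ext_def by auto
        qed
      qed
      then show ?thesis by blast
    qed
  qed
  then obtain f where f: "\<forall>u \<in> Offs \<union> Ts. ok u (f u)" by (rule bchoice[THEN exE])
  have "\<exists>\<chi>. good 1 (Tk 1 \<union> (Offs \<union> Ts)) \<chi> \<and> (\<forall>u \<in> Tk 1. \<chi> u = \<phi> u)"
    by (rule cut_set[OF \<phi>(1) TS finite_subset[OF OS finS] disj f[unfolded ok_def]])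
  then obtain \<chi> where \<chi>: "good 1 (Tk 1 \<union> (Offs \<union> Ts)) \<chi>" "\<forall>u \<in> Tk 1. \<chi> u = \<phi> u" by blast
  let ?T = "Tk 1 \<union> (Offs \<union> Ts)"
  have T'S: "?T \<subseteq> S" using TS OS by blast
  have MS: "Mids \<subseteq> S" using degs_off by blast
  have aO: "alpha u" if "u \<in> Offs \<union> Ts" for u using f that unfolding ok_def by blast
  have md: "Mids \<inter> ?T = {}"
  proof -
    have "\<not> alpha u" if "u \<in> Mids" for u using that by (rule Mids_E)
    then show ?thesis using aO extra_notin_Tk by blast
  qed
  have "\<exists>\<psi>'. good 1 (?T \<union> Mids) \<psi>' \<and> (\<forall>b \<in> Mids. \<psi>' b = 0) \<and> (\<forall>u \<in> ?T. \<psi>' u = \<chi> u)"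
  proof (rule add_forest_set[OF \<chi>(1) finite_subset[OF T'S finS] finite_subset[OF MS finS] md])
    show "\<forall>b \<in> Mids. \<forall>b' \<in> Mids. \<not> E b b'"
    proof (intro ballI notI)
      fix b b' assume b: "b \<in> Mids" "b' \<in> Mids" "E b b'"
      obtain "d b = 2" "\<not> alpha b" using b(1) by (rule Mids_E)
      moreover have "d b' = 2" using degs_off b(2) by blast
      ultimately show False using nonalpha_nb[of b b'] b MS by auto
    qed
    show "\<forall>b \<in> Mids. \<forall>u \<in> nb ?T b. \<forall>u' \<in> nb ?T b. \<chi> u = \<chi> u' \<longrightarrow> u = u'"
    proof
      fix b assume "b \<in> Mids"
      then obtain i where i: "b = off (Suc i)" "Suc i < n" "triple (v (Suc i))" by (rule Mids_E)
      note o = opp[OF i(2,3)]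
      have nb: "nb ?T b = {v (Suc i), opp i} \<inter> ?T" unfolding i(1) by (rule nb_Int[OF o(5) T'S])
      have i2: "2 \<le> Suc i" by (rule big) (rule deg3(3)[OF i(3)])
      have "\<chi> (v (Suc i)) \<noteq> \<chi> (opp i)" if "opp i \<in> ?T"
      proof -
        have oT: "opp i \<in> Tk 1" using that o(7) degs_off by blast
        have "insert (v 1) (Tk 2) = Tk 1" using Tk_Suc[of 0] n3 by (simp add: numeral_2_eq_2)
        then have oT2: "opp i \<in> Tk 2" using oT o(7) d1 by (metis insertE)
        have "\<psi> (v (Suc i)) \<noteq> \<psi> (opp i)" using inv i i2 oT2 unfolding Inv_def by blast
        moreover have "v (Suc i) \<in> Tk 1" by (rule v_in_Tk) (use i(2) in simp_all)
        ultimately show ?thesis using \<chi>(2) oT \<phi>(3) oT2 v\<phi>[OF i2] i(2) by simp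
      qed
      then show "\<forall>u \<in> nb ?T b. \<forall>u' \<in> nb ?T b. \<chi> u = \<chi> u' \<longrightarrow> u = u'" unfolding nb by auto
    qed
  qed
  moreover have "?T \<union> Mids = S"
  proof -
    have "{..<n} = insert 0 {1..<n}" using n3 by auto
    then have "C = insert (v 0) (v ` {1..<n})" unfolding C_def by simp
    then have "S \<subseteq> ?T \<union> Mids" unfolding Tk_def T1_def T0_def by blast
    then show ?thesis using T'S MS by blast
  qed
  ultimately show False using nocol by auto
qed

end

context sgraph
begin

definition cycle_in :: "'a set \<Rightarrow> (nat \<Rightarrow> 'a) \<Rightarrow> nat \<Rightarrow> bool" where
  "cycle_in X v n \<longleftrightarrow> 3 \<le> n \<and> v n = v 0 \<and> inj_on v {..<n} \<and> (\<forall>i<n. v i \<in> X \<and> E (v i) (v (Suc i)))"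

lemma cycle_exists:
  assumes fin: "finite X" and ne: "X \<noteq> {}" and deg: "\<forall>x \<in> X. 2 \<le> card (nb X x)"
  shows "\<exists>v n. cycle_in X v n"
proof -
  define path where "path xs \<longleftrightarrow> xs \<noteq> [] \<and> distinct xs \<and> set xs \<subseteq> X \<and> successively E xs" for xs
  obtain x where "x \<in> X" using ne by blast
  then have "path [x]" unfolding path_def by simp
  moreover have "length xs \<le> card X" if "path xs" for xs
    using that fin unfolding path_def by (metis card_mono distinct_card)
  ultimately obtain xs where xs: "path xs" "\<And>ys. path ys \<Longrightarrow> length ys \<le> length xs"
    using ex_has_greatest_nat[of path "[x]" length "Suc (card X)"] by (auto simp: less_Suc_eq_le)
  obtain a ys where a: "xs = a # ys" using xs(1) unfolding path_def by (cases xs) auto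
  have aX: "a \<in> X" using xs(1) a unfolding path_def by simp
  have sub: "nb X a \<subseteq> set ys"
  proof
    fix w assume w: "w \<in> nb X a"
    show "w \<in> set ys"
    proof (rule ccontr)
      assume "w \<notin> set ys"
      moreover have "w \<noteq> a" using w irrefl by auto
      ultimately have "path (w # xs)" using xs(1) w a sym unfolding path_def by auto
      then show False using xs(2)[of "w # xs"] by simp
    qed
  qed
  have "\<not> nb X a \<subseteq> {ys ! 0}"
  proof
    assume "nb X a \<subseteq> {ys ! 0}"
    then have "card (nb X a) \<le> card {ys ! 0}" by (intro card_mono) simp_all
    then show False using deg aX by force
  qed
  then obtain w where w: "w \<in> nb X a" "w \<noteq> ys ! 0" by blast
  then obtain k where k: "w = ys ! k" "k < length ys" using sub by (metis in_set_conv_nth subsetD)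
  have k0: "0 < k" using w(2) k(1) by (cases k) auto
  define n where "n = Suc (Suc k)"
  define v where "v i = (if i = n then a else xs ! i)" for i
  have n: "n \<le> length xs" using k(2) a unfolding n_def by simp
  have "cycle_in X v n" unfolding cycle_in_def
  proof (intro conjI allI impI)
    show "3 \<le> n" using k0 unfolding n_def by simp
    show "v n = v 0" unfolding v_def n_def a by simp
    show "inj_on v {..<n}"
      using xs(1) n unfolding path_def inj_on_def v_def by (auto simp: nth_eq_iff_index_eq)
    fix i assume i: "i < n"
    show "v i \<in> X" using xs(1) i n nth_mem[of i xs] unfolding path_def v_def by auto
    show "E (v i) (v (Suc i))"
    proof (cases "Suc i = n")
      case True
      then have "v i = w" "v (Suc i) = a" using k a unfolding v_def n_def by auto
      then show ?thesis using w(1) sym by auto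
    next
      case False
      then have "Suc i < length xs" using i n by simp
      then show ?thesis using xs(1) False i unfolding path_def v_def by (auto simp: successively_conv_nth)
    qed
  qed
  then show ?thesis by blast
qed

lemma sum_deg_remove:
  assumes "finite X" "x \<in> X"
  shows "(\<Sum>y\<in>X. card (nb X y)) = (\<Sum>y\<in>X - {x}. card (nb (X - {x}) y)) + 2 * card (nb X x)"
proof -
  have "card (nb X y) = card (nb (X - {x}) y) + (if E x y then 1 else 0)" for y
  proof (cases "E x y")
    case True
    then have "nb X y = insert x (nb (X - {x}) y)" using assms(2) sym by auto
    then show ?thesis using True assms(1) by simp
  next
    case False
    then have "nb X y = nb (X - {x}) y" using sym by auto
    then show ?thesis using False by simp
  qed
  then have "(\<Sum>y\<in>X - {x}. card (nb X y)) = (\<Sum>y\<in>X - {x}. card (nb (X - {x}) y)) + (\<Sum>y\<in>X - {x}. if E x y then 1 else 0)"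
    by (simp add: sum.distrib)
  also have "(\<Sum>y\<in>X - {x}. if E x y then 1 else 0) = card (nb X x)"
  proof -
    have "nb X x = {y \<in> X - {x}. E x y}" using irrefl by auto
    then show ?thesis using assms(1) by (simp add: sum.If_cases Int_def)
  qed
  finally show ?thesis using assms by (simp add: sum.remove)
qed

lemma sum_deg_le:
  assumes "finite X" and "\<And>v n i. cycle_in X v n \<Longrightarrow> i < n \<Longrightarrow> card (nb X (v i)) \<le> 2"
  shows "(\<Sum>x\<in>X. card (nb X x)) \<le> 2 * card X"
  using assms
proof (induction "card X" arbitrary: X rule: less_induct)
  case less
  have cyc: "card (nb Y (v i)) \<le> 2" if "Y \<subseteq> X" "cycle_in Y v n" "i < n" for Y v n i
  proof -
    have "cycle_in X v n" using that unfolding cycle_in_def by blast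
    moreover have "card (nb Y (v i)) \<le> card (nb X (v i))"
      by (rule card_mono) (use that(1) less(2) nb_mono in \<open>simp_all del: in_nb\<close>)
    ultimately show ?thesis using less(3) that(3) le_trans by blast
  qed
  show ?case
  proof (cases "\<forall>x \<in> X. 2 \<le> card (nb X x)")
    case False
    then obtain x where x: "x \<in> X" "card (nb X x) \<le> 1" by force
    have "(\<Sum>y\<in>X - {x}. card (nb (X - {x}) y)) \<le> 2 * card (X - {x})"
    proof (rule less(1))
      show "card (X - {x}) < card X" by (rule card_Diff1_less[OF less(2) x(1)])
      show "card (nb (X - {x}) (v i)) \<le> 2" if "cycle_in (X - {x}) v n" "i < n" for v n i
        by (rule cyc[OF _ that]) blast
    qed (use less(2) in simp)
    moreover have "card X = Suc (card (X - {x}))" using card.remove[OF less(2) x(1)] by simp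
    ultimately show ?thesis using sum_deg_remove[OF less(2) x(1)] x(2) by linarith
  next
    case True
    show ?thesis
    proof (cases "X = {}")
      case False
      obtain v n where v: "cycle_in X v n" using cycle_exists[OF less(2) False True] by blast
      define C where "C = v ` {..<n}"
      have n0: "0 < n" using v unfolding cycle_in_def by simp
      then have "v 0 \<in> C" unfolding C_def by blast
      then have ne: "C \<noteq> {}" by blast
      have "C \<subseteq> X" "finite C" using v unfolding C_def cycle_in_def by auto
      with ne have C: "C \<subseteq> X" "C \<noteq> {}" "finite C" by blast+
      have inC: "v i \<in> C" if "i \<le> n" for i using v that unfolding C_def cycle_in_def by (cases "i = n") auto
      have nbC: "nb X c \<subseteq> C" "card (nb X c) = 2" if c: "c \<in> C" for c
      proof -
        obtain i where i: "c = v i" "i < n" using c unfolding C_def by blast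
        then show two: "card (nb X c) = 2" using less(3)[OF v i(2)] True C(1) c by force
        define k where "k = (if i = 0 then n - 1 else i - 1)"
        define l where "l = (if Suc i = n then 0 else Suc i)"
        have k: "k < n" "v (Suc k) = c" "l < n" "v (Suc i) = v l"
          using v i n0 unfolding k_def l_def cycle_in_def by auto
        define p where "p = v k"
        have "E p c" using v k unfolding p_def cycle_in_def by metis
        then have p: "p \<in> nb X c" "p \<in> C"
          using v k(1) inC[of k] sym C(1) unfolding p_def by auto
        have s: "v (Suc i) \<in> nb X c" "v (Suc i) \<in> C"
          using v i inC[of "Suc i"] C(1) unfolding cycle_in_def by auto
        have "p \<noteq> v (Suc i)"
        proof
          assume eq: "p = v (Suc i)"
          then have "v k = v l" using k(4) unfolding p_def by simp
          then have "k = l" using v k(1,3) unfolding cycle_in_def inj_on_def by blast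
          then show False using v i unfolding k_def l_def cycle_in_def by (auto split: if_splits)
        qed
        then have "card {p, v (Suc i)} = card (nb X c)" using two by simp
        then have eq: "{p, v (Suc i)} = nb X c" using p s less(2) by (intro card_subset_eq) (simp_all del: in_nb)
        show "nb X c \<subseteq> C" unfolding eq[symmetric] using p(2) s(2) by simp
      qed
      have same: "nb X y = nb (X - C) y" if "y \<in> X - C" for y
        using nbC(1) that sym C(1) by (fastforce simp: nb_def)
      have "(\<Sum>y\<in>X - C. card (nb (X - C) y)) \<le> 2 * card (X - C)"
      proof (rule less(1))
        show "card (X - C) < card X" using C less(2) by (intro psubset_card_mono) auto
        show "card (nb (X - C) (v i)) \<le> 2" if "cycle_in (X - C) v n" "i < n" for v n i
          by (rule cyc[OF _ that]) blast
      qed (use less(2) in simp)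
      moreover have "(\<Sum>y\<in>X - C. card (nb X y)) = (\<Sum>y\<in>X - C. card (nb (X - C) y))"
        using same by (intro sum.cong) simp_all
      moreover have "(\<Sum>y\<in>C. card (nb X y)) = 2 * card C" using nbC(2) by simp
      moreover have "(\<Sum>y\<in>X. card (nb X y)) = (\<Sum>y\<in>X - C. card (nb X y)) + (\<Sum>y\<in>C. card (nb X y))"
        by (rule sum.subset_diff[OF C(1) less(2)])
      moreover have "card X = card (X - C) + card C"
        using C less(2) by (metis add.commute card_Diff_subset card_mono le_add_diff_inverse)
      ultimately show ?thesis by linarith
    qed simp
  qed
qed

lemma cycle_rotate:
  assumes "cycle_in X v n" "k < n"
  shows "cycle_in X (\<lambda>i. v ((k + i) mod n)) n"
  unfolding cycle_in_def
proof (intro conjI allI impI)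
  note v = assms(1)[unfolded cycle_in_def]
  show "3 \<le> n" "v ((k + n) mod n) = v ((k + 0) mod n)" using v by simp_all
  show "inj_on (\<lambda>i. v ((k + i) mod n)) {..<n}"
  proof (rule inj_onI)
    fix i j assume ij: "i \<in> {..<n}" "j \<in> {..<n}" "v ((k + i) mod n) = v ((k + j) mod n)"
    have m: "(k + x) mod n = (if k + x < n then k + x else k + x - n)" if "x < n" for x
      using assms(2) that by (simp add: mod_if)
    have "(k + i) mod n = (k + j) mod n"
      by (rule inj_onD[of v "{..<n}"]) (use v ij assms(2) in auto)
    then show "i = j" using m ij by (auto split: if_splits)
  qed
  fix i assume "i < n"
  have m: "(k + i) mod n < n" using v by (intro mod_less_divisor) simp
  then show "v ((k + i) mod n) \<in> X" using v by blast
  have "v ((k + Suc i) mod n) = v (Suc ((k + i) mod n))"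
  proof (cases "Suc ((k + i) mod n) = n")
    case True
    then show ?thesis using v by (simp add: mod_Suc)
  next
    case False
    then show ?thesis by (simp add: mod_Suc)
  qed
  then show "E (v ((k + i) mod n)) (v ((k + Suc i) mod n))" using v m by simp
qed

lemma cycle_reverse:
  assumes "cycle_in X v n"
  shows "cycle_in X (\<lambda>i. v (n - i)) n"
  unfolding cycle_in_def
proof (intro conjI allI impI)
  note v = assms[unfolded cycle_in_def]
  show "3 \<le> n" "v (n - n) = v (n - 0)" using v by simp_all
  have e: "v (n - i) = v (if i = 0 then 0 else n - i)" for i using v by simp
  show "inj_on (\<lambda>i. v (n - i)) {..<n}"
  proof (rule inj_onI)
    fix i j assume ij: "i \<in> {..<n}" "j \<in> {..<n}" "v (n - i) = v (n - j)"
    have "(if i = 0 then 0 else n - i) = (if j = 0 then 0 else n - j)"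
      by (rule inj_onD[of v "{..<n}"]) (use v ij e[of i] e[of j] in \<open>auto split: if_splits\<close>)
    then show "i = j" using ij by (auto split: if_splits)
  qed
  fix i assume i: "i < n"
  show "v (n - i) \<in> X" using v i e[of i] by (cases "i = 0") auto
  have "E (v (n - Suc i)) (v (Suc (n - Suc i)))" using v i by simp
  then show "E (v (n - i)) (v (n - Suc i))" using i sym by (simp add: Suc_diff_Suc)
qed

end

context mincex1
begin

lemma not_all_weak:
  assumes z: "z \<in> S" "d z = 3" and two: "\<forall>m \<in> N z. d m = 2 \<and> \<not> alpha m"
    and weak: "\<forall>m \<in> N z. weak (far z m)"
  shows False
proof -
  define P where "P = far z ` N z"
  have wP: "weak p" if "p \<in> P" for p using weak that unfolding P_def by blast
  have "\<forall>p \<in> P. \<exists>t. N p = {fst t, fst (snd t), snd (snd t)} \<and> alpha (fst t) \<and> d (fst (snd t)) = 2 \<and>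
      \<not> alpha (fst (snd t)) \<and> 3 \<le> d (snd (snd t))"
  proof
    fix p assume "p \<in> P"
    then obtain a m y where "N p = {a, m, y}" "alpha a" "d m = 2" "\<not> alpha m" "3 \<le> d y"
      using wP unfolding weak_def by blast
    then show "\<exists>t. N p = {fst t, fst (snd t), snd (snd t)} \<and> alpha (fst t) \<and> d (fst (snd t)) = 2 \<and>
        \<not> alpha (fst (snd t)) \<and> 3 \<le> d (snd (snd t))" by (intro exI[of _ "(a, m, y)"]) simp
  qed
  then obtain t where t: "\<forall>p \<in> P. N p = {fst (t p), fst (snd (t p)), snd (snd (t p))} \<and> alpha (fst (t p)) \<and>
      d (fst (snd (t p))) = 2 \<and> \<not> alpha (fst (snd (t p))) \<and> 3 \<le> d (snd (snd (t p)))"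
    by (rule bchoice[THEN exE])
  define a where "a p = fst (t p)" for p
  define y where "y p = snd (snd (t p))" for p
  define m where "m p = fst (snd (t p))" for p
  have P: "N p = {a p, m p, y p}" "alpha (a p)" "d (m p) = 2" "\<not> alpha (m p)" "3 \<le> d (y p)" "p \<in> S" "d p = 3"
    if "p \<in> P" for p
    using t[rule_format, OF that, folded a_def m_def y_def] wP[OF that, unfolded weak_def] by simp_all
  have a: "a p \<in> N p" "p \<in> N (a p)" "a p \<in> S" "d (a p) = 2" if "p \<in> P" for p
  proof -
    show aN: "a p \<in> N p" using P(1)[OF that] by blast
    show "p \<in> N (a p)" by (rule N_sym[OF P(6)[OF that] aN])
    show "a p \<in> S" using aN by simp
    show "d (a p) = 2" by (rule alpha_two[OF P(2)[OF that]])
  qed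
  have a_unique: "p = p'" if "p \<in> P" "p' \<in> P" "a p \<in> N p'" for p p'
  proof (rule ccontr)
    assume ne: "p \<noteq> p'"
    have "d p \<noteq> 2" using P(7)[OF that(1)] by simp
    then have "\<exists>u. N (a p) = {p, u} \<and> u \<noteq> p \<and> d u = 2"
      by (rule alpha_nbs[OF P(2)[OF that(1)] a(3)[OF that(1)] a(2)[OF that(1)]])
    then obtain u where u: "N (a p) = {p, u}" "d u = 2" by blast
    have "p' \<in> N (a p)" by (rule N_sym[OF P(6)[OF that(2)] that(3)])
    then show False using ne u P(7)[OF that(2)] by auto
  qed
  have zm: "far z b \<in> P" "N b = {z, far z b}" "b = m (far z b)" if "b \<in> N z" for b
  proof -
    show p: "far z b \<in> P" using that unfolding P_def by blast
    have b2: "d b = 2" "\<not> alpha b" using two that by blast+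
    note f = far_in[OF z(1) that b2(1)]
    show "N b = {z, far z b}" by (rule f(5))
    have "b \<in> N (far z b)" using f(4,6) by simp
    then show "b = m (far z b)" using P(1,2,5)[OF p] b2 by auto
  qed
  have mz: "m p \<in> N z" if "p \<in> P" for p
  proof -
    obtain b where b: "b \<in> N z" "p = far z b" using \<open>p \<in> P\<close> unfolding P_def by blast
    then have "m p = b" using zm(3)[OF b(1)] by simp
    then show ?thesis using b(1) by blast
  qed
  have zP: "z \<notin> P"
  proof
    assume "z \<in> P"
    then obtain b where b: "b \<in> N z" "far z b = z" unfolding P_def by auto
    then show False using far_in(2)[OF z(1) b(1)] two by blast
  qed
  define D where "D = insert z (N z \<union> P \<union> a ` P)"
  have DS: "D \<subseteq> S" unfolding D_def using z(1) P(6) a(3) by auto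
  have zD: "z \<in> D" unfolding D_def by blast
  obtain \<phi> where g: "good 1 (S - D) \<phi>" and fin: "finite (S - D)" using partial[OF zD DS] by blast
  define T where "T = S - D"
  have yz: "y p \<noteq> z" if "p \<in> P" for p
  proof
    assume "y p = z"
    then have "z \<in> N p" using P(1)[OF that] by blast
    then have "p \<in> N z" by (rule N_sym[OF P(6)[OF that]])
    then show False using two P(7)[OF that] by auto
  qed
  have yN: "y p \<notin> N z" "y p \<notin> a ` P" if "p \<in> P" for p using two P(5)[OF that] a(4) by force+
  have aN: "a p \<notin> N z" "a p \<notin> P" "a p \<noteq> z" if "p \<in> P" for p
    using two P(2,7) a(4)[OF that] that z(2) by force+
  have PN: "p \<notin> N z" if "p \<in> P" for p using two P(7)[OF that] by auto
  have "\<exists>\<psi>. good 1 (insert z T) \<psi> \<and> \<psi> z = 1 \<and> (\<forall>u \<in> T. \<psi> u = \<phi> u)"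
    by (rule add_coloured_vertex[OF g[folded T_def]]) (auto simp: T_def D_def)
  then obtain \<psi> where \<psi>: "good 1 (insert z T) \<psi>" "\<psi> z = 1" "\<forall>u \<in> T. \<psi> u = \<phi> u" by blast
  define U where "U = a ` {p \<in> P. y p \<in> T \<and> \<psi> (y p) = 1}"
  have finP: "finite P" "finite U" "finite (insert z T)" unfolding P_def U_def T_def using finS by auto
  have UT: "U \<inter> insert z T = {}" unfolding U_def T_def D_def using aN by auto
  have zTS: "insert z T \<subseteq> S" unfolding T_def using z(1) by blast
  have PT: "P \<inter> (insert z T \<union> U) = {}" unfolding U_def T_def D_def using aN zP by auto
  have US: "U \<subseteq> S" using a(3) unfolding U_def by blast
  have "\<exists>\<chi>. good 1 (insert z T \<union> U) \<chi> \<and> (\<forall>b \<in> U. \<chi> b = 0) \<and> (\<forall>u \<in> insert z T. \<chi> u = \<psi> u)"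
  proof (rule add_leaves[OF \<psi>(1) finP(3,2) UT], rule ballI)
    fix b assume "b \<in> U"
    then obtain p where p: "b = a p" "p \<in> P" unfolding U_def by blast
    have "nb (insert z T \<union> U) b \<subseteq> N b - {p}" using PT p(2) zTS US by auto
    moreover have "card (N b - {p}) \<le> 1" using a(2,4)[OF p(2)] unfolding p(1) d_def by simp
    ultimately have "card (nb (insert z T \<union> U) b) \<le> 1"
      using card_mono[of "N b - {p}"] finN by (meson finite_Diff le_trans)
    moreover have "finite (nb (insert z T \<union> U) b)" using finP by simp
    ultimately show "\<forall>u \<in> nb (insert z T \<union> U) b. \<forall>u' \<in> nb (insert z T \<union> U) b.
        (if u \<in> insert z T then \<psi> u else 0) = (if u' \<in> insert z T then \<psi> u' else 0) \<longrightarrow> u = u'"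
      unfolding card_le_Suc0_iff_eq[unfolded One_nat_def[symmetric]] by (metis One_nat_def card_le_Suc0_iff_eq)
  qed
  then obtain \<chi> where \<chi>: "good 1 (insert z T \<union> U) \<chi>" "\<forall>b \<in> U. \<chi> b = 0" "\<forall>u \<in> insert z T. \<chi> u = \<psi> u"
    by blast
  let ?T2 = "insert z T \<union> U"
  have T2S: "?T2 \<union> P \<subseteq> S" using zTS US P(6) by blast
  have y_case: "y p \<in> P \<or> y p \<in> T" if "p \<in> P" for p
  proof -
    have "y p \<in> S" using P(1)[OF that] by (metis in_nb insertCI)
    then show ?thesis using yN[OF that] yz[OF that] unfolding T_def D_def by blast
  qed
  have mT: "m p \<notin> ?T2 \<union> P" if "p \<in> P" for p
    using mz[OF that] PN aN(1) irrefl unfolding T_def D_def U_def by auto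
  have nbP: "nb (?T2 \<union> P) p = {a p, y p} \<inter> (?T2 \<union> P)" if "p \<in> P" for p
    unfolding nb_Int[OF P(1)[OF that] T2S] using mT[OF that] by blast
  have aU: "y p \<in> T \<and> \<psi> (y p) = 1" if "p \<in> P" "a p \<in> ?T2 \<union> P" for p
  proof -
    have "a p \<in> U" using that aN[OF that(1)] unfolding T_def D_def by blast
    then obtain p' where p': "p' \<in> P" "y p' \<in> T" "\<psi> (y p') = 1" "a p = a p'" unfolding U_def by blast
    have "p = p'" using a_unique[OF that(1) p'(1)] a(1)[OF p'(1)] p'(4) by simp
    then show ?thesis using p' by simp
  qed
  have "\<exists>\<xi>. good 1 (?T2 \<union> P) \<xi> \<and> (\<forall>b \<in> P. \<xi> b = 0) \<and> (\<forall>u \<in> ?T2. \<xi> u = \<chi> u)"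
  proof (rule add_leaves[OF \<chi>(1) _ finP(1) PT], use finP in simp, rule ballI)
    fix p assume p: "p \<in> P"
    have col: "\<chi> (a p) = 0 \<and> a p \<in> ?T2 \<and> y p \<in> ?T2 \<and> \<chi> (y p) = 1" if "a p \<in> ?T2 \<union> P"
    proof -
      have y: "y p \<in> T" "\<psi> (y p) = 1" using aU[OF p that] by blast+
      then have "a p \<in> U" unfolding U_def using p by blast
      then show ?thesis using \<chi>(2,3) y by simp
    qed
    define k where "k u = (if u \<in> ?T2 then \<chi> u else 0)" for u
    have k: "k (a p) \<noteq> k (y p)" if "a p \<in> ?T2 \<union> P" using col[OF that] unfolding k_def by simp
    show "\<forall>u \<in> nb (?T2 \<union> P) p. \<forall>u' \<in> nb (?T2 \<union> P) p.
        (if u \<in> ?T2 then \<chi> u else 0) = (if u' \<in> ?T2 then \<chi> u' else 0) \<longrightarrow> u = u'"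
      unfolding k_def[symmetric] nbP[OF p] using k by (metis IntE empty_iff insert_iff)
  qed
  then obtain \<xi> where \<xi>: "good 1 (?T2 \<union> P) \<xi>" "\<forall>b \<in> P. \<xi> b = 0" "\<forall>u \<in> ?T2. \<xi> u = \<chi> u" by blast
  have \<xi>z: "\<xi> z = 1" using \<xi>(3) \<chi>(3) \<psi>(2) by simp
  let ?T3 = "?T2 \<union> P"
  have NT: "N z \<inter> ?T3 = {}" using PN aN(1) irrefl unfolding T_def D_def U_def by auto
  have "\<exists>\<eta>. good 1 (?T3 \<union> N z) \<eta> \<and> (\<forall>b \<in> N z. \<eta> b = 0) \<and> (\<forall>u \<in> ?T3. \<eta> u = \<xi> u)"
  proof (rule fill_star[OF \<xi>(1) T2S])
    show "\<forall>b \<in> N z. d b = 2 \<and> (far z b \<in> ?T3 \<longrightarrow> \<xi> (far z b) \<noteq> \<xi> z)"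
      using two zm(1) \<xi>(2) \<xi>z by simp
  qed (use \<xi>z NT in \<open>simp_all del: in_nb\<close>)
  then obtain \<eta> where \<eta>: "good 1 (?T3 \<union> N z) \<eta>" "\<forall>b \<in> N z. \<eta> b = 0" "\<forall>u \<in> ?T3. \<eta> u = \<xi> u" by blast
  let ?T4 = "?T3 \<union> N z"
  have T4S: "?T4 \<subseteq> S" using T2S by auto
  define R where "R = a ` P - ?T4"
  have "\<forall>u \<in> R. \<exists>p. alpha u \<and> u \<in> N p \<and> d p \<noteq> 2 \<and> p \<in> ?T4 \<and> \<eta> p = 0 \<and>
      (\<forall>w \<in> nb ?T4 p. \<eta> w \<noteq> 1) \<and> (\<forall>u' \<in> R. u' \<in> N p \<longrightarrow> u' = u)"
  proof
    fix u assume "u \<in> R"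
    then obtain p where p: "u = a p" "p \<in> P" "u \<notin> ?T4" unfolding R_def by blast
    have "\<eta> w \<noteq> 1" if w: "w \<in> nb ?T4 p" for w
    proof -
      have "w \<in> N p" "w \<in> ?T4" using w T4S by auto
      then have "w = m p \<or> w = y p" using p(1,3) unfolding P(1)[OF p(2)] by blast
      then show ?thesis
      proof
        assume "w = m p"
        then show ?thesis using \<eta>(2) mz[OF p(2)] by simp
      next
        assume wy: "w = y p"
        show ?thesis
        proof (cases "y p \<in> P")
          case True
          then show ?thesis using wy \<eta>(3) \<xi>(2) by simp
        next
          case False
          then have yT: "y p \<in> T" using y_case[OF p(2)] by blast
          then have "\<psi> (y p) \<noteq> 1" using p unfolding U_def by blast
          then show ?thesis using wy yT \<eta>(3) \<xi>(3) \<chi>(3) by simp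
        qed
      qed
    qed
    moreover have "u' = u" if "u' \<in> R" "u' \<in> N p" for u'
      using that a_unique[OF _ p(2)] p(1) unfolding R_def by blast
    ultimately show "\<exists>p. alpha u \<and> u \<in> N p \<and> d p \<noteq> 2 \<and> p \<in> ?T4 \<and> \<eta> p = 0 \<and>
      (\<forall>w \<in> nb ?T4 p. \<eta> w \<noteq> 1) \<and> (\<forall>u' \<in> R. u' \<in> N p \<longrightarrow> u' = u)"
      using P(2,7)[OF p(2)] a(1)[OF p(2)] \<eta>(3) \<xi>(2) p(1,2) by (intro exI[of _ p]) simp
  qed
  then obtain f where f: "\<forall>u \<in> R. alpha u \<and> u \<in> N (f u) \<and> d (f u) \<noteq> 2 \<and> f u \<in> ?T4 \<and> \<eta> (f u) = 0 \<and>
      (\<forall>w \<in> nb ?T4 (f u). \<eta> w \<noteq> 1) \<and> (\<forall>u' \<in> R. u' \<in> N (f u) \<longrightarrow> u' = u)" by (rule bchoice[THEN exE])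
  have finR: "finite R" "R \<inter> ?T4 = {}" unfolding R_def using finP by auto
  obtain \<theta> where "good 1 (?T4 \<union> R) \<theta>" using cut_set[OF \<eta>(1) T4S finR f] by blast
  moreover have "?T4 \<union> R = S"
  proof -
    have "R \<subseteq> S" unfolding R_def using a(3) by blast
    then show ?thesis using T4S unfolding R_def T_def D_def by blast
  qed
  ultimately show False using nocol by simp
qed

lemma full_bad:
  assumes x: "x \<in> W" "d x = 3" "N x \<subseteq> W"
  shows "bad x"
proof (rule ccontr)
  assume nb: "\<not> bad x"
  consider "weak x" | "triple x" using W_cases[OF x(1)] x(2) nb by auto
  then show False
  proof cases
    case 1
    then obtain a where "a \<in> N x" "alpha a" unfolding weak_def by blast
    then show False using weak_alpha[OF 1] x(3) by blast
  next
    case 2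
    then have "card {m \<in> N x. weak (far x m)} \<noteq> card (N x)" using x(2) unfolding triple_def d_def by simp
    then obtain m where m: "m \<in> N x" "\<not> weak (far x m)" by (metis (mono_tags, lifting) Collect_mem_eq Collect_cong)
    have t: "d m = 2" "\<not> alpha m" using triple_nb[OF 2 m(1)] by blast+
    have l: "link m" using W_cases[of m] x(3) m(1) t(1) by auto
    have xS: "x \<in> S" using x(1) unfolding W_def by blast
    note f = far_in[OF xS m(1) t(1)]
    have "weak (far x m)"
      by (rule link_nonalpha(2)[OF l t(2) N_sym[OF xS m(1)] 2 _ f(2)]) (use f in blast)
    then show False using m(2) by blast
  qed
qed

lemma W_deg_sum: "(\<Sum>x\<in>W. card (nb W x)) \<le> 2 * card W"
proof (rule sum_deg_le)
  have WS: "W \<subseteq> S" unfolding W_def by blast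
  then show fin: "finite W" using finS finite_subset by blast
  fix v n i assume c: "cycle_in W v n" and i: "i < n"
  show "card (nb W (v i)) \<le> 2"
  proof (rule ccontr)
    assume "\<not> ?thesis"
    then have big: "3 \<le> card (nb W (v i))" by simp
    have vW: "v i \<in> W" using c i unfolding cycle_in_def by blast
    have le: "nb W (v i) \<subseteq> N (v i)" by (rule nb_mono[OF WS])
    have d3: "d (v i) = 3"
      using W_cases[OF vW] big card_mono[OF finN le] unfolding d_def by auto
    then have "nb W (v i) = N (v i)"
      using big card_mono[OF finN le] unfolding d_def by (intro card_subset_eq[OF finN le]) simp
    then have sub: "N (v i) \<subseteq> W" by auto
    have b: "bad (v i)" by (rule full_bad[OF vW d3 sub])
    define w where "w j = v ((i + j) mod n)" for j
    have w: "cycle_in W w n" unfolding w_def by (rule cycle_rotate[OF c i])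
    have w0: "w 0 = v i" unfolding w_def using i by simp
    have no: False if "cycle_in W u n" "u 0 = v i" "alpha (u 1)" for u
    proof -
      have "W_cycle E S u n"
        by unfold_locales (use that b sub in \<open>auto simp: cycle_in_def simp del: in_nb\<close>)
      then show False by (rule W_cycle.contradiction)
    qed
    have u: "cycle_in W (\<lambda>j. w (n - j)) n" "w (n - 0) = v i"
      using cycle_reverse[OF w] w w0 unfolding cycle_in_def by auto
    have na: "\<not> alpha (w 1)" "\<not> alpha (w (n - 1))" using no[OF w w0] no[OF u] by blast+
    have n3: "3 \<le> n" using w unfolding cycle_in_def by simp
    have Ew: "w j \<in> W \<and> E (w j) (w (Suc j))" if "j < n" for j using w that unfolding cycle_in_def by blast
    have "w n = w 0" "Suc (n - 1) = n" using w n3 unfolding cycle_in_def by simp_all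
    then have "E (w 0) (w 1)" "E (w (n - 1)) (w 0)" "w 1 \<in> W" "w (n - 1) \<in> W"
      using Ew[of 0] Ew[of 1] Ew[of "n - 1"] n3 by auto
    then have N: "w 1 \<in> N (v i)" "w (n - 1) \<in> N (v i)" using WS sym w0 by auto
    have "inj_on w {..<n}" using w unfolding cycle_in_def by blast
    then have "w 1 \<noteq> w (n - 1)" using inj_onD[of w "{..<n}" 1 "n - 1"] n3 by auto
    moreover obtain a a' y where nbs: "N (v i) = {a, a', y}" "alpha a" "alpha a'"
      using b unfolding bad_def by blast
    have "w 1 = y" "w (n - 1) = y" using N na nbs(2,3) unfolding nbs(1) by auto
    ultimately show False by simp
  qed
qed

text \<open>Charge sent along a thread passes through its vertices of degree 2, so that the transfer is always
  between adjacent vertices.\<close>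

definition pay :: "'a \<Rightarrow> 'a \<Rightarrow> int" where
  "pay x y =
     (if d x \<noteq> 2 then
        if alpha y then 4 + of_bool (\<not> bad x \<and> bad (far y (far x y)))
        else if d y = 2 then 2 + of_bool (\<not> weak x \<and> \<not> triple x \<and> weak (far x y))
        else of_bool ((bad y \<or> weak y) \<and> \<not> (bad x \<or> weak x))
      else if alpha x then
        if d y = 2 then of_bool (\<not> bad (far y x) \<and> bad (far x y))
        else of_bool (bad y \<and> \<not> bad (far x (far y x)))
      else of_bool (weak y \<and> \<not> weak (far y x) \<and> \<not> triple (far y x)))"

definition charge :: "'a \<Rightarrow> int" where
  "charge x = 11 * int (d x) - 26 - (if x \<in> W then 2 - int (card (nb W x)) else 0)"

lemma pay_nonneg: "0 \<le> pay x y"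
  unfolding pay_def by (auto simp: of_bool_def)

lemma sum_three:
  fixes f :: "'a \<Rightarrow> int"
  assumes "d x = 3" "N x = {a, b, c}"
  shows "(\<Sum>u \<in> N x. f u) = f a + f b + f c" "a \<noteq> b" "a \<noteq> c" "b \<noteq> c"
proof -
  have "card {a, b, c} = 3" using assms unfolding d_def by simp
  then show ne: "a \<noteq> b" "a \<noteq> c" "b \<noteq> c" by (auto simp: card_insert_if split: if_splits)
  show "(\<Sum>u \<in> N x. f u) = f a + f b + f c" unfolding assms(2) using ne by simp
qed

lemma finW: "finite W" "W \<subseteq> S"
  using finS unfolding W_def by auto

lemma W_deg_missing: "int (card (nb W x)) = int (d x) - (\<Sum>u \<in> N x. of_bool (u \<notin> W))"
proof -
  have "nb W x = N x \<inter> W" using finW(2) by auto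
  moreover have "card (N x) = card (N x \<inter> W) + card (N x - W)"
    using finN by (metis card_Int_Diff)
  moreover have "(\<Sum>u \<in> N x. of_bool (u \<notin> W)) = int (card (N x - W))"
    using finN by (simp add: of_bool_def sum.If_cases Diff_eq Compl_eq)
  ultimately show ?thesis unfolding d_def by simp
qed

lemma pay_missing:
  assumes x: "x \<in> S" "u \<in> N x" "u \<notin> W" and bw: "bad x \<or> weak x \<and> \<not> alpha u"
  shows "1 \<le> pay u x"
proof -
  have xN: "x \<in> N u" by (rule N_sym[OF x(1,2)])
  have uS: "u \<in> S" using x(2) by simp
  have dx: "d x = 3" using bw deg3 by blast
  have nl: "\<not> link u" "\<not> bad u" "\<not> weak u" using x(3) uS unfolding W_def by blast+
  consider "alpha u" | "d u = 2" "\<not> alpha u" | "d u \<noteq> 2" using alpha_two by blast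
  then show ?thesis
  proof cases
    case 1
    note two = alpha_two[OF 1]
    have b: "bad x" using bw 1 by blast
    have N: "N u = {x, far x u}" by (rule two_far(1)[OF two xN])
    have "\<exists>w \<in> N u. if d w = 2 then \<not> bad (far u w) else \<not> bad w"
      using nl(1) uS two 1 unfolding link_def by (auto simp del: in_nb split: if_splits)
    moreover have "d (far x u) = 2" using 1 dx unfolding alpha_def N by auto
    ultimately have "\<not> bad (far u (far x u))" using b dx unfolding N by (auto split: if_splits dest: deg3(1))
    then show ?thesis unfolding pay_def using two 1 dx b by simp
  next
    case 2
    have w: "weak x" using bw 2 bad_nb[OF _ x(2)] by auto
    have N: "N u = {x, far x u}" by (rule two_far(1)[OF 2(1) xN])
    have "\<not> weak (far x u) \<and> \<not> triple (far x u)" using nl(1) uS 2 w N unfolding link_def by auto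
    then show ?thesis unfolding pay_def using 2 w by simp
  next
    case 3
    then show ?thesis unfolding pay_def using bw nl dx alpha_two[of x] by auto
  qed
qed

lemma alpha_real: assumes "alpha v" "v \<in> S" shows "\<exists>p \<in> N v. 3 \<le> d p"
proof -
  obtain u where u: "u \<in> N v" "d u = 2" using assms(1) unfolding alpha_def by blast
  note f = two_far[OF alpha_two[OF assms(1)] u(1)]
  have "1 + 2 \<le> d (far u v)"
    by (rule alpha_end[of v u]) (use assms alpha_two f u(2) u(1)[unfolded in_nb] in auto)
  then show ?thesis using f(1) by auto
qed

lemma link_W: assumes "v \<in> W" "d v = 2" shows "card (nb W v) = 2"
proof -
  have l: "link v" using W_cases[OF assms(1)] assms(2) by simp
  have vS: "v \<in> S" using assms(1) finW by blast
  have "N v \<subseteq> W"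
  proof
    fix w assume w: "w \<in> N v"
    have wS: "w \<in> S" using w by simp
    show "w \<in> W"
    proof (cases "alpha v")
      case False
      then show ?thesis using link_nonalpha(1)[OF l _ w] wS unfolding W_def by blast
    next
      case True
      show ?thesis
      proof (cases "d w = 2")
        case False
        then show ?thesis using link_alpha(1)[OF l True w] wS unfolding W_def by blast
      next
        case d2: True
        have vw: "v \<in> N w" by (rule N_sym[OF vS w])
        then have aw: "alpha w" unfolding alpha_def using d2 assms(2) by blast
        have bf: "bad (far v w)" by (rule link_alpha(2)[OF l True w d2])
        have N: "N w = {v, far v w}" by (rule two_far(1)[OF d2 vw])
        have Nv: "N v = {w, far w v}" by (rule two_far(1)[OF assms(2) w])
        obtain p where p: "p \<in> N v" "d p \<noteq> 2" using alpha_real[OF True vS] by force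
        then have "p = far w v" using Nv d2 by auto
        then have "bad (far w v)" using link_alpha(1)[OF l True p] by simp
        then have "link w" unfolding link_def using wS d2 aw bf N deg3(1) assms(2) by auto
        then show ?thesis using wS unfolding W_def by blast
      qed
    qed
  qed
  then have "nb W v = N v" using finW by auto
  then show ?thesis using assms(2) unfolding d_def by simp
qed

lemma two_balance:
  assumes v: "v \<in> S" "d v = 2"
  shows "(\<Sum>u \<in> N v. pay v u) \<le> charge v + (\<Sum>u \<in> N v. pay u v)"
proof -
  have ch: "charge v = -4" unfolding charge_def using link_W v(2) by simp
  show ?thesis
  proof (cases "alpha v")
    case True
    obtain p where p: "p \<in> N v" "d p \<noteq> 2" using alpha_real[OF True v(1)] by force
    define u where "u = far p v"
    have N: "N v = {p, u}" "u \<noteq> p" "u \<in> N v" using two_far[OF v(2) p(1)] unfolding u_def by auto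
    have u2: "d u = 2" using True p(2) N(1) unfolding alpha_def by auto
    have f: "far u v = p" by (rule far_eq[OF v(2)]) (use N in auto)
    have au: "alpha u" unfolding alpha_def using u2 v(2) N_sym[OF v(1) N(3)] by blast
    have "\<not> alpha p" using p(2) alpha_two by blast
    then have "pay v p = of_bool (bad p \<and> \<not> bad (far v u))" "pay v u = of_bool (\<not> bad p \<and> bad (far v u))"
      "pay p v = 4 + of_bool (\<not> bad p \<and> bad (far v u))" "pay u v = of_bool (\<not> bad (far v u) \<and> bad p)"
      unfolding pay_def using v(2) True p(2) u2 au f u_def by simp_all
    then show ?thesis unfolding N(1) ch using N(2) by (simp add: conj_commute)
  next
    case False
    obtain p q where N: "N v = {p, q}" "p \<noteq> q" using v(2) unfolding d_def card_2_iff by blast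
    have d2: "d p \<noteq> 2" "d q \<noteq> 2" using nonalpha_nb[OF v(2) False] N(1) by blast+
    have f: "far p v = q" "far q v = p" by (rule far_eq[OF v(2)], use N in auto)+
    have "pay v p = of_bool (weak p \<and> \<not> weak q \<and> \<not> triple q)" "pay v q = of_bool (weak q \<and> \<not> weak p \<and> \<not> triple p)"
      "pay p v = 2 + of_bool (\<not> weak p \<and> \<not> triple p \<and> weak q)" "pay q v = 2 + of_bool (\<not> weak q \<and> \<not> triple q \<and> weak p)"
      unfolding pay_def using v(2) False d2 f by simp_all
    then show ?thesis unfolding N(1) ch using N(2) by (simp add: conj_ac)
  qed
qed

lemma pay_le:
  assumes "d x \<noteq> 2"
  shows "pay x u \<le> 5" "\<not> alpha u \<Longrightarrow> pay x u \<le> 3" "d u \<noteq> 2 \<Longrightarrow> pay x u \<le> 1"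
  using assms alpha_two[of u] unfolding pay_def by (auto simp: of_bool_def)

lemma pay_from:
  assumes "d x \<noteq> 2"
  shows "bad x \<Longrightarrow> alpha u \<Longrightarrow> pay x u = 4" "\<not> alpha u \<Longrightarrow> d u = 2 \<Longrightarrow> weak x \<or> triple x \<Longrightarrow> pay x u = 2"
    "\<not> alpha u \<Longrightarrow> d u \<noteq> 2 \<Longrightarrow> bad x \<or> weak x \<Longrightarrow> pay x u = 0"
  using assms unfolding pay_def by auto

lemma received_nonneg: "0 \<le> (\<Sum>u \<in> N x. pay u x)"
  by (intro sum_nonneg pay_nonneg)

lemma bad_balance:
  assumes "bad x"
  shows "(\<Sum>u \<in> N x. pay x u) \<le> charge x + (\<Sum>u \<in> N x. pay u x)"
proof -
  have xS: "x \<in> S" and d3: "d x = 3" using assms unfolding bad_def by blast+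
  obtain a b y where N: "N x = {a, b, y}" "alpha a" "alpha b" "3 \<le> d y" using assms unfolding bad_def by blast
  have "\<not> alpha y" using N(4) alpha_two[of y] by auto
  then have out: "(\<Sum>u \<in> N x. pay x u) = 8"
    unfolding sum_three(1)[OF d3 N(1)] using pay_from[of x] d3 N assms by simp
  have "(\<Sum>u \<in> N x. of_bool (u \<notin> W)) \<le> (\<Sum>u \<in> N x. pay u x)"
    by (rule sum_mono) (use pay_missing[OF xS] pay_nonneg assms in \<open>simp add: of_bool_def del: in_nb\<close>)
  moreover have "x \<in> W" using assms xS unfolding W_def by blast
  ultimately show ?thesis unfolding charge_def out using d3 W_deg_missing[of x] by simp
qed

lemma weak_balance:
  assumes "weak x"
  shows "(\<Sum>u \<in> N x. pay x u) \<le> charge x + (\<Sum>u \<in> N x. pay u x)"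
proof -
  have xS: "x \<in> S" and d3: "d x = 3" using assms unfolding weak_def by blast+
  obtain a m y where N: "N x = {a, m, y}" "alpha a" "d m = 2" "\<not> alpha m" "3 \<le> d y"
    using assms unfolding weak_def by blast
  have ny: "\<not> alpha y" using N(5) alpha_two[of y] by auto
  then have out: "(\<Sum>u \<in> N x. pay x u) \<le> 7"
    unfolding sum_three(1)[OF d3 N(1)] using pay_from[of x] pay_le(1)[of x a] d3 N assms by simp
  have "of_bool (m \<notin> W) \<le> pay m x" "of_bool (y \<notin> W) \<le> pay y x"
    using pay_missing[OF xS] pay_nonneg assms N ny by (simp_all add: of_bool_def del: in_nb)
  then have "(\<Sum>u \<in> N x. of_bool (u \<notin> W)) - 1 \<le> (\<Sum>u \<in> N x. pay u x)"
    unfolding sum_three(1)[OF d3 N(1)] using pay_nonneg[of a x] by (simp add: of_bool_def split: if_splits)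
  moreover have "x \<in> W" using assms xS unfolding W_def by blast
  ultimately show ?thesis unfolding charge_def using out d3 W_deg_missing[of x] by simp
qed

lemma triple_balance:
  assumes "triple x"
  shows "(\<Sum>u \<in> N x. pay x u) \<le> charge x + (\<Sum>u \<in> N x. pay u x)"
proof -
  have xS: "x \<in> S" and d3: "d x = 3" using assms unfolding triple_def by blast+
  have "pay x u = 2" if "u \<in> N x" for u
    by (rule pay_from(2)) (use triple_nb[OF assms that] d3 assms in simp_all)
  then have out: "(\<Sum>u \<in> N x. pay x u) = 6" using d3 unfolding d_def by simp
  have "card {m \<in> N x. weak (far x m)} = 2" using assms unfolding triple_def by blast
  then have "{m \<in> N x. weak (far x m)} \<noteq> {}" by (metis card.empty zero_neq_numeral)
  then obtain m where m: "m \<in> N x" "weak (far x m)" by blast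
  have t: "d m = 2" "\<not> alpha m" using triple_nb[OF assms m(1)] by blast+
  note f = far_in[OF xS m(1) t(1)]
  have "link m" unfolding link_def using t f(5,6) m(2) assms by (auto simp: insert_commute)
  then have "m \<in> nb W x" using f unfolding W_def by simp
  then have "1 \<le> card (nb W x)" using finW(1) by (metis One_nat_def Suc_leI card_gt_0_iff empty_iff finite_nb)
  moreover have "x \<in> W" using assms xS unfolding W_def by blast
  ultimately show ?thesis unfolding charge_def out using d3 received_nonneg[of x] by simp
qed

lemma three_balance:
  assumes x: "x \<in> S" "d x = 3" "\<not> bad x" "\<not> weak x" "\<not> triple x"
  shows "(\<Sum>u \<in> N x. pay x u) \<le> charge x + (\<Sum>u \<in> N x. pay u x)"
proof -
  have "x \<notin> W" using W_cases[of x] x by auto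
  then have ch: "charge x = 7" unfolding charge_def using x(2) by simp
  have x2: "d x \<noteq> 2" using x(2) by simp
  note le = pay_le[OF x2]
  have deg: "d u = 2 \<or> 3 \<le> d u" if "u \<in> N x" for u using deg_ge_2[of u] that by auto
  have "(\<Sum>u \<in> N x. pay x u) \<le> 7"
  proof (cases "\<exists>y \<in> N x. 3 \<le> d y")
    case True
    then obtain y where y: "y \<in> N x" "3 \<le> d y" by blast
    have "card (N x - {y}) = 2" using x(2) y(1) unfolding d_def by simp
    then obtain b c where bc: "N x - {y} = {b, c}" unfolding card_2_iff by blast
    then have N: "N x = {b, c, y}" using y(1) by blast
    note s = sum_three[OF x(2) N]
    have py: "pay x y \<le> 1" by (rule le(3)) (use y(2) in simp)
    have real: "pay x w \<le> 1" if vw: "alpha v" and N': "N x = {v, w, y}" "v \<noteq> w" for v w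
    proof -
      have "w \<in> N x" using N'(1) by blast
      moreover have "\<not> alpha w"
        using x(1-3) vw N' y(2) unfolding bad_def by blast
      moreover have "d w \<noteq> 2" if "\<not> alpha w"
        using x(1,2,4) vw N' y(2) that unfolding weak_def by blast
      ultimately show ?thesis using le(3) by blast
    qed
    show ?thesis
    proof (cases "alpha b \<or> alpha c")
      case True
      have "pay x b + pay x c \<le> 6"
        using True
      proof
        assume "alpha b"
        then show ?thesis using real[OF _ N s(2)] le(1)[of b] by simp
      next
        assume "alpha c"
        moreover have "N x = {c, b, y}" using N by blast
        ultimately show ?thesis using real[of c b] s(2) le(1)[of c] by simp
      qed
      then show ?thesis unfolding s(1) using py by simp
    next
      case False
      then show ?thesis unfolding s(1) using py le(2)[of b] le(2)[of c] by simp
    qed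
  next
    case False
    then have two: "\<forall>m \<in> N x. d m = 2 \<and> \<not> alpha m" using alpha_3_neighbour[OF x(1,2)] deg by blast
    let ?w = "{m \<in> N x. weak (far x m)}"
    have "card ?w \<le> 1"
    proof -
      have "card ?w \<noteq> 2" using x(1,2,5) two unfolding triple_def by blast
      moreover have "card ?w \<noteq> 3"
      proof
        assume "card ?w = 3"
        then have "?w = N x" using x(2) finN unfolding d_def by (intro card_subset_eq) auto
        then show False using not_all_weak[OF x(1,2) two] by blast
      qed
      moreover have "card ?w \<le> 3" using x(2) card_mono[OF finN, of ?w x] unfolding d_def by (auto simp del: in_nb)
      ultimately show ?thesis by linarith
    qed
    moreover have "(\<Sum>u \<in> N x. pay x u) = (\<Sum>u \<in> N x. 2 + of_bool (weak (far x u)))"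
      by (rule sum.cong) (use two x in \<open>simp_all add: pay_def del: in_nb\<close>)
    moreover have "(\<Sum>u \<in> N x. of_bool (weak (far x u))) = int (card ?w)"
      using finN by (simp add: of_bool_def sum.If_cases Int_def del: in_nb)
    ultimately show ?thesis using x(2) unfolding d_def by (simp add: sum.distrib)
  qed
  then show ?thesis unfolding ch using received_nonneg[of x] by simp
qed

lemma big_balance:
  assumes x: "x \<in> S" "4 \<le> d x"
  shows "(\<Sum>u \<in> N x. pay x u) \<le> charge x + (\<Sum>u \<in> N x. pay u x)"
proof -
  have "x \<notin> W" using W_cases[of x] x by auto
  then have ch: "charge x = 11 * int (d x) - 26" unfolding charge_def by simp
  have x2: "d x \<noteq> 2" using x(2) by simp
  obtain b where b: "b \<in> N x" "\<not> alpha b" using not_all_alpha[OF x(1)] x(2) by auto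
  have "(\<Sum>u \<in> N x. pay x u) = pay x b + (\<Sum>u \<in> N x - {b}. pay x u)" by (rule sum.remove[OF finN b(1)])
  also have "\<dots> \<le> 3 + (\<Sum>u \<in> N x - {b}. 5)"
    by (intro add_mono sum_mono pay_le[OF x2] b(2))
  also have "\<dots> = 3 + 5 * (int (d x) - 1)"
    using b(1) x(2) unfolding d_def by (simp add: of_nat_diff del: in_nb)
  finally show ?thesis unfolding ch using received_nonneg[of x] x(2) by simp
qed

lemma sum_ge_4_colours: "0 \<le> (\<Sum>v \<in> S. 11 * int (d v) - 26)"
proof -
  have "0 \<le> (\<Sum>v \<in> S. charge v)"
  proof (rule discharge[of pay])
    fix v assume v: "v \<in> S"
    consider "d v = 2" | "d v = 3" | "4 \<le> d v" using deg_ge_2[OF v] by linarith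
    then show "(\<Sum>u \<in> N v. pay v u) \<le> charge v + (\<Sum>u \<in> N v. pay u v)"
      using two_balance[OF v] big_balance[OF v] bad_balance weak_balance triple_balance three_balance[OF v]
      by cases blast+
  qed
  also have "\<dots> = (\<Sum>v \<in> S. 11 * int (d v) - 26) - (\<Sum>v \<in> S. if v \<in> W then 2 - int (card (nb W v)) else 0)"
    unfolding charge_def by (simp add: sum_subtractf)
  also have "(\<Sum>v \<in> S. if v \<in> W then 2 - int (card (nb W v)) else 0) = (\<Sum>v \<in> W. 2 - int (card (nb W v)))"
    using finS finW(2) by (simp add: sum.If_cases Int_absorb1)
  also have "\<dots> = 2 * int (card W) - int (\<Sum>v \<in> W. card (nb W v))"
    by (simp add: sum_subtractf)
  finally show ?thesis using W_deg_sum by linarith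
qed

end

section \<open>From good colourings to star colourings\<close>

lemma mod_three:
  fixes a b :: nat
  assumes "a < 3" "b < 3"
  shows "(a + 1) mod 3 \<noteq> a" "(b + 1) mod 3 = a \<Longrightarrow> (a + 1) mod 3 \<noteq> b"
    "a \<noteq> b \<Longrightarrow> b = (a + 1) mod 3 \<or> a = (b + 1) mod 3"
proof -
  have "a = 0 \<or> a = 1 \<or> a = 2" "b = 0 \<or> b = 1 \<or> b = 2" using assms by linarith+
  then show "(a + 1) mod 3 \<noteq> a" "(b + 1) mod 3 = a \<Longrightarrow> (a + 1) mod 3 \<noteq> b"
    "a \<noteq> b \<Longrightarrow> b = (a + 1) mod 3 \<or> a = (b + 1) mod 3" by (elim disjE; simp)+
qed

context sgraph
begin

lemma forest_levels:
  assumes "finite F" "forest_on F"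
  shows "\<exists>l. (\<forall>v. l v < (3::nat)) \<and> (\<forall>u \<in> F. \<forall>v \<in> F. E u v \<longrightarrow> l u \<noteq> l v) \<and>
    (\<forall>v \<in> F. \<forall>u \<in> F. \<forall>w \<in> F. E v u \<and> E v w \<and> l v = (l u + 1) mod 3 \<and> l v = (l w + 1) mod 3 \<longrightarrow> u = w)"
  using assms
proof (induction "card F" arbitrary: F)
  case 0
  then show ?case by (intro exI[of _ "\<lambda>_. 0"]) simp
next
  case (Suc k)
  then have "F \<noteq> {}" by auto
  then obtain x where x: "x \<in> F" "card (nb F x) \<le> 1" using Suc(4) unfolding forest_on_def by blast
  have "\<exists>l. (\<forall>v. l v < (3::nat)) \<and> (\<forall>u \<in> F - {x}. \<forall>v \<in> F - {x}. E u v \<longrightarrow> l u \<noteq> l v) \<and>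
    (\<forall>v \<in> F - {x}. \<forall>u \<in> F - {x}. \<forall>w \<in> F - {x}.
      E v u \<and> E v w \<and> l v = (l u + 1) mod 3 \<and> l v = (l w + 1) mod 3 \<longrightarrow> u = w)"
  proof (rule Suc(1))
    show "k = card (F - {x})" using Suc(2,3) x(1) by simp
    show "forest_on (F - {x})" by (rule forest_on_mono[OF Suc(4)]) blast
  qed (use Suc(3) in simp)
  then obtain l where l: "\<forall>v. l v < (3::nat)" "\<forall>u \<in> F - {x}. \<forall>v \<in> F - {x}. E u v \<longrightarrow> l u \<noteq> l v"
    "\<forall>v \<in> F - {x}. \<forall>u \<in> F - {x}. \<forall>w \<in> F - {x}.
      E v u \<and> E v w \<and> l v = (l u + 1) mod 3 \<and> l v = (l w + 1) mod 3 \<longrightarrow> u = w"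
    by (elim exE conjE) (rule that)
  obtain p where p: "nb F x \<subseteq> {p}"
  proof -
    have "finite (nb F x)" using Suc(3) by simp
    then have "\<forall>u \<in> nb F x. \<forall>u' \<in> nb F x. u = u'" using x(2) card_le_Suc0_iff_eq by (metis One_nat_def)
    then show thesis using that by blast
  qed
  define l' where "l' = l(x := (l p + 1) mod 3)"
  have nx: "u = p" if "u \<in> F" "E x u" for u using p that by auto
  have nx': "u = p" if "u \<in> F" "E u x" for u using nx[OF that(1)] sym[OF that(2)] by blast
  have lt: "l v < 3" for v using l(1) by blast
  have px: "l' p = l p" "p \<noteq> x" if "p \<in> F" "E x p" using that irrefl unfolding l'_def by auto
  have "\<forall>v. l' v < 3" using l(1) unfolding l'_def by simp
  moreover have "\<forall>u \<in> F. \<forall>v \<in> F. E u v \<longrightarrow> l' u \<noteq> l' v"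
  proof (intro ballI impI)
    fix u v assume uv: "u \<in> F" "v \<in> F" "E u v"
    consider "u = x" | "v = x" | "u \<noteq> x" "v \<noteq> x" by blast
    then show "l' u \<noteq> l' v"
    proof cases
      case 1
      then have "v = p" "v \<noteq> x" using nx uv irrefl by auto
      then show ?thesis using 1 mod_three(1)[OF lt lt, of p] unfolding l'_def by simp
    next
      case 2
      then have "u = p" "u \<noteq> x" using nx' uv irrefl by auto
      then show ?thesis using 2 mod_three(1)[OF lt lt, of p] unfolding l'_def by (metis fun_upd_other fun_upd_same)
    next
      case 3
      then show ?thesis using l(2) uv unfolding l'_def by simp
    qed
  qed
  moreover have "\<forall>v \<in> F. \<forall>u \<in> F. \<forall>w \<in> F. E v u \<and> E v w \<and> l' v = (l' u + 1) mod 3 \<and> l' v = (l' w + 1) mod 3 \<longrightarrow> u = w"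
  proof (intro ballI impI, elim conjE)
    fix v u w assume m: "v \<in> F" "u \<in> F" "w \<in> F" and e: "E v u" "E v w"
      and lv: "l' v = (l' u + 1) mod 3" "l' v = (l' w + 1) mod 3"
    have no: "l' v \<noteq> (l' x + 1) mod 3" if "E v x"
    proof -
      have "v = p" "v \<noteq> x" using nx'[OF m(1) that] that irrefl by auto
      then show ?thesis using mod_three(2)[of "l' x" "l p"] l(1) unfolding l'_def by auto
    qed
    show "u = w"
    proof (cases "v = x")
      case True
      then show ?thesis using nx m e by blast
    next
      case False
      moreover have "u \<noteq> x" "w \<noteq> x" using no e lv by auto
      ultimately show ?thesis using l(3) m e lv unfolding l'_def by (metis DiffI fun_upd_other singletonD)
    qed
  qed
  ultimately show ?case by blast
qed

lemma good_star_colouring: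
  assumes g: "good r T \<phi>" and fin: "finite T"
  shows "\<exists>c. (\<forall>v \<in> T. c v < r + 3) \<and> (\<forall>u \<in> T. \<forall>v \<in> T. E u v \<longrightarrow> c u \<noteq> c v) \<and>
    (\<forall>a \<in> T. \<forall>b \<in> T. \<forall>x \<in> T. \<forall>y \<in> T. E a b \<and> E b x \<and> E x y \<and> c a = c x \<and> c b = c y \<longrightarrow> a = x \<or> b = y)"
proof -
  let ?F = "{v \<in> T. \<phi> v = 0}"
  have "forest_on ?F" using g unfolding good_def by blast
  then obtain l where l: "\<forall>v. l v < (3::nat)" "\<forall>u \<in> ?F. \<forall>v \<in> ?F. E u v \<longrightarrow> l u \<noteq> l v"
    "\<forall>v \<in> ?F. \<forall>u \<in> ?F. \<forall>w \<in> ?F. E v u \<and> E v w \<and> l v = (l u + 1) mod 3 \<and> l v = (l w + 1) mod 3 \<longrightarrow> u = w"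
    using forest_levels[of ?F] fin by auto
  define c where "c v = (if \<phi> v = 0 then l v else \<phi> v + 2)" for v
  have eq: "\<phi> u = \<phi> v \<and> (\<phi> u = 0 \<longrightarrow> l u = l v)" if "c u = c v" for u v
  proof -
    have "l u < 3" "l v < 3" using l(1) by blast+
    then show ?thesis using that unfolding c_def by (auto split: if_splits)
  qed
  have proper: "c u \<noteq> c v" if "u \<in> T" "v \<in> T" "E u v" for u v
  proof
    assume "c u = c v"
    then have e: "\<phi> u = \<phi> v" "\<phi> u = 0 \<longrightarrow> l u = l v" using eq by blast+
    then have "\<phi> u = 0" using good_edge[OF g that] by blast
    then show False using e l(2) that by simp
  qed
  have "a = x \<or> b = y" if T: "a \<in> T" "b \<in> T" "x \<in> T" "y \<in> T" and e: "E a b" "E b x" "E x y"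
    and c: "c a = c x" "c b = c y" for a b x y
  proof -
    have p: "\<phi> a = \<phi> x" "\<phi> b = \<phi> y" using eq c by blast+
    consider "\<phi> b < \<phi> a" | "\<phi> a < \<phi> b" | "\<phi> a = 0" "\<phi> b = 0"
      using good_edge[OF g T(1,2) e(1)] by (cases "\<phi> a" "\<phi> b" rule: linorder_cases) auto
    then show ?thesis
    proof cases
      case 1
      then show ?thesis using good_centre[OF g T(2,1,3) sym[OF e(1)] e(2) p(1)] by simp
    next
      case 2
      then show ?thesis using good_centre[OF g T(3,2,4) sym[OF e(2)] e(3) p(2)] p by simp
    next
      case 3
      have F: "a \<in> ?F" "b \<in> ?F" "x \<in> ?F" "y \<in> ?F" using 3 T p by auto
      have ll: "l a = l x" "l b = l y" using eq c 3 by blast+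
      have ne: "l a \<noteq> l b" using l(2) F e(1) by blast
      have "l a < 3" "l b < 3" using l(1) by blast+
      then have "l b = (l a + 1) mod 3 \<or> l a = (l b + 1) mod 3" using mod_three(3) ne by blast
      then consider "l b = (l a + 1) mod 3" | "l a = (l b + 1) mod 3" by blast
      then show ?thesis
      proof cases
        case 1
        then have "a = x" using l(3)[rule_format, OF F(2,1,3)] e sym ll by simp
        then show ?thesis by blast
      next
        case 2
        then have "b = y" using l(3)[rule_format, OF F(3,2,4)] e sym ll by simp
        then show ?thesis by blast
      qed
    qed
  qed
  moreover have "c v < r + 3" if "v \<in> T" for v
    using good_le[OF g that] l(1)[rule_format, of v] unfolding c_def by (simp add: trans_less_add2)
  ultimately show ?thesis using proper by (intro exI[of _ c]) blast
qed

lemma mincex_exists: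
  assumes "finite V" "1 \<le> r" "\<And>\<phi>. \<not> good r V \<phi>"
  shows "\<exists>S \<subseteq> V. S \<noteq> {} \<and> mincex E S r"
proof -
  define Z where "Z = {S. S \<subseteq> V \<and> (\<forall>\<phi>. \<not> good r S \<phi>)}"
  have V: "V \<in> Z" using assms(3) unfolding Z_def by blast
  have "finite Z" using finite_subset[of Z "Pow V"] assms(1) unfolding Z_def by blast
  from finite_has_minimal2[OF this V] obtain S where S: "S \<in> Z" "\<forall>b \<in> Z. b \<subseteq> S \<longrightarrow> S = b" by blast
  then have S': "T \<notin> Z" if "T \<subset> S" for T using that by blast
  have fS: "finite S" using S(1) assms(1) finite_subset unfolding Z_def by blast
  have "mincex E S r"
  proof unfold_locales
    show "\<exists>\<phi>. good r T \<phi>" if "T \<subset> S" for T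
      using S(1) S'[OF that] that unfolding Z_def by blast
  qed (use fS assms(2) S(1) in \<open>auto simp: Z_def\<close>)
  moreover have "S \<noteq> {}"
  proof
    assume "S = {}"
    moreover have "good r {} (\<lambda>_. 0)" unfolding good_def forest_on_def by simp
    ultimately show False using S(1) unfolding Z_def by blast
  qed
  ultimately show ?thesis using S(1) unfolding Z_def by blast
qed

end

lemma star_component:
  assumes "graph H" and sc: "strongly_connected H"
    and noP4: "\<And>a b x y. \<lbrakk>(a, b) \<in> arcs_ends H; (b, x) \<in> arcs_ends H; (x, y) \<in> arcs_ends H\<rbrakk> \<Longrightarrow> a = x \<or> b = y"
  shows "\<exists>m. complete_bipartite_digraph 1 m H"
proof -
  interpret graph H by fact
  have sym: "(v, u) \<in> arcs_ends H" if "(u, v) \<in> arcs_ends H" for u v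
    using sym_arcs that unfolding symmetric_def by (rule symD)
  have irr: "(u, u) \<notin> arcs_ends H" for u using adj_not_same by blast
  obtain u where u: "u \<in> verts H"
    "(\<exists>w w'. w \<noteq> w' \<and> (u, w) \<in> arcs_ends H \<and> (u, w') \<in> arcs_ends H) \<or>
     (\<forall>v w w'. (v, w) \<in> arcs_ends H \<and> (v, w') \<in> arcs_ends H \<longrightarrow> w = w')"
  proof (cases "\<exists>v w w'. w \<noteq> w' \<and> (v, w) \<in> arcs_ends H \<and> (v, w') \<in> arcs_ends H")
    case True
    then show thesis using that adj_in_verts(1) by blast
  next
    case False
    moreover have "verts H \<noteq> {}" using sc unfolding strongly_connected_def by blast
    ultimately show thesis using that by blast
  qed
  have return: "z = u" if w: "(u, w) \<in> arcs_ends H" "(w, z) \<in> arcs_ends H" for w z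
  proof (rule ccontr)
    assume ne: "z \<noteq> u"
    have "\<exists>w'. w' \<noteq> w \<and> (u, w') \<in> arcs_ends H"
      using u(2) ne w sym by metis
    then obtain w' where "w' \<noteq> w" "(w', u) \<in> arcs_ends H" using sym by blast
    then show False using noP4[of w' u w z] w ne by blast
  qed
  define V where "V = {w. (u, w) \<in> arcs_ends H}"
  have reach: "w = u \<or> w \<in> V" if "(u, w) \<in> rtrancl_on (verts H) (arcs_ends H)" for w
    using that
  proof (induction rule: rtrancl_on_induct)
    case base
    show ?case by simp
  next
    case (step w z)
    then show ?case using return unfolding V_def by blast
  qed
  have "verts H = {u} \<union> V"
  proof
    show "verts H \<subseteq> {u} \<union> V"
      using reach sc u(1) unfolding strongly_connected_def reachable_def by blast
    show "{u} \<union> V \<subseteq> verts H" using u(1) adj_in_verts(2) unfolding V_def by blast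
  qed
  moreover have "arcs_ends H = {u} \<times> V \<union> V \<times> {u}"
  proof
    show "arcs_ends H \<subseteq> {u} \<times> V \<union> V \<times> {u}"
    proof
      fix e assume e: "e \<in> arcs_ends H"
      obtain a b where ab: "e = (a, b)" by fastforce
      have "a \<in> {u} \<union> V" using e ab adj_in_verts(1) calculation by blast
      then show "e \<in> {u} \<times> V \<union> V \<times> {u}" using e ab return unfolding V_def by blast
    qed
    show "{u} \<times> V \<union> V \<times> {u} \<subseteq> arcs_ends H" using sym unfolding V_def by blast
  qed
  moreover have "{u} \<inter> V = {}" using irr unfolding V_def by blast
  ultimately have "complete_bipartite_digraph 1 (card V) H"
    unfolding complete_bipartite_digraph_def using assms(1) by (intro conjI exI[of _ "{u}"] exI[of _ V]) simp_all
  then show ?thesis by blast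
qed

context graph
begin

lemma arcs_ends_induce: "(u, v) \<in> arcs_ends (G \<restriction> X) \<longleftrightarrow> u \<in> X \<and> v \<in> X \<and> (u, v) \<in> arcs_ends G"
  by (auto simp: arcs_ends_def arc_to_ends_def)

lemma graph_induce: assumes "X \<subseteq> verts G" shows "graph (G \<restriction> X)" "subgraph (G \<restriction> X) G"
proof -
  interpret I: wf_digraph "G \<restriction> X" by unfold_locales auto
  show "graph (G \<restriction> X)"
  proof unfold_locales
    show "finite (verts (G \<restriction> X))" using finite_subset[OF assms finite_verts] by simp
    show "finite (arcs (G \<restriction> X))" by simp
    show "tail (G \<restriction> X) e \<noteq> head (G \<restriction> X) e" if "e \<in> arcs (G \<restriction> X)" for e
      using that no_loops by simp
    show "e = e'" if "e \<in> arcs (G \<restriction> X)" "e' \<in> arcs (G \<restriction> X)"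
      "arc_to_ends (G \<restriction> X) e = arc_to_ends (G \<restriction> X) e'" for e e'
      using that no_multi_arcs[of e e'] by (simp add: arc_to_ends_def)
    show "symmetric (G \<restriction> X)"
      using sym_arcs unfolding symmetric_def sym_def arcs_ends_induce by blast
  qed
  show "subgraph (G \<restriction> X) G"
    unfolding subgraph_def using assms I.wf_digraph wf_digraph by (auto simp: compatible_def)
qed

lemma star_coloringI:
  assumes proper: "\<And>u v. (u, v) \<in> arcs_ends G \<Longrightarrow> c u \<noteq> c v"
    and noP4: "\<And>a b x y. \<lbrakk>(a, b) \<in> arcs_ends G; (b, x) \<in> arcs_ends G; (x, y) \<in> arcs_ends G; c a = c x; c b = c y\<rbrakk>
      \<Longrightarrow> a = x \<or> b = y"
  shows "star_coloring G c"
  unfolding star_coloring_def proper_coloring_def star_forest_def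
proof (intro conjI allI impI ballI)
  show "case e of (u, v) \<Rightarrow> c u \<noteq> c v" if "e \<in> arcs_ends G" for e using proper that by auto
  fix i j H
  let ?X = "color_class G c i \<union> color_class G c j"
  assume H: "H \<in> pre_digraph.sccs (G \<restriction> ?X)"
  have X: "?X \<subseteq> verts G" unfolding color_class_def by blast
  interpret I: graph "G \<restriction> ?X" by (rule graph_induce(1)[OF X])
  have ind: "induced_subgraph H (G \<restriction> ?X)" and sc: "strongly_connected H"
    using H unfolding I.sccs_def by blast+
  have eq: "(G \<restriction> ?X) \<restriction> verts H = H" by (rule I.induce_eq_iff_induced[OF ind])
  have sub: "verts H \<subseteq> verts (G \<restriction> ?X)" using ind unfolding induced_subgraph_def subgraph_def by blast
  have gH: "graph H" using I.graph_induce(1)[OF sub] unfolding eq .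
  have arc: "(u, v) \<in> arcs_ends G \<and> u \<in> ?X \<and> v \<in> ?X" if "(u, v) \<in> arcs_ends H" for u v
    using that I.arcs_ends_induce[of u v "verts H"] arcs_ends_induce[of u v ?X] unfolding eq by blast
  have col: "c u = i \<or> c u = j" if "u \<in> ?X" for u using that unfolding color_class_def by blast
  show "\<exists>m. complete_bipartite_digraph 1 m H"
  proof (rule star_component[OF gH sc])
    fix a b x y assume "(a, b) \<in> arcs_ends H" "(b, x) \<in> arcs_ends H" "(x, y) \<in> arcs_ends H"
    then have e: "(a, b) \<in> arcs_ends G" "(b, x) \<in> arcs_ends G" "(x, y) \<in> arcs_ends G"
      "a \<in> ?X" "b \<in> ?X" "x \<in> ?X" "y \<in> ?X" using arc by blast+
    have "c a \<noteq> c b" "c b \<noteq> c x" "c x \<noteq> c y" using proper e(1-3) by blast+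
    then have "c a = c x" "c b = c y" using col e(4-7) by metis+
    then show "a = x \<or> b = y" using noP4 e(1-3) by blast
  qed
qed

lemma card_arcs_ends_le: "card (arcs_ends G) \<le> 2 * card (edges G)"
proof -
  have fin: "finite (arcs_ends G)" unfolding arcs_ends_def by simp
  have im: "edges G = (\<lambda>(u, v). {u, v}) ` arcs_ends G" unfolding edges_def by auto
  have "arcs_ends G \<subseteq> (\<Union>e \<in> edges G. {(u, v). e = {u, v}})" unfolding im by auto
  moreover have two: "finite {(u, v). e = {u, v}} \<and> card {(u, v). e = {u, v}} \<le> 2" if "e \<in> edges G" for e
  proof -
    have "\<exists>a b. e = {a, b}" using that unfolding edges_def by blast
    then obtain a b where "e = {a, b}" by blast
    then have sub: "{(u, v). e = {u, v}} \<subseteq> {(a, b), (b, a)}" by (auto simp: doubleton_eq_iff)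
    have fin2: "finite {(a, b), (b, a)}" by blast
    have "card {(a, b), (b, a)} \<le> 2" using card_length[of "[(a, b), (b, a)]"] by simp
    then show ?thesis using le_trans[OF card_mono[OF fin2 sub]] finite_subset[OF sub fin2] by blast
  qed
  moreover have "finite (edges G)" unfolding im using fin by simp
  ultimately have "card (arcs_ends G) \<le> card (\<Union>e \<in> edges G. {(u, v). e = {u, v}})"
    by (intro card_mono) auto
  also have "\<dots> \<le> (\<Sum>e \<in> edges G. card {(u, v). e = {u, v}})"
    by (rule card_UN_le) fact
  also have "\<dots> \<le> (\<Sum>e \<in> edges G. 2)" by (rule sum_mono) (use two in blast)
  finally show ?thesis by simp
qed

lemma average_le_Mad:
  assumes S: "S \<subseteq> verts G" "S \<noteq> {}"
  shows "real (\<Sum>v \<in> S. card {u \<in> S. (v, u) \<in> arcs_ends G}) \<le> Mad G * real (card S)"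
proof -
  let ?H = "G \<restriction> S"
  let ?M = "{2 * real (card (edges H)) / real (card (verts H)) |H. subgraph H G \<and> graph H \<and> verts H \<noteq> {}}"
  interpret H: graph ?H by (rule graph_induce(1)[OF S(1)])
  have finS: "finite S" by (rule finite_subset[OF S(1) finite_verts])
  have finE: "finite (edges G)"
  proof -
    have "edges G = (\<lambda>(u, v). {u, v}) ` arcs_ends G" unfolding edges_def by auto
    then show ?thesis unfolding arcs_ends_def by simp
  qed
  have "?M \<subseteq> (\<lambda>(a, b). 2 * real a / real b) ` ({..card (edges G)} \<times> {..card (verts G)})"
  proof
    fix q assume "q \<in> ?M"
    then obtain H where H: "q = 2 * real (card (edges H)) / real (card (verts H))" "subgraph H G" by blast
    have "arcs_ends H \<subseteq> arcs_ends G"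
      using H(2) unfolding subgraph_def compatible_def arcs_ends_def arc_to_ends_def by auto
    then have "edges H \<subseteq> edges G" unfolding edges_def by blast
    then have "card (edges H) \<le> card (edges G)" by (rule card_mono[OF finE])
    moreover have "card (verts H) \<le> card (verts G)"
      using H(2) unfolding subgraph_def by (intro card_mono) auto
    ultimately show "q \<in> (\<lambda>(a, b). 2 * real a / real b) ` ({..card (edges G)} \<times> {..card (verts G)})"
      unfolding H(1) by (intro image_eqI[of _ _ "(card (edges H), card (verts H))"]) auto
  qed
  then have "finite ?M" by (rule finite_subset) simp
  moreover have "2 * real (card (edges ?H)) / real (card (verts ?H)) \<in> ?M"
    using graph_induce[OF S(1)] S(2) by (intro CollectI exI[of _ ?H]) simp
  ultimately have "2 * real (card (edges ?H)) / real (card (verts ?H)) \<le> Mad G"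
    unfolding Mad_def by (rule Max_ge)
  moreover have "0 < card S" using S(2) finS by (simp add: card_gt_0_iff)
  ultimately have le: "2 * real (card (edges ?H)) \<le> Mad G * real (card S)" by (simp add: divide_le_eq)
  have "(\<Sum>v \<in> S. card {u \<in> S. (v, u) \<in> arcs_ends G}) = card (SIGMA v:S. {u \<in> S. (v, u) \<in> arcs_ends G})"
    using finS by simp
  also have "(SIGMA v:S. {u \<in> S. (v, u) \<in> arcs_ends G}) = arcs_ends ?H"
    using arcs_ends_induce by auto
  also have "card \<dots> \<le> 2 * card (edges ?H)" by (rule H.card_arcs_ends_le)
  finally show ?thesis using le by linarith
qed

lemma cycle_length_ge:
  assumes "6 \<le> girth G" "cycle p" "3 \<le> length p"
  shows "6 \<le> length p"
proof -
  have "girth G \<le> enat (length p)" unfolding girth_def by (rule Inf_lower) (use assms in blast)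
  then have "enat 6 \<le> enat (length p)" using assms(1) by (metis numeral_eq_enat order_trans)
  then show ?thesis by simp
qed

lemma no_short_cycles:
  assumes g: "6 \<le> girth G"
  shows "\<lbrakk>(a, b) \<in> arcs_ends G; (b, c) \<in> arcs_ends G; (c, a) \<in> arcs_ends G\<rbrakk> \<Longrightarrow> False"
    and "\<lbrakk>(a, b) \<in> arcs_ends G; (b, c) \<in> arcs_ends G; (c, e) \<in> arcs_ends G; (e, a) \<in> arcs_ends G; a \<noteq> c; b \<noteq> e\<rbrakk> \<Longrightarrow> False"
    and "\<lbrakk>(a, b) \<in> arcs_ends G; (b, c) \<in> arcs_ends G; (c, e) \<in> arcs_ends G; (e, f) \<in> arcs_ends G; (f, a) \<in> arcs_ends G\<rbrakk> \<Longrightarrow> False"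
proof -
  have arc: "\<exists>x \<in> arcs G. tail G x = u \<and> head G x = v \<and> u \<noteq> v \<and> u \<in> verts G" if "(u, v) \<in> arcs_ends G" for u v
  proof -
    obtain x where "x \<in> arcs G" "tail G x = u" "head G x = v" using \<open>(u, v) \<in> arcs_ends G\<close> by (rule reachableE)
    then show ?thesis using no_loops[of x] by auto
  qed
  show tri: False if e: "(a, b) \<in> arcs_ends G" "(b, c) \<in> arcs_ends G" "(c, a) \<in> arcs_ends G" for a b c
  proof -
    obtain x y z where x: "x \<in> arcs G" "tail G x = a" "head G x = b" "a \<noteq> b" "a \<in> verts G"
      and y: "y \<in> arcs G" "tail G y = b" "head G y = c" "b \<noteq> c"
      and z: "z \<in> arcs G" "tail G z = c" "head G z = a" "c \<noteq> a"
      using arc[OF e(1)] arc[OF e(2)] arc[OF e(3)] by blast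
    have "cycle [x, y, z]" unfolding cycle_def awalk_def using x y z by (intro exI[of _ a]) auto
    from cycle_length_ge[OF g this] show False by simp
  qed
  show False if e: "(a, b) \<in> arcs_ends G" "(b, c) \<in> arcs_ends G" "(c, e) \<in> arcs_ends G" "(e, a) \<in> arcs_ends G"
    and ne: "a \<noteq> c" "b \<noteq> e" for a b c e
  proof -
    obtain w x y z where w: "w \<in> arcs G" "tail G w = a" "head G w = b" "a \<noteq> b" "a \<in> verts G"
      and x: "x \<in> arcs G" "tail G x = b" "head G x = c" "b \<noteq> c"
      and y: "y \<in> arcs G" "tail G y = c" "head G y = e" "c \<noteq> e"
      and z: "z \<in> arcs G" "tail G z = e" "head G z = a" "e \<noteq> a"
      using arc[OF e(1)] arc[OF e(2)] arc[OF e(3)] arc[OF e(4)] by blast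
    have "cycle [w, x, y, z]" unfolding cycle_def awalk_def using w x y z ne by (intro exI[of _ a]) auto
    from cycle_length_ge[OF g this] show False by simp
  qed
  show False if e: "(a, b) \<in> arcs_ends G" "(b, c) \<in> arcs_ends G" "(c, e) \<in> arcs_ends G" "(e, f) \<in> arcs_ends G"
    "(f, a) \<in> arcs_ends G"
  proof -
    have ne: "a \<noteq> c" "b \<noteq> e" "c \<noteq> f" "e \<noteq> a" "f \<noteq> b" using tri e by blast+
    obtain v w x y z where v: "v \<in> arcs G" "tail G v = a" "head G v = b" "a \<noteq> b" "a \<in> verts G"
      and w: "w \<in> arcs G" "tail G w = b" "head G w = c" "b \<noteq> c"
      and x: "x \<in> arcs G" "tail G x = c" "head G x = e" "c \<noteq> e"
      and y: "y \<in> arcs G" "tail G y = e" "head G y = f" "e \<noteq> f"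
      and z: "z \<in> arcs G" "tail G z = f" "head G z = a" "f \<noteq> a"
      using arc[OF e(1)] arc[OF e(2)] arc[OF e(3)] arc[OF e(4)] arc[OF e(5)] by blast
    have "cycle [v, w, x, y, z]" unfolding cycle_def awalk_def using v w x y z ne by (intro exI[of _ a]) auto
    from cycle_length_ge[OF g this] show False by simp
  qed
qed

abbreviation adj :: "'a \<Rightarrow> 'a \<Rightarrow> bool" where "adj u v \<equiv> (u, v) \<in> arcs_ends G"

lemma sgraph_adj: "sgraph adj"
  using sym_arcs adj_not_same unfolding symmetric_def sgraph_def by (blast dest: symD)

lemma star_chromatic_number_le:
  assumes "sgraph.good adj r (verts G) \<phi>"
  shows "star_chromatic_number G \<le> r + 3"
proof -
  interpret E: sgraph adj by (rule sgraph_adj)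
  obtain c :: "'a \<Rightarrow> nat" where c: "\<forall>v \<in> verts G. c v < r + 3" "\<forall>u \<in> verts G. \<forall>v \<in> verts G. adj u v \<longrightarrow> c u \<noteq> c v"
    "\<forall>a \<in> verts G. \<forall>b \<in> verts G. \<forall>x \<in> verts G. \<forall>y \<in> verts G.
      adj a b \<and> adj b x \<and> adj x y \<and> c a = c x \<and> c b = c y \<longrightarrow> a = x \<or> b = y"
    using E.good_star_colouring[OF assms finite_verts] by blast
  have "star_coloring G c"
  proof (rule star_coloringI)
    show "c u \<noteq> c v" if "adj u v" for u v using that adj_in_verts[OF that] c(2) by blast
    show "a = x \<or> b = y" if "adj a b" "adj b x" "adj x y" "c a = c x" "c b = c y" for a b x y
      using that adj_in_verts[OF that(1)] adj_in_verts[OF that(3)] c(3) by blast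
  qed
  then show ?thesis unfolding star_chromatic_number_def using c(1) by (intro Least_le exI[of _ c]) auto
qed

lemma degree_sum_less:
  assumes S: "S \<subseteq> verts G" "S \<noteq> {}" and Mad: "Mad G < real p / real q" and q: "0 < q"
  shows "(\<Sum>v \<in> S. int q * int (card (sgraph.nb adj S v)) - int p) < 0"
proof -
  interpret E: sgraph adj by (rule sgraph_adj)
  define D where "D = (\<Sum>v \<in> S. card (E.nb S v))"
  have "0 < card S" using S finite_subset[OF S(1) finite_verts] by (simp add: card_gt_0_iff)
  then have "Mad G * real (card S) < real p / real q * real (card S)"
    by (intro mult_strict_right_mono[OF Mad]) simp
  moreover have "real D \<le> Mad G * real (card S)"
    unfolding D_def E.nb_def by (rule average_le_Mad[OF S])
  ultimately have "real D < real p / real q * real (card S)" by linarith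
  then have "real q * real D < real p * real (card S)" using q by (simp add: field_simps)
  then have "q * D < p * card S" by (metis of_nat_less_iff of_nat_mult)
  then have "int q * int D < int p * int (card S)" by (metis of_nat_less_iff of_nat_mult)
  then show ?thesis unfolding D_def by (simp add: sum_subtractf sum_distrib_left mult.commute)
qed

end

theorem theorem2:
  fixes G :: "('a, 'b) pre_digraph"
  assumes "graph G"
  shows "(Mad G < 26 / 11 \<longrightarrow> star_chromatic_number G \<le> 4) \<and>
         (Mad G < 18 / 7 \<and> girth G \<ge> 6 \<longrightarrow> star_chromatic_number G \<le> 5) \<and>
         (Mad G < 8 / 3 \<and> girth G \<ge> 6 \<longrightarrow> star_chromatic_number G \<le> 6)"
proof -
  interpret graph G by fact
  interpret E: sgraph adj by (rule sgraph_adj)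
  have bound: "star_chromatic_number G \<le> r + 3"
    if r: "1 \<le> r" "0 < q" and Mad: "Mad G < real p / real q"
      and disch: "\<And>S. mincex adj S r \<Longrightarrow> 0 \<le> (\<Sum>v \<in> S. int q * int (card (E.nb S v)) - int p)" for r p q
  proof (rule ccontr)
    assume "\<not> ?thesis"
    then have no: "\<not> E.good r (verts G) \<phi>" for \<phi> using star_chromatic_number_le by blast
    obtain S where S: "S \<subseteq> verts G" "S \<noteq> {}" "mincex adj S r"
      using E.mincex_exists[OF finite_verts r(1) no] by blast
    show False using degree_sum_less[OF S(1,2) Mad r(2)] disch[OF S(3)] by linarith
  qed
  have six: "mincex6 adj S r" if "6 \<le> girth G" "mincex adj S r" "2 \<le> r" for S r
    unfolding mincex6_def mincex6_axioms_def
    using that(2,3) no_short_cycles[OF that(1)] by blast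
  have "star_chromatic_number G \<le> 4" if "Mad G < 26 / 11"
  proof -
    have "star_chromatic_number G \<le> 1 + 3"
    proof (rule bound[of 1 11 26])
      fix S assume "mincex adj S 1"
      then interpret mincex1 adj S by (rule mincex1.intro)
      show "0 \<le> (\<Sum>v \<in> S. int 11 * int (card (E.nb S v)) - int 26)"
        using sum_ge_4_colours unfolding d_def by simp
    qed (use that in simp_all)
    then show ?thesis by simp
  qed
  moreover have "star_chromatic_number G \<le> 5" if "Mad G < 18 / 7" "6 \<le> girth G"
  proof -
    have "star_chromatic_number G \<le> 2 + 3"
    proof (rule bound[of 2 7 18])
      fix S assume "mincex adj S 2"
      then interpret mincex6 adj S 2 by (rule six[OF that(2)]) simp
      show "0 \<le> (\<Sum>v \<in> S. int 7 * int (card (E.nb S v)) - int 18)"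
        using sum_ge_5_colours unfolding d_def by simp
    qed (use that in simp_all)
    then show ?thesis by simp
  qed
  moreover have "star_chromatic_number G \<le> 6" if "Mad G < 8 / 3" "6 \<le> girth G"
  proof -
    have "star_chromatic_number G \<le> 3 + 3"
    proof (rule bound[of 3 6 16])
      fix S assume "mincex adj S 3"
      then interpret mincex6 adj S 3 by (rule six[OF that(2)]) simp
      show "0 \<le> (\<Sum>v \<in> S. int 6 * int (card (E.nb S v)) - int 16)"
        using sum_ge_6_colours unfolding d_def by simp
    qed (use that in simp_all)
    then show ?thesis by simp
  qed
  ultimately show ?thesis by blast
qed

end
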